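(* Let $n,r\geq 1$ and let $m$ be a natural number. For any subset $X\subset P^+(n,r)_m$ there is an isomorphism of algebras $$\operatorname{End}_{S(n,r)}\Big(\bigoplus_{\alpha\in X}\textstyle\bigwedge^{\alpha}V\Big)\;\simeq\;\operatorname{End}_{S(n,nm-r)}\Big(\bigoplus_{\alpha\in X}\textstyle\bigwedge^{n-\alpha}V\Big).$$
   Context: Let $k$ be an infinite field and $0\ne q\in k$ (the classical case is $q=1$). Let $A(n)$ be the $k$-bialgebra generated by $c_{ij}$ ($1\le i,j\le n$) with relations $c_{ir}c_{is}=c_{is}c_{ir}$ for all $i,r,s$; $c_{jr}c_{is}=q\,c_{is}c_{jr}$ for $i<j$, $r\le s$; $c_{js}c_{ir}=c_{ir}c_{js}+(q-1)c_{is}c_{jr}$ for $i<j$, $r<s$; comultiplication $c_{ij}\mapsto\sum_l c_{il}\otimes c_{lj}$ and counit $c_{ij}\mapsto\delta_{ij}$. Let $A(n,r)$ be its homogeneous component of degree $r$, a subcoalgebra; the (classical or quantized) Schur algebra $S(n,r)$ is the dual algebra of $A(n,r)$, and $S(n,r)$-modules are the same as $A(n,r)$-comodules; $S(n,r)$-homomorphisms are the comodule homomorphisms. $V$ is the natural module with basis $v_1,\dots,v_n$ and left $A(n)$-comodule structure $v_i\mapsto\sum_j c_{ij}\otimes v_j$. The exterior algebra of $V$ has relations $v_i\wedge v_i=0$, $v_i\wedge v_j=-v_j\wedge v_i$; it is a left comodule algebra, and $\bigwedge^s V$ is its degree $s$ part. $P^+(n,r)_m$ is the set of partitions $\alpha=(\alpha_1\ge\dots\ge\alpha_m\ge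 0)$ of $r$ with at most $m$ parts and all parts $\le n$. For such $\alpha$, $\bigwedge^\alpha V=\bigwedge^{\alpha_1}V\otimes\dots\otimes\bigwedge^{\alpha_m}V$, a module for $S(n,r)$, and $n-\alpha=(n-\alpha_m,\dots,n-\alpha_1)\in P^+(n,nm-r)_m$. *)

theory Defs
  imports "HOL-Algebra.QuotRing" "HOL-Algebra.Module" "HOL-Library.Poly_Mapping"
begin

section \<open>Free associative algebras\<close>

datatype 'a word = Word (letters: "'a list")

instantiation word :: (type) monoid_add
begin

definition "0 = Word []"
definition "u + v = Word (letters u @ letters v)"

instance
  by standard (simp_all add: zero_word_def plus_word_def)

end

text \<open>The product of the type \<^typ>\<open>'x word \<Rightarrow>\<^sub>0 'k\<close> is convolution, so this is the free
  associative algebra on \<^typ>\<open>'x\<close>.  Only the letters in \<open>G\<close> are used as generators.\<close>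

definition free_alg :: "'x set \<Rightarrow> ('x word \<Rightarrow>\<^sub>0 'k::field) ring"
  where "free_alg G =
    \<lparr>carrier = {p. \<forall>w\<in>Poly_Mapping.keys p. set (letters w) \<subseteq> G},
     mult = (*), one = 1, zero = 0, add = (+)\<rparr>"

definition gen :: "'x \<Rightarrow> 'x word \<Rightarrow>\<^sub>0 'k::field"
  where "gen x = Poly_Mapping.single (Word [x]) 1"

definition const :: "'k \<Rightarrow> 'x word \<Rightarrow>\<^sub>0 'k::field"
  where "const a = Poly_Mapping.single 0 a"

lemma keys_mult_word:
  fixes p p' :: "'x word \<Rightarrow>\<^sub>0 'k::field"
  assumes "w \<in> Poly_Mapping.keys (p * p')"
  obtains u v where "u \<in> Poly_Mapping.keys p" "v \<in> Poly_Mapping.keys p'"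
    "letters w = letters u @ letters v"
proof -
  obtain u v where "w = u + v" "u \<in> Poly_Mapping.keys p" "v \<in> Poly_Mapping.keys p'"
    using subsetD[OF keys_mult assms] by blast
  then show thesis
    by (intro that[of u v]) (simp_all add: plus_word_def)
qed

lemma free_alg_simps:
  "p \<otimes>\<^bsub>free_alg G\<^esub> p' = p * p'"
  "p \<oplus>\<^bsub>free_alg G\<^esub> p' = p + p'"
  "\<one>\<^bsub>free_alg G\<^esub> = 1"
  "\<zero>\<^bsub>free_alg G\<^esub> = 0"
  by (simp_all add: free_alg_def)

lemma ring_free_alg: "ring (free_alg G :: ('x word \<Rightarrow>\<^sub>0 'k::field) ring)"
proof (rule ringI)
  let ?F = "free_alg G :: ('x word \<Rightarrow>\<^sub>0 'k::field) ring"
  have uminus: "- p \<in> carrier ?F" if "p \<in> carrier ?F" for p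
    using that by (simp add: free_alg_def)
  have add: "p + p' \<in> carrier ?F" if "p \<in> carrier ?F" "p' \<in> carrier ?F" for p p'
    using that subsetD[OF Poly_Mapping.keys_add[of p p']] unfolding free_alg_def by auto
  have mult: "p * p' \<in> carrier ?F" if pp': "p \<in> carrier ?F" "p' \<in> carrier ?F" for p p'
  proof -
    have "set (letters w) \<subseteq> G" if "w \<in> Poly_Mapping.keys (p * p')" for w
      using that by (rule keys_mult_word) (use pp' in \<open>auto simp: free_alg_def\<close>)
    then show ?thesis
      by (simp add: free_alg_def)
  qed
  have "0 \<in> carrier ?F" "1 \<in> carrier ?F"
    by (simp_all add: free_alg_def zero_word_def)
  note closed = add mult this
  show "abelian_group ?F"
  proof (rule abelian_groupI)
    fix p assume "p \<in> carrier ?F"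
    then show "\<exists>p'\<in>carrier ?F. p' \<oplus>\<^bsub>?F\<^esub> p = \<zero>\<^bsub>?F\<^esub>"
      using uminus by (intro bexI[of _ "- p"]) (simp_all add: free_alg_simps)
  qed (simp_all only: free_alg_simps closed add_ac add_0_left add_0_right)
  show "Group.monoid ?F"
    by (rule monoidI) (simp_all only: free_alg_simps closed mult.assoc mult_1_left mult_1_right)
qed (simp_all only: free_alg_simps distrib_right distrib_left)

lemma gen_in_free_alg [simp]: "x \<in> G \<Longrightarrow> gen x \<in> carrier (free_alg G)"
  by (simp add: gen_def free_alg_def)

lemma const_in_free_alg [simp]: "const a \<in> carrier (free_alg G)"
  by (simp add: const_def free_alg_def zero_word_def)


section \<open>The quantized coordinate algebra\<close>

type_synonym 'k coord = "((nat \<times> nat) word \<Rightarrow>\<^sub>0 'k) set"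

definition qrels :: "nat \<Rightarrow> 'k::field \<Rightarrow> ((nat \<times> nat) word \<Rightarrow>\<^sub>0 'k) set"
  where "qrels n q =
    {gen (i,r) * gen (i,s) - gen (i,s) * gen (i,r) | i r s.
       i \<in> {1..n} \<and> r \<in> {1..n} \<and> s \<in> {1..n}}
    \<union> {gen (j,r) * gen (i,s) - const q * (gen (i,s) * gen (j,r)) | i j r s.
       i \<in> {1..n} \<and> j \<in> {1..n} \<and> r \<in> {1..n} \<and> s \<in> {1..n} \<and> i < j \<and> r \<le> s}
    \<union> {gen (j,s) * gen (i,r)
         - (gen (i,r) * gen (j,s) + const (q - 1) * (gen (i,s) * gen (j,r))) | i j r s.
       i \<in> {1..n} \<and> j \<in> {1..n} \<and> r \<in> {1..n} \<and> s \<in> {1..n} \<and> i < j \<and> r < s}"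

abbreviation qfree :: "nat \<Rightarrow> ((nat \<times> nat) word \<Rightarrow>\<^sub>0 'k::field) ring"
  where "qfree n \<equiv> free_alg ({1..n} \<times> {1..n})"

definition qideal :: "nat \<Rightarrow> 'k::field \<Rightarrow> ((nat \<times> nat) word \<Rightarrow>\<^sub>0 'k) set"
  where "qideal n q = Idl\<^bsub>qfree n\<^esub> (qrels n q)"

text \<open>The elements of $A(n)$ are cosets.  The record type \<^typ>\<open>('k, 'a) module\<close> is used for (not
  necessarily commutative) algebras over the field type \<^typ>\<open>'k\<close>.\<close>

definition qcoset :: "nat \<Rightarrow> 'k::field \<Rightarrow> ((nat \<times> nat) word \<Rightarrow>\<^sub>0 'k) \<Rightarrow> 'k coord"
  where "qcoset n q p = qideal n q +>\<^bsub>qfree n\<^esub> p"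

definition A :: "nat \<Rightarrow> 'k::field \<Rightarrow> ('k, 'k coord) module"
  where "A n q =
    ring.extend (qfree n Quot qideal n q)
      (module.fields (\<lambda>a x. qcoset n q (const a) \<otimes>\<^bsub>qfree n Quot qideal n q\<^esub> x))"

definition c :: "nat \<Rightarrow> 'k::field \<Rightarrow> nat \<Rightarrow> nat \<Rightarrow> 'k coord"
  where "c n q i j = qcoset n q (gen (i,j))"

text \<open>The component $A(n,r)$ of degree $r$.  It is not closed under the product; below it is only
  used as a vector space.\<close>

definition A_deg :: "nat \<Rightarrow> nat \<Rightarrow> 'k::field \<Rightarrow> ('k, 'k coord) module"
  where "A_deg n r q =
    (A n q)\<lparr>carrier :=
      {qcoset n q p | p. p \<in> carrier (qfree n) \<and> (\<forall>w\<in>Poly_Mapping.keys p. length (letters w) = r)}\<rparr>"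

lemma qrels_subset: "qrels n q \<subseteq> carrier (qfree n)"
proof -
  interpret ring "qfree n :: ((nat \<times> nat) word \<Rightarrow>\<^sub>0 'a) ring" by (rule ring_free_alg)
  note m = m_closed[unfolded free_alg_simps] and a = a_closed[unfolded free_alg_simps]
  have d: "p - p' \<in> carrier (qfree n)" if "p \<in> carrier (qfree n)" "p' \<in> carrier (qfree n)"
    for p p' :: "(nat \<times> nat) word \<Rightarrow>\<^sub>0 'a"
  proof -
    have "- p' \<in> carrier (qfree n)"
      using that(2) by (simp add: free_alg_def)
    from a[OF that(1) this] show ?thesis
      by (simp only: diff_conv_add_uminus)
  qed
  show ?thesis
    unfolding qrels_def by (auto simp del: One_nat_def intro!: m a d gen_in_free_alg const_in_free_alg)
qed

lemma ideal_qideal: "ideal (qideal n q) (qfree n)"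
  unfolding qideal_def by (rule ring.genideal_ideal[OF ring_free_alg qrels_subset])

lemma A_simps:
  "carrier (A n q) = carrier (qfree n Quot qideal n q)"
  "x \<otimes>\<^bsub>A n q\<^esub> y = x \<otimes>\<^bsub>qfree n Quot qideal n q\<^esub> y"
  "x \<oplus>\<^bsub>A n q\<^esub> y = x \<oplus>\<^bsub>qfree n Quot qideal n q\<^esub> y"
  "\<zero>\<^bsub>A n q\<^esub> = \<zero>\<^bsub>qfree n Quot qideal n q\<^esub>"
  "\<one>\<^bsub>A n q\<^esub> = \<one>\<^bsub>qfree n Quot qideal n q\<^esub>"
  "a \<odot>\<^bsub>A n q\<^esub> x = qcoset n q (const a) \<otimes>\<^bsub>A n q\<^esub> x"
  by (simp_all add: A_def ring.defs module.defs)

lemma qcoset_ring_hom: "qcoset n q \<in> ring_hom (qfree n) (A n q)"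
  using ideal.rcos_ring_hom[OF ideal_qideal, of n q]
  unfolding ring_hom_def by (auto simp: A_simps qcoset_def[abs_def])

lemma ring_A: "ring (A n q)"
proof -
  let ?Q = "qfree n Quot qideal n q"
  interpret Q: ring ?Q by (rule ideal.quotient_is_ring[OF ideal_qideal])
  show ?thesis
  proof (rule ringI)
    show "abelian_group (A n q)"
    proof (rule abelian_groupI)
      fix x assume "x \<in> carrier (A n q)"
      then show "\<exists>y\<in>carrier (A n q). y \<oplus>\<^bsub>A n q\<^esub> x = \<zero>\<^bsub>A n q\<^esub>"
        unfolding A_simps using Q.l_neg Q.a_inv_closed by blast
    qed (simp_all del: One_nat_def add: A_simps Q.add.m_ac)
    show "Group.monoid (A n q)"
      by (rule monoidI) (simp_all del: One_nat_def add: A_simps Q.m_assoc)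
  qed (simp_all del: One_nat_def add: A_simps Q.l_distr Q.r_distr)
qed


lemma qcoset_in_A: "p \<in> carrier (qfree n) \<Longrightarrow> qcoset n q p \<in> carrier (A n q)"
  using qcoset_ring_hom by (rule ring_hom_closed)

lemma A_deg_memI:
  "p \<in> carrier (qfree n) \<Longrightarrow> (\<And>w. w \<in> Poly_Mapping.keys p \<Longrightarrow> length (letters w) = r)
    \<Longrightarrow> qcoset n q p \<in> carrier (A_deg n r q)"
  unfolding A_deg_def by auto

lemma A_deg_memE:
  assumes "x \<in> carrier (A_deg n r q)"
  obtains p where "x = qcoset n q p" "p \<in> carrier (qfree n)"
    "\<And>w. w \<in> Poly_Mapping.keys p \<Longrightarrow> length (letters w) = r"
  using assms unfolding A_deg_def by auto

lemma A_deg_subset: "x \<in> carrier (A_deg n r q) \<Longrightarrow> x \<in> carrier (A n q)"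
  by (auto elim!: A_deg_memE intro: qcoset_in_A)

lemma A_deg_zero: "\<zero>\<^bsub>A n q\<^esub> \<in> carrier (A_deg n r q)"
proof -
  have "\<zero>\<^bsub>A n q\<^esub> = qcoset n q \<zero>\<^bsub>qfree n\<^esub>"
    by (rule ring_hom_zero[OF qcoset_ring_hom ring_free_alg ring_A, symmetric])
  also have "\<dots> \<in> carrier (A_deg n r q)"
    by (rule A_deg_memI) (simp_all add: free_alg_def)
  finally show ?thesis .
qed

lemma A_deg_one: "\<one>\<^bsub>A n q\<^esub> \<in> carrier (A_deg n 0 q)"
proof -
  have "\<one>\<^bsub>A n q\<^esub> = qcoset n q \<one>\<^bsub>qfree n\<^esub>"
    using ring_hom_one[OF qcoset_ring_hom, of n q] by simp
  also have "\<dots> \<in> carrier (A_deg n 0 q)"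
    by (rule A_deg_memI) (auto simp: free_alg_def zero_word_def)
  finally show ?thesis .
qed

lemma A_deg_add:
  assumes "x \<in> carrier (A_deg n r q)" "y \<in> carrier (A_deg n r q)"
  shows "x \<oplus>\<^bsub>A n q\<^esub> y \<in> carrier (A_deg n r q)"
proof -
  interpret F: ring "qfree n :: ((nat \<times> nat) word \<Rightarrow>\<^sub>0 'a) ring" by (rule ring_free_alg)
  obtain p p' where p: "x = qcoset n q p" "p \<in> carrier (qfree n)"
      "\<And>w. w \<in> Poly_Mapping.keys p \<Longrightarrow> length (letters w) = r"
    and p': "y = qcoset n q p'" "p' \<in> carrier (qfree n)"
      "\<And>w. w \<in> Poly_Mapping.keys p' \<Longrightarrow> length (letters w) = r"
    using assms by (elim A_deg_memE) blast
  have "x \<oplus>\<^bsub>A n q\<^esub> y = qcoset n q (p \<oplus>\<^bsub>qfree n\<^esub> p')"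
    unfolding p p' by (rule ring_hom_add[OF qcoset_ring_hom p(2) p'(2), symmetric])
  also have "\<dots> \<in> carrier (A_deg n r q)"
    using p(2,3) p'(2,3) subsetD[OF Poly_Mapping.keys_add[of p p']]
    by (intro A_deg_memI F.a_closed) (auto simp: free_alg_simps)
  finally show ?thesis .
qed

lemma A_deg_mult:
  assumes "x \<in> carrier (A_deg n r q)" "y \<in> carrier (A_deg n s q)"
  shows "x \<otimes>\<^bsub>A n q\<^esub> y \<in> carrier (A_deg n (r + s) q)"
proof -
  interpret F: ring "qfree n :: ((nat \<times> nat) word \<Rightarrow>\<^sub>0 'a) ring" by (rule ring_free_alg)
  obtain p p' where p: "x = qcoset n q p" "p \<in> carrier (qfree n)"
      "\<And>w. w \<in> Poly_Mapping.keys p \<Longrightarrow> length (letters w) = r"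
    and p': "y = qcoset n q p'" "p' \<in> carrier (qfree n)"
      "\<And>w. w \<in> Poly_Mapping.keys p' \<Longrightarrow> length (letters w) = s"
    using assms by (elim A_deg_memE) blast
  have "x \<otimes>\<^bsub>A n q\<^esub> y = qcoset n q (p \<otimes>\<^bsub>qfree n\<^esub> p')"
    unfolding p p' by (rule ring_hom_mult[OF qcoset_ring_hom p(2) p'(2), symmetric])
  also have "\<dots> \<in> carrier (A_deg n (r + s) q)"
  proof (rule A_deg_memI)
    fix w assume "w \<in> Poly_Mapping.keys (p \<otimes>\<^bsub>qfree n\<^esub> p')"
    then have "w \<in> Poly_Mapping.keys (p * p')"
      by (simp add: free_alg_simps)
    then show "length (letters w) = r + s"
      by (rule keys_mult_word) (simp add: p(3) p'(3))
  qed (rule F.m_closed[OF p(2) p'(2)])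
  finally show ?thesis .
qed

lemma A_deg_smult:
  assumes "x \<in> carrier (A_deg n r q)"
  shows "a \<odot>\<^bsub>A n q\<^esub> x \<in> carrier (A_deg n r q)"
proof -
  have "qcoset n q (const a) \<in> carrier (A_deg n 0 q)"
    by (rule A_deg_memI) (auto simp: const_def zero_word_def free_alg_def split: if_splits)
  from A_deg_mult[OF this assms] show ?thesis
    by (simp add: A_simps)
qed

lemma A_deg_finsum:
  assumes "\<And>b. b \<in> B \<Longrightarrow> f b \<in> carrier (A_deg n r q)"
  shows "(\<Oplus>\<^bsub>A n q\<^esub>b\<in>B. f b) \<in> carrier (A_deg n r q)"
proof -
  interpret ring "A n q" by (rule ring_A)
  show ?thesis
    using assms
  proof (induction B rule: infinite_finite_induct)
    case (insert b B)
    then show ?case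
      by (subst finsum_insert) (auto intro!: A_deg_add dest: A_deg_subset)
  qed (simp_all add: A_deg_zero)
qed

lemma A_deg_c: "i \<in> {1..n} \<Longrightarrow> j \<in> {1..n} \<Longrightarrow> c n q i j \<in> carrier (A_deg n 1 q)"
  unfolding c_def by (rule A_deg_memI) (simp_all add: gen_def free_alg_def)


section \<open>Comodules with a given finite basis\<close>

text \<open>A left comodule \<open>M\<close> with basis $(v_b)$ is given by its coefficients: the coaction is
  $v_b \mapsto \sum_{b'} \mathrm{coeff}\,M\,b\,b' \otimes v_{b'}$.  Vectors are coordinate
  functions vanishing outside the basis, and the tensor product of a vector space $C$ with $M$
  is modelled by the $C$-valued functions on the basis of $M$.\<close>

record ('b, 'a) comodule =
  basis :: "'b set"
  coeff :: "'b \<Rightarrow> 'b \<Rightarrow> 'a"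

definition vectors :: "('b, 'a) comodule \<Rightarrow> ('b \<Rightarrow> 'k::field) set"
  where "vectors M = {x. \<forall>b. b \<notin> basis M \<longrightarrow> x b = 0}"

definition unit_vec :: "'b \<Rightarrow> 'b \<Rightarrow> 'k::field"
  where "unit_vec b = (\<lambda>b'. if b' = b then 1 else 0)"

definition coaction ::
    "('k::field, 'a) module \<Rightarrow> ('b, 'a) comodule \<Rightarrow> ('b \<Rightarrow> 'k) \<Rightarrow> 'b \<Rightarrow> 'a"
  where "coaction C M x =
    (\<lambda>b'\<in>basis M. \<Oplus>\<^bsub>C\<^esub>b\<in>basis M. x b \<odot>\<^bsub>C\<^esub> coeff M b b')"

definition linear_maps ::
    "('b, 'a) comodule \<Rightarrow> ('d, 'a) comodule \<Rightarrow> (('b \<Rightarrow> 'k::field) \<Rightarrow> 'd \<Rightarrow> 'k) set"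
  where "linear_maps M N =
    {f \<in> vectors M \<rightarrow>\<^sub>E vectors N.
       (\<forall>x\<in>vectors M. \<forall>y\<in>vectors M. f (\<lambda>b. x b + y b) = (\<lambda>d. f x d + f y d))
     \<and> (\<forall>a. \<forall>x\<in>vectors M. f (\<lambda>b. a * x b) = (\<lambda>d. a * f x d))}"

text \<open>The map $\mathrm{id}_C \otimes f$.\<close>

definition id_tensor ::
    "('k::field, 'a) module \<Rightarrow> ('b, 'a) comodule \<Rightarrow> ('d, 'a) comodule
      \<Rightarrow> (('b \<Rightarrow> 'k) \<Rightarrow> 'd \<Rightarrow> 'k) \<Rightarrow> ('b \<Rightarrow> 'a) \<Rightarrow> 'd \<Rightarrow> 'a"
  where "id_tensor C M N f y =
    (\<lambda>d\<in>basis N. \<Oplus>\<^bsub>C\<^esub>b\<in>basis M. f (unit_vec b) d \<odot>\<^bsub>C\<^esub> y b)"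

definition comodule_homs ::
    "('k::field, 'a) module \<Rightarrow> ('b, 'a) comodule \<Rightarrow> ('d, 'a) comodule
      \<Rightarrow> (('b \<Rightarrow> 'k) \<Rightarrow> 'd \<Rightarrow> 'k) set"
  where "comodule_homs C M N =
    {f \<in> linear_maps M N. \<forall>x\<in>vectors M.
       coaction C N (f x) = id_tensor C M N f (coaction C M x)}"

definition comodule_End ::
    "('k::field, 'a) module \<Rightarrow> ('b, 'a) comodule \<Rightarrow> ('k, ('b \<Rightarrow> 'k) \<Rightarrow> 'b \<Rightarrow> 'k) module"
  where "comodule_End C M =
    \<lparr>carrier = comodule_homs C M M,
     mult = compose (vectors M),
     one = (\<lambda>x\<in>vectors M. x),
     zero = (\<lambda>x\<in>vectors M. \<lambda>b. 0),
     add = (\<lambda>f g. \<lambda>x\<in>vectors M. \<lambda>b. f x b + g x b),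
     smult = (\<lambda>a f. \<lambda>x\<in>vectors M. \<lambda>b. a * f x b)\<rparr>"

text \<open>$S(n,r)$ is the dual algebra of $A(n,r)$, and $S(n,r)$-homomorphisms are by definition
  homomorphisms of $A(n,r)$-comodules.\<close>

definition Schur_End ::
    "nat \<Rightarrow> nat \<Rightarrow> 'k::field \<Rightarrow> ('b, 'k coord) comodule
      \<Rightarrow> ('k, ('b \<Rightarrow> 'k) \<Rightarrow> 'b \<Rightarrow> 'k) module"
  where "Schur_End n r q M = comodule_End (A_deg n r q) M"

definition algebra_isomorphic :: "('k, 'a) module \<Rightarrow> ('k, 'b) module \<Rightarrow> bool"
  where "algebra_isomorphic R S \<longleftrightarrow>
    (\<exists>\<phi>\<in>ring_iso R S. \<forall>a. \<forall>x\<in>carrier R. \<phi> (a \<odot>\<^bsub>R\<^esub> x) = a \<odot>\<^bsub>S\<^esub> \<phi> x)"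

text \<open>Tensor product of a list of comodules over the bialgebra \<open>R\<close>, with coaction
  $x \otimes y \mapsto \sum x_{(-1)} y_{(-1)} \otimes x_{(0)} \otimes y_{(0)}$; the basis vector
  $v_{b_1} \otimes \dots \otimes v_{b_m}$ is indexed by the list $[b_1, \dots, b_m]$.\<close>

definition tensor_comodule ::
    "('k, 'a) module \<Rightarrow> ('b, 'a) comodule list \<Rightarrow> ('b list, 'a) comodule"
  where "tensor_comodule R Ms =
    \<lparr>basis = listset (map basis Ms),
     coeff = (\<lambda>bs bs'.
       foldr (\<otimes>\<^bsub>R\<^esub>) (map (\<lambda>(M, b, b'). coeff M b b') (zip Ms (zip bs bs'))) \<one>\<^bsub>R\<^esub>)\<rparr>"

definition dsum_comodule ::
    "('k, 'a) module \<Rightarrow> 'i set \<Rightarrow> ('i \<Rightarrow> ('b, 'a) comodule) \<Rightarrow> ('i \<times> 'b, 'a) comodule"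
  where "dsum_comodule R X M =
    \<lparr>basis = (SIGMA i:X. basis (M i)),
     coeff = (\<lambda>(i, b) (i', b'). if i = i' then coeff (M i) b b' else \<zero>\<^bsub>R\<^esub>)\<rparr>"


section \<open>Exterior powers\<close>

definition natural_comodule :: "nat \<Rightarrow> 'k::field \<Rightarrow> (nat, 'k coord) comodule"
  where "natural_comodule n q = \<lparr>basis = {1..n}, coeff = c n q\<rparr>"

text \<open>The exterior algebra has the basis $v_J = v_{j_1} \wedge \dots \wedge v_{j_s}$, where
  $J = \{j_1 < \dots < j_s\}$; \<open>wedge ls J\<close> is the coefficient of $v_J$ in the product
  $v_{l_1} \wedge \dots \wedge v_{l_s}$.  The lemmas below say that it is given by the defining
  relations of the exterior algebra.\<close>

fun inversions :: "nat list \<Rightarrow> nat" where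
  "inversions [] = 0"
| "inversions (l # ls) = length (filter (\<lambda>l'. l' < l) ls) + inversions ls"

definition wedge :: "nat list \<Rightarrow> nat set \<Rightarrow> 'k::field"
  where "wedge ls J = (if distinct ls \<and> set ls = J then (-1) ^ inversions ls else 0)"

lemma wedge_sorted:
  assumes "finite I"
  shows "(wedge (sorted_list_of_set I) J :: 'k::field) = (if J = I then 1 else 0)"
proof -
  have "inversions ls = 0" if "sorted ls" for ls
    using that by (induction ls) (auto simp: filter_empty_conv not_less)
  then show ?thesis
    using assms by (auto simp: wedge_def)
qed

lemma wedge_square: "wedge (ls @ i # i # ls') J = (0 :: 'k::field)"
  by (simp add: wedge_def)

lemma wedge_swap: "wedge (ls @ i # j # ls') J = - (wedge (ls @ j # i # ls') J :: 'k::field)"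
proof (cases "i = j")
  case True
  then show ?thesis
    by (simp add: wedge_square)
next
  case False
  have less: "inversions (ls @ j # i # ls') = Suc (inversions (ls @ i # j # ls'))"
    if "i < j" for i j
    using that by (induction ls) auto
  have "(-1) ^ inversions (ls @ i # j # ls') = - ((-1) ^ inversions (ls @ j # i # ls') :: 'k)"
    using less[of i j] less[of j i] False by (cases "i < j") auto
  moreover have "set (ls @ i # j # ls') = set (ls @ j # i # ls')"
    "distinct (ls @ i # j # ls') = distinct (ls @ j # i # ls')"
    by auto
  ultimately show ?thesis
    by (simp add: wedge_def)
qed

text \<open>The coaction on the exterior algebra is multiplicative, so the coaction of
  $v_{i_1} \wedge \dots \wedge v_{i_s}$ is the image of that of
  $v_{i_1} \otimes \dots \otimes v_{i_s}$ under the projection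
  $V^{\otimes s} \to \bigwedge^s V$.\<close>

definition ext_power :: "nat \<Rightarrow> 'k::field \<Rightarrow> nat \<Rightarrow> (nat set, 'k coord) comodule"
  where "ext_power n q s =
    (let T = tensor_comodule (A n q) (replicate s (natural_comodule n q)) in
    \<lparr>basis = {J. J \<subseteq> {1..n} \<and> card J = s},
     coeff = (\<lambda>I J. \<Oplus>\<^bsub>A n q\<^esub>ls\<in>basis T.
       wedge ls J \<odot>\<^bsub>A n q\<^esub> coeff T (sorted_list_of_set I) ls)\<rparr>)"

definition ext_powers :: "nat \<Rightarrow> 'k::field \<Rightarrow> nat list \<Rightarrow> (nat set list, 'k coord) comodule"
  where "ext_powers n q \<alpha> = tensor_comodule (A n q) (map (ext_power n q) \<alpha>)"

text \<open>The coefficients of $\bigwedge^\alpha V$ lie in $A(n,r)$, where $r = |\alpha|$, so that it is an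
  $A(n,r)$-comodule.\<close>

lemma A_deg_tensor_comodule:
  assumes "list_all2 (\<lambda>M r. \<forall>b\<in>basis M. \<forall>b'\<in>basis M. coeff M b b' \<in> carrier (A_deg n r q)) Ms rs"
    and "bs \<in> basis (tensor_comodule (A n q) Ms)" "bs' \<in> basis (tensor_comodule (A n q) Ms)"
  shows "coeff (tensor_comodule (A n q) Ms) bs bs' \<in> carrier (A_deg n (sum_list rs) q)"
  using assms
proof (induction arbitrary: bs bs' rule: list_all2_induct)
  case Nil
  then show ?case
    by (simp add: tensor_comodule_def A_deg_one)
next
  case (Cons M Ms r rs)
  then show ?case
    by (auto simp: tensor_comodule_def set_Cons_def intro!: A_deg_mult)
qed

lemma basis_tensor_replicate:
  "ls \<in> basis (tensor_comodule R (replicate s M)) \<longleftrightarrow> length ls = s \<and> set ls \<subseteq> basis M"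
proof (induction s arbitrary: ls)
  case (Suc s)
  then show ?case
    by (cases ls) (auto simp: tensor_comodule_def set_Cons_def)
qed (auto simp: tensor_comodule_def)

lemma A_deg_ext_power:
  assumes "I \<in> basis (ext_power n q s)" "J \<in> basis (ext_power n q s)"
  shows "coeff (ext_power n q s) I J \<in> carrier (A_deg n s q)"
proof -
  let ?Ms = "replicate s (natural_comodule n q)"
  have I: "sorted_list_of_set I \<in> basis (tensor_comodule (A n q) ?Ms)"
    using assms(1) finite_subset[of I "{1..n}"]
    by (auto simp: basis_tensor_replicate natural_comodule_def ext_power_def Let_def)
  have "list_all2 (\<lambda>M r. \<forall>b\<in>basis M. \<forall>b'\<in>basis M. coeff M b b' \<in> carrier (A_deg n r q))
      ?Ms (replicate s 1)"
    using A_deg_c[of _ n _ q] by (auto simp: list_all2_conv_all_nth natural_comodule_def)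
  from A_deg_tensor_comodule[OF this I] show ?thesis
    by (auto simp: ext_power_def Let_def sum_list_replicate intro!: A_deg_finsum A_deg_smult)
qed

lemma A_deg_ext_powers:
  assumes "I \<in> basis (ext_powers n q \<alpha>)" "J \<in> basis (ext_powers n q \<alpha>)"
  shows "coeff (ext_powers n q \<alpha>) I J \<in> carrier (A_deg n (sum_list \<alpha>) q)"
  using assms unfolding ext_powers_def
  by (intro A_deg_tensor_comodule) (simp_all add: list_all2_conv_all_nth A_deg_ext_power)

lemma A_deg_dsum_ext_powers:
  fixes q :: "'k::field"
  assumes "\<And>\<alpha>. \<alpha> \<in> X \<Longrightarrow> sum_list (f \<alpha>) = r"
    and "b \<in> basis (dsum_comodule (A n q) X (\<lambda>\<alpha>. ext_powers n q (f \<alpha>)))"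
    and "b' \<in> basis (dsum_comodule (A n q) X (\<lambda>\<alpha>. ext_powers n q (f \<alpha>)))"
  shows "coeff (dsum_comodule (A n q) X (\<lambda>\<alpha>. ext_powers n q (f \<alpha>))) b b'
    \<in> carrier (A_deg n r q)"
  using assms(2,3) A_deg_ext_powers[of _ n q] assms(1)
  by (fastforce simp: dsum_comodule_def A_deg_zero)


section \<open>Partitions\<close>

text \<open>Partitions with at most $m$ parts are padded with zeros to length $m$.\<close>

definition partitions :: "nat \<Rightarrow> nat \<Rightarrow> nat \<Rightarrow> nat list set"
  where "partitions n r m =
    {\<alpha>. length \<alpha> = m \<and> sorted_wrt (\<ge>) \<alpha> \<and> sum_list \<alpha> = r \<and> (\<forall>a\<in>set \<alpha>. a \<le> n)}"

definition complement :: "nat \<Rightarrow> nat list \<Rightarrow> nat list"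
  where "complement n \<alpha> = rev (map (\<lambda>a. n - a) \<alpha>)"

lemma complement_in_partitions:
  assumes "\<alpha> \<in> partitions n r m"
  shows "complement n \<alpha> \<in> partitions n (n * m - r) m"
proof -
  have "sum_list (map (\<lambda>a. n - a) xs) + sum_list xs = n * length xs"
    if "\<forall>a\<in>set xs. a \<le> n" for xs :: "nat list"
    using that by (induction xs) auto
  from this[of \<alpha>] assms show ?thesis
    by (auto simp: partitions_def complement_def sorted_wrt_rev sorted_wrt_map
        elim!: sorted_wrt_mono_rel[rotated])
qed

end

theory Submission
  imports Defs "HOL-Library.Multiset" "HOL-Library.List_Lexorder" "HOL-Library.Product_Lexorder"
begin

text \<open>The isomorphism is explicit: it re-indexes matrices along
  $(I_1, \dots, I_m) \mapsto (I_m^c, \dots, I_1^c)$ and conjugates them with a diagonal matrix of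
  powers of $q$.  To see that it respects comodule homomorphisms, note that these are the
  matrices commuting with the action of all linear functionals on $A(n,r)$, that is, of all
  endomorphisms of tensor space commuting with the Hecke algebra.  It suffices to test weight
  projections and divided powers of the simple root vectors, because convolution products of
  these separate the points of $A(n)$: by straightening, $A(n)$ is spanned by the ordered
  monomials, and on these the products are triangular.  Finally, conjugation exchanges the
  divided powers of a root vector on $\bigwedge^\alpha V$ with those of the opposite root vector
  on $\bigwedge^{n-\alpha} V$ up to nonzero scalars; as the simple roots only involve adjacent
  indices, no signs occur.\<close>

section \<open>Words as indices of the tensor basis, and adjacent exchanges\<close>

section \<open>Words\<close>

text \<open>Classically, passing to the complement of an index set describes the dual of an exterior
  power up to a determinant. Followed by transposition this becomes covariant and interchanges
  raising and lowering: matrices are re-indexed, not transposed. In a tensor product, a raising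
  vector has its extra factor q on one side and a lowering vector on the other, so the order of the
  blocks has to be reversed; the powers of q that still differ make up the diagonal matrix.

  The field may have positive characteristic and q may be a root of unity, so root vectors alone are
  too few operators. Divided powers of every order k are used, each given by its matrix, without
  division by quantum factorials.

  Neither a basis of A(n) nor a description of its full dual is needed in advance. It suffices that
  commuting matrices kill the defining ideal and that enough of them are available to detect it.

  The scalar relating two corresponding divided powers may depend on k, but not on \<alpha>, because
  an endomorphism mixes all summands. It does depend on the number of blocks, so it matters that all
  partitions are padded to the common length m.\<close>

definition words :: "nat \<Rightarrow> nat \<Rightarrow> nat list set"
  where "words n r = {w. set w \<subseteq> {1..n} \<and> length w = r}"

lemma words_0 [simp]: "words n 0 = {[]}"
  by (auto simp: words_def)

lemma finite_words [simp]: "finite (words n r)"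
  unfolding words_def by (rule finite_lists_length_eq) simp

lemma length_words: "w \<in> words n r \<Longrightarrow> length w = r"
  by (simp add: words_def)

lemma append_in_words: "v @ w \<in> words n r \<longleftrightarrow> (\<exists>s t. r = s + t \<and> v \<in> words n s \<and> w \<in> words n t)"
  by (auto simp: words_def)

lemma sum_words_add:
  "(\<Sum>w\<in>words n (a + b). f w) = (\<Sum>v\<in>words n a. \<Sum>w\<in>words n b. f (v @ w))"
proof -
  have "bij_betw (\<lambda>(v, w). v @ w) (words n a \<times> words n b) (words n (a + b))"
    by (rule bij_betw_byWitness[where f' = "\<lambda>u. (take a u, drop a u)"])
      (auto simp: words_def subset_eq dest: in_set_takeD in_set_dropD)
  from sum.reindex_bij_betw[OF this, of f] show ?thesis
    by (simp add: sum.cartesian_product case_prod_beta)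
qed

definition swap_at :: "nat \<Rightarrow> 'a list \<Rightarrow> 'a list"
  where "swap_at p w = w[p := w ! Suc p, Suc p := w ! p]"

lemma length_swap_at [simp]: "length (swap_at p w) = length w"
  by (simp add: swap_at_def)

lemma swap_at_swap_at [simp]: "Suc p < length w \<Longrightarrow> swap_at p (swap_at p w) = w"
  unfolding swap_at_def by (rule nth_equalityI) (auto simp: nth_list_update)

lemma swap_at_nth:
  "Suc p < length w \<Longrightarrow> swap_at p w ! p = w ! Suc p"
  "Suc p < length w \<Longrightarrow> swap_at p w ! Suc p = w ! p"
  by (simp_all add: swap_at_def nth_list_update)

lemma swap_at_eq: "Suc p < length w \<Longrightarrow> w ! p = w ! Suc p \<Longrightarrow> swap_at p w = w"
  unfolding swap_at_def by (rule nth_equalityI) (auto simp: nth_list_update)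

lemma mset_swap_at [simp]: "Suc p < length w \<Longrightarrow> mset (swap_at p w) = mset w"
  unfolding swap_at_def by (rule mset_swap) simp_all

lemma swap_at_in_words: "Suc p < r \<Longrightarrow> w \<in> words n r \<Longrightarrow> swap_at p w \<in> words n r"
  using mset_eq_setD[OF mset_swap_at[of p w]] by (auto simp: words_def)

lemma swap_at_append [simp]: "swap_at (length u) (u @ x # y # v) = u @ y # x # v"
  by (simp add: swap_at_def list_update_append nth_append)

lemma swap_at_append2: "swap_at p (u @ v) =
   (if Suc p < length u then swap_at p u @ v
    else if length u \<le> p then u @ swap_at (p - length u) v else swap_at p (u @ v))"
  by (simp add: swap_at_def list_update_append nth_append Suc_diff_le)

lemma split_at_adjacent: "Suc p < length w \<Longrightarrow> w = take p w @ w ! p # w ! Suc p # drop (p + 2) w"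
  by (metis Cons_nth_drop_Suc Suc_lessD add_2_eq_Suc' append_take_drop_id)

lemma sum_swap_at:
  assumes "Suc p < r"
  shows "(\<Sum>w\<in>words n r. f (swap_at p w)) = (\<Sum>w\<in>words n r. f w)"
proof -
  have "bij_betw (swap_at p) (words n r) (words n r)"
    by (rule bij_betw_byWitness[where f' = "swap_at p"])
      (use assms in \<open>auto simp: swap_at_in_words length_words\<close>)
  then show ?thesis
    by (rule sum.reindex_bij_betw)
qed

section \<open>The Hecke algebra on tensor space and its commutant\<close>

section \<open>Hecke operators\<close>

text \<open>Left multiplication by the matrix of a generator T of the Hecke algebra, with (T - q)(T
  + 1) = 0, acting at the places p and p + 1. \<open>hecke_col\<close> is right multiplication by
  the same matrix.\<close>

definition hecke_row :: "'k::field \<Rightarrow> nat \<Rightarrow> (nat list \<Rightarrow> 'k) \<Rightarrow> nat list \<Rightarrow> 'k"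
  where "hecke_row q p f w =
    (if w ! p < w ! Suc p then f (swap_at p w)
     else if w ! p = w ! Suc p then q * f w
     else q * f (swap_at p w) + (q - 1) * f w)"

definition hecke_col :: "'k::field \<Rightarrow> nat \<Rightarrow> (nat list \<Rightarrow> 'k) \<Rightarrow> nat list \<Rightarrow> 'k"
  where "hecke_col q p f w =
    (if w ! p < w ! Suc p then q * f (swap_at p w)
     else if w ! p = w ! Suc p then q * f w
     else f (swap_at p w) + (q - 1) * f w)"

text \<open>Both sides are the bilinear expression f T g. \<open>M\<close> collects the diagonal
  entries of T; the off-diagonal ones, \<open>L\<close> and \<open>R\<close>, agree after
  substituting \<open>swap_at p w\<close> for \<open>w\<close>, which permutes the words.\<close>

lemma hecke_adjoint:
  assumes "Suc p < r"
  shows "(\<Sum>w\<in>words n r. f w * hecke_row q p g w) = (\<Sum>w\<in>words n r. hecke_col q p f w * g w)"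
proof -
  let ?s = "swap_at p"
  define L where "L w = (if w ! p < w ! Suc p then f w * g (?s w) else 0)
     + (if w ! Suc p < w ! p then q * f w * g (?s w) else 0)" for w
  define R where "R w = (if w ! p < w ! Suc p then q * f (?s w) * g w else 0)
     + (if w ! Suc p < w ! p then f (?s w) * g w else 0)" for w
  define M where "M w = (if w ! p = w ! Suc p then q * f w * g w else 0)
     + (if w ! Suc p < w ! p then (q - 1) * f w * g w else 0)" for w
  have "(\<Sum>w\<in>words n r. f w * hecke_row q p g w) = (\<Sum>w\<in>words n r. L w + M w)"
    by (rule sum.cong) (auto simp: hecke_row_def L_def M_def algebra_simps)
  also have "\<dots> = (\<Sum>w\<in>words n r. L (?s w)) + (\<Sum>w\<in>words n r. M w)"
    by (simp add: sum.distrib sum_swap_at[OF assms])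
  also have "(\<Sum>w\<in>words n r. L (?s w)) = (\<Sum>w\<in>words n r. R w)"
    using assms by (intro sum.cong) (auto simp: L_def R_def swap_at_nth length_words)
  also have "\<dots> + (\<Sum>w\<in>words n r. M w) = (\<Sum>w\<in>words n r. hecke_col q p f w * g w)"
    unfolding sum.distrib[symmetric]
    by (rule sum.cong) (auto simp: hecke_col_def R_def M_def algebra_simps)
  finally show ?thesis .
qed

lemma hecke_row_sum:
  "hecke_row q p (\<lambda>w. \<Sum>l\<in>S. f w l * d l) w = (\<Sum>l\<in>S. hecke_row q p (\<lambda>w. f w l) w * d l)"
  by (simp add: hecke_row_def sum_distrib_left sum.distrib sum_subtractf algebra_simps)

lemma hecke_col_sum:
  "hecke_col q p (\<lambda>w. \<Sum>l\<in>S. d l * f w l) w = (\<Sum>l\<in>S. d l * hecke_col q p (\<lambda>w. f w l) w)"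
  by (simp add: hecke_col_def sum_distrib_left sum.distrib sum_subtractf algebra_simps)

text \<open>A function \<open>\<xi>\<close> of two words stands for the linear functional taking the value \<open>\<xi> i j\<close> on
  $c_{i_1 j_1} \cdots c_{i_r j_r}$.  The defining relations of $A(n)$ say that, as a matrix, it
  commutes with the action of the Hecke algebra on tensor space.\<close>

definition centralizing :: "nat \<Rightarrow> 'k::field \<Rightarrow> (nat list \<Rightarrow> nat list \<Rightarrow> 'k) \<Rightarrow> bool"
  where "centralizing n q \<xi> \<longleftrightarrow>
    (\<forall>r. \<forall>i\<in>words n r. \<forall>j\<in>words n r. \<forall>p. Suc p < r \<longrightarrow>
      hecke_row q p (\<lambda>w. \<xi> w j) i = hecke_col q p (\<xi> i) j)"

lemma centralizing_zero: "centralizing n q (\<lambda>i j. 0)"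
  by (simp add: centralizing_def hecke_row_def hecke_col_def)

text \<open>Dual to the comultiplication of A(n), hence matrix multiplication.\<close>

definition convolve :: "nat \<Rightarrow> (nat list \<Rightarrow> nat list \<Rightarrow> 'k::field) \<Rightarrow> (nat list \<Rightarrow> nat list \<Rightarrow> 'k)
    \<Rightarrow> nat list \<Rightarrow> nat list \<Rightarrow> 'k"
  where "convolve n \<xi> \<eta> i j = (\<Sum>l\<in>words n (length i). \<xi> i l * \<eta> l j)"

lemma centralizing_convolve:
  assumes "centralizing n q \<xi>" "centralizing n q \<eta>"
  shows "centralizing n q (convolve n \<xi> \<eta>)"
  unfolding centralizing_def
proof (intro allI ballI impI)
  fix r p i j assume ij: "i \<in> words n r" "j \<in> words n r" and p: "Suc p < r"
  have "hecke_row q p (\<lambda>w. convolve n \<xi> \<eta> w j) i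
      = hecke_row q p (\<lambda>w. \<Sum>l\<in>words n r. \<xi> w l * \<eta> l j) i"
    using ij p by (simp add: hecke_row_def convolve_def length_words)
  also have "\<dots> = (\<Sum>l\<in>words n r. hecke_col q p (\<xi> i) l * \<eta> l j)"
    unfolding hecke_row_sum using assms(1) ij p by (simp add: centralizing_def)
  also have "\<dots> = (\<Sum>l\<in>words n r. \<xi> i l * hecke_row q p (\<lambda>w. \<eta> w j) l)"
    by (rule hecke_adjoint[OF p, symmetric])
  also have "\<dots> = (\<Sum>l\<in>words n r. \<xi> i l * hecke_col q p (\<eta> l) j)"
    using assms(2) ij p by (simp add: centralizing_def)
  also have "\<dots> = hecke_col q p (convolve n \<xi> \<eta> i) j"
    using ij by (simp add: hecke_col_sum[symmetric] convolve_def[abs_def] length_words)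
  finally show "hecke_row q p (\<lambda>w. convolve n \<xi> \<eta> w j) i = hecke_col q p (convolve n \<xi> \<eta> i) j" .
qed

section \<open>Linear functionals on the free algebra and their descent to A(n)\<close>

section \<open>Functionals on the free algebra\<close>

definition evaluate :: "(nat list \<Rightarrow> nat list \<Rightarrow> 'k::field) \<Rightarrow> ((nat \<times> nat) word \<Rightarrow>\<^sub>0 'k) \<Rightarrow> 'k"
  where "evaluate \<xi> p = (\<Sum>w\<in>Poly_Mapping.keys p.
    Poly_Mapping.lookup p w * \<xi> (map fst (letters w)) (map snd (letters w)))"

lemma evaluate_superset:
  assumes "finite S" "Poly_Mapping.keys p \<subseteq> S"
  shows "evaluate \<xi> p = (\<Sum>w\<in>S. Poly_Mapping.lookup p w * \<xi> (map fst (letters w)) (map snd (letters w)))"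
  unfolding evaluate_def
  by (rule sum.mono_neutral_left[OF assms]) (simp add: in_keys_iff)

lemma evaluate_add: "evaluate \<xi> (p + p') = evaluate \<xi> p + evaluate \<xi> p'"
proof -
  let ?S = "Poly_Mapping.keys p \<union> Poly_Mapping.keys p'"
  have "evaluate \<xi> (p + p') = (\<Sum>w\<in>?S. Poly_Mapping.lookup (p + p') w * \<xi> (map fst (letters w)) (map snd (letters w)))"
    by (rule evaluate_superset) (simp_all add: Poly_Mapping.keys_add)
  also have "\<dots> = evaluate \<xi> p + evaluate \<xi> p'"
    by (simp add: evaluate_superset[of ?S p] evaluate_superset[of ?S p'] lookup_add
        distrib_right sum.distrib)
  finally show ?thesis .
qed

lemma evaluate_zero [simp]: "evaluate \<xi> 0 = 0"
  by (simp add: evaluate_def)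

lemma evaluate_sum: "evaluate \<xi> (\<Sum>a\<in>S. f a) = (\<Sum>a\<in>S. evaluate \<xi> (f a))"
  by (induction S rule: infinite_finite_induct) (simp_all add: evaluate_add)

lemma evaluate_uminus: "evaluate \<xi> (- p) = - evaluate \<xi> p"
  using evaluate_add[of \<xi> p "- p"] by (simp add: eq_neg_iff_add_eq_0 add.commute)

lemma evaluate_diff: "evaluate \<xi> (p - p') = evaluate \<xi> p - evaluate \<xi> p'"
  using evaluate_add[of \<xi> p "- p'"] by (simp add: evaluate_uminus)

lemma evaluate_single [simp]:
  "evaluate \<xi> (Poly_Mapping.single w a) = a * \<xi> (map fst (letters w)) (map snd (letters w))"
  by (simp add: evaluate_def)

lemma poly_mapping_expand: "p = (\<Sum>w\<in>Poly_Mapping.keys p. Poly_Mapping.single w (Poly_Mapping.lookup p w))"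
  by (rule poly_mapping_eqI)
    (simp add: lookup_sum lookup_single when_def in_keys_iff)

lemma evaluate_single_mult:
  "evaluate \<xi> (Poly_Mapping.single w a * p) =
    a * evaluate (\<lambda>i j. \<xi> (map fst (letters w) @ i) (map snd (letters w) @ j)) p"
proof -
  have "Poly_Mapping.single w a * p = (\<Sum>v\<in>Poly_Mapping.keys p. Poly_Mapping.single (w + v) (a * Poly_Mapping.lookup p v))"
    by (subst poly_mapping_expand[of p]) (simp add: sum_distrib_left mult_single)
  then show ?thesis
    by (simp add: evaluate_sum evaluate_def[of _ p] plus_word_def sum_distrib_left mult.assoc)
qed

lemma evaluate_mult_single:
  "evaluate \<xi> (p * Poly_Mapping.single w a) =
    a * evaluate (\<lambda>i j. \<xi> (i @ map fst (letters w)) (j @ map snd (letters w))) p"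
proof -
  have "p * Poly_Mapping.single w a = (\<Sum>v\<in>Poly_Mapping.keys p. Poly_Mapping.single (v + w) (Poly_Mapping.lookup p v * a))"
    by (subst poly_mapping_expand[of p]) (simp add: sum_distrib_right mult_single)
  then show ?thesis
    by (simp add: evaluate_sum evaluate_def[of _ p] plus_word_def sum_distrib_left mult_ac)
qed

lemma evaluate_const_mult: "evaluate \<xi> (const a * p) = a * evaluate \<xi> p"
  by (simp add: const_def evaluate_single_mult zero_word_def)

text \<open>By bilinearity the outer factors may be taken to be single words.\<close>

lemma evaluate_sandwich_eq_0:
  assumes "\<And>u v. u \<in> Poly_Mapping.keys a \<Longrightarrow> v \<in> Poly_Mapping.keys b \<Longrightarrow>
    evaluate \<xi> (Poly_Mapping.single u 1 * p * Poly_Mapping.single v 1) = 0"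
  shows "evaluate \<xi> (a * p * b) = 0"
proof -
  have s: "Poly_Mapping.single u x = const x * Poly_Mapping.single u 1"
    "Poly_Mapping.single u x = Poly_Mapping.single u 1 * const x" for u and x :: 'a
    by (simp_all add: const_def mult_single)
  have e: "evaluate \<xi> (p * const x) = x * evaluate \<xi> p" for p x
    by (simp add: const_def evaluate_mult_single zero_word_def)
  have "a * p * b = (\<Sum>u\<in>Poly_Mapping.keys a. \<Sum>v\<in>Poly_Mapping.keys b.
    Poly_Mapping.single u (Poly_Mapping.lookup a u) * p * Poly_Mapping.single v (Poly_Mapping.lookup b v))"
    by (subst poly_mapping_expand[of a], subst poly_mapping_expand[of b])
      (simp add: sum_distrib_left sum_distrib_right sum.swap[of _ "Poly_Mapping.keys b"])
  moreover have "evaluate \<xi> (Poly_Mapping.single u x * p * Poly_Mapping.single v y) = 0"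
    if "u \<in> Poly_Mapping.keys a" "v \<in> Poly_Mapping.keys b" for u v x y
  proof -
    have "Poly_Mapping.single u x * p * Poly_Mapping.single v y
        = const x * (Poly_Mapping.single u 1 * p * Poly_Mapping.single v 1) * const y"
      unfolding s(1)[of u x] s(2)[of v y] by (simp only: mult.assoc)
    then show ?thesis
      by (simp add: e evaluate_const_mult assms[OF that])
  qed
  ultimately show ?thesis
    by (simp add: evaluate_sum)
qed

text \<open>The kernel of \<open>evaluate \<xi>\<close> is in general only a subspace. The set here
  is the largest two-sided ideal inside it, so it contains the ideal of the relations as soon as it
  contains the relations.\<close>

lemma ideal_vanishing:
  "ideal {p \<in> carrier (free_alg G). \<forall>a\<in>carrier (free_alg G). \<forall>b\<in>carrier (free_alg G). evaluate \<xi> (a * p * b) = 0}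
    (free_alg G)" (is "ideal ?I ?F")
proof -
  interpret F: ring ?F by (rule ring_free_alg)
  note m = F.m_closed[unfolded free_alg_simps] and a = F.a_closed[unfolded free_alg_simps]
    and z = F.zero_closed[unfolded free_alg_simps]
  have neg: "\<ominus>\<^bsub>?F\<^esub> x = - x" if "x \<in> carrier ?F" for x
  proof -
    have "- x \<in> carrier ?F" using that by (simp add: free_alg_def)
    moreover have "- x \<oplus>\<^bsub>?F\<^esub> x = \<zero>\<^bsub>?F\<^esub>" by (simp add: free_alg_simps)
    ultimately show ?thesis using F.minus_equality[of "- x" x] that by simp
  qed
  show ?thesis
  proof (rule idealI[OF ring_free_alg])
    show "subgroup ?I (add_monoid ?F)"
    proof (rule F.add.subgroupI)
      show "?I \<noteq> {}" using z by (intro ex_in_conv[THEN iffD1] exI[of _ 0]) auto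
    next
      fix x assume "x \<in> ?I"
      then show "\<ominus>\<^bsub>?F\<^esub> x \<in> ?I"
        using neg[of x] F.a_inv_closed[of x] by (auto simp: evaluate_uminus)
    next
      fix x y assume "x \<in> ?I" "y \<in> ?I"
      then show "x \<oplus>\<^bsub>?F\<^esub> y \<in> ?I"
        by (auto simp: free_alg_simps a distrib_left distrib_right evaluate_add)
    qed auto
  next
    fix x p assume p: "p \<in> ?I" and x: "x \<in> carrier ?F"
    show "x \<otimes>\<^bsub>?F\<^esub> p \<in> ?I"
    proof -
      have "evaluate \<xi> (a * (x * p) * b) = 0" if "a \<in> carrier ?F" "b \<in> carrier ?F" for a b
      proof -
        have "evaluate \<xi> ((a * x) * p * b) = 0"
          using p m[OF that(1) x] that(2) by blast
        then show ?thesis by (simp add: mult.assoc)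
      qed
      then show ?thesis using p x m by (auto simp: free_alg_simps)
    qed
    show "p \<otimes>\<^bsub>?F\<^esub> x \<in> ?I"
    proof -
      have "evaluate \<xi> (a * (p * x) * b) = 0" if "a \<in> carrier ?F" "b \<in> carrier ?F" for a b
      proof -
        have "evaluate \<xi> (a * p * (x * b)) = 0"
          using p m[OF x that(2)] that(1) by blast
        then show ?thesis by (simp add: mult.assoc)
      qed
      then show ?thesis using p x m by (auto simp: free_alg_simps)
    qed
  qed
qed

text \<open>The three families of relations are the commutation with T read at the two middle
  letters. For equal row letters both sides carry a factor q, which is cancelled.\<close>

lemma centralizing_relations:
  assumes "centralizing n q \<xi>" "q \<noteq> 0"
    and "u @ i # j # v \<in> words n s" "u' @ a # b # v' \<in> words n s" "length u = length u'"
  shows "\<xi> (u @ i # i # v) (u' @ a # b # v') = \<xi> (u @ i # i # v) (u' @ b # a # v')"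
    and "i < j \<Longrightarrow> a \<le> b \<Longrightarrow> \<xi> (u @ j # i # v) (u' @ a # b # v') = q * \<xi> (u @ i # j # v) (u' @ b # a # v')"
    and "i < j \<Longrightarrow> a < b \<Longrightarrow> \<xi> (u @ j # i # v) (u' @ b # a # v')
       = \<xi> (u @ i # j # v) (u' @ a # b # v') + (q - 1) * \<xi> (u @ i # j # v) (u' @ b # a # v')"
proof -
  let ?p = "length u"
  have w: "u @ i # i # v \<in> words n s" "u' @ b # a # v' \<in> words n s" "Suc ?p < s"
    using assms(3,4) by (auto simp: words_def)
  have sw: "swap_at ?p (u' @ x # y # v') = u' @ y # x # v'" for x y
    using swap_at_append[of u'] assms(5) by simp
  note eq = assms(1)[unfolded centralizing_def, rule_format, OF _ _ w(3)]
  note simps = hecke_row_def hecke_col_def sw nth_append assms(5)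
  show "\<xi> (u @ i # i # v) (u' @ a # b # v') = \<xi> (u @ i # i # v) (u' @ b # a # v')"
    using eq[OF w(1) assms(4)] eq[OF w(1) w(2)] assms(2)
    by (cases a b rule: linorder_cases) (simp_all add: simps algebra_simps)
  show "\<xi> (u @ j # i # v) (u' @ a # b # v') = q * \<xi> (u @ i # j # v) (u' @ b # a # v')"
    if "i < j" "a \<le> b"
    using eq[OF assms(3,4)] that swap_at_append[of u i j v]
    by (cases "a = b") (simp_all add: simps)
  show "\<xi> (u @ j # i # v) (u' @ b # a # v')
       = \<xi> (u @ i # j # v) (u' @ a # b # v') + (q - 1) * \<xi> (u @ i # j # v) (u' @ b # a # v')"
    if "i < j" "a < b"
    using eq[OF assms(3) w(2)] that swap_at_append[of u i j v]
    by (simp add: simps)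
qed

text \<open>Hence \<open>\<xi>\<close> defines a functional on A(n). A relation placed between two
  fixed words is an instance of \<open>centralizing_relations\<close>.\<close>

lemma evaluate_qideal:
  fixes q :: "'k::field"
  assumes "centralizing n q \<xi>" "q \<noteq> 0" "p \<in> qideal n q"
  shows "evaluate \<xi> p = 0"
proof -
  let ?F = "qfree n :: ((nat \<times> nat) word \<Rightarrow>\<^sub>0 'k) ring"
  let ?I = "{p \<in> carrier ?F. \<forall>a\<in>carrier ?F. \<forall>b\<in>carrier ?F. evaluate \<xi> (a * p * b) = 0}"
  interpret F: ring ?F by (rule ring_free_alg)
  have "qrels n q \<subseteq> ?I"
  proof
    fix p assume p: "p \<in> qrels n q"
    have "evaluate \<xi> (a * p * b) = 0" if ab: "a \<in> carrier ?F" "b \<in> carrier ?F" for a b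
    proof (rule evaluate_sandwich_eq_0)
      fix u v assume uv: "u \<in> Poly_Mapping.keys a" "v \<in> Poly_Mapping.keys b"
      define u1 u2 v1 v2 where uv_defs: "u1 = map fst (letters u)" "u2 = map snd (letters u)"
        "v1 = map fst (letters v)" "v2 = map snd (letters v)"
      have "set (letters u) \<subseteq> {1..n} \<times> {1..n}" "set (letters v) \<subseteq> {1..n} \<times> {1..n}"
        using ab uv by (auto simp: free_alg_def)
      then have sets: "set u1 \<subseteq> {1..n}" "set u2 \<subseteq> {1..n}" "set v1 \<subseteq> {1..n}" "set v2 \<subseteq> {1..n}"
        unfolding uv_defs by fastforce+
      have len: "length u1 = length u2" "length v1 = length v2"
        by (simp_all add: uv_defs)
      define w where "w i j r s = \<xi> (u1 @ i # j # v1) (u2 @ r # s # v2)" for i j r s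
      have ev: "evaluate \<xi> (Poly_Mapping.single u 1 * (gen (i,r) * gen (j,s)) * Poly_Mapping.single v 1)
          = w i j r s" for i r j s
        unfolding w_def
        by (simp add: gen_def mult_single plus_word_def uv_defs)
      have evc: "evaluate \<xi> (Poly_Mapping.single u 1 * (const c * p) * Poly_Mapping.single v 1)
          = c * evaluate \<xi> (Poly_Mapping.single u 1 * p * Poly_Mapping.single v 1)" for c p
      proof -
        have "Poly_Mapping.single u 1 * (const c * p) = const c * (Poly_Mapping.single u 1 * p)"
          by (simp add: const_def mult.assoc[symmetric] mult_single)
        then show ?thesis
          by (simp add: mult.assoc evaluate_const_mult)
      qed
      have rel: "w i i r s = w i i s r"
        "i < j \<Longrightarrow> r \<le> s \<Longrightarrow> w j i r s = q * w i j s r"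
        "i < j \<Longrightarrow> r < s \<Longrightarrow> w j i s r = w i j r s + (q - 1) * w i j s r"
        if "i \<in> {1..n}" "j \<in> {1..n}" "r \<in> {1..n}" "s \<in> {1..n}" for i j r s
        unfolding w_def
        using centralizing_relations[OF assms(1,2), of u1 i j v1 "length u1 + length v1 + 2" u2 r s v2]
          sets len that by (auto simp: words_def)
      show "evaluate \<xi> (Poly_Mapping.single u 1 * p * Poly_Mapping.single v 1) = 0"
        using p unfolding qrels_def Un_iff mem_Collect_eq
        by (elim disjE exE conjE; hypsubst; simp only: left_diff_distrib right_diff_distrib distrib_left distrib_right
            evaluate_add evaluate_diff evc ev) (simp_all add: rel algebra_simps del: One_nat_def)
    qed
    then show "p \<in> ?I"
      using p subsetD[OF qrels_subset p] by blast
  qed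
  then have "p \<in> ?I"
    using F.genideal_minimal[OF ideal_vanishing, of "qrels n q" \<xi>] assms(3) by (auto simp: qideal_def)
  then have "evaluate \<xi> (1 * p * 1) = 0"
    using F.one_closed by (auto simp only: free_alg_simps mem_Collect_eq)
  then show ?thesis by simp
qed

section \<open>Divided powers of simple root vectors and weight projections commute with the Hecke
  algebra\<close>

section \<open>Quantized divided powers and weight projections\<close>

text \<open>Up to normalization, \<open>shift s t u v k\<close> is the \<open>k\<close>-th divided power of the root vector which
  changes letters \<open>s\<close> into \<open>t\<close>; every unchanged letter \<open>t\<close> contributes \<open>u\<close> for each changed
  letter to its right and \<open>v\<close> for each changed letter to its left.\<close>

fun shift :: "nat \<Rightarrow> nat \<Rightarrow> 'k::field \<Rightarrow> 'k \<Rightarrow> nat \<Rightarrow> nat list \<Rightarrow> nat list \<Rightarrow> 'k" where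
  "shift s t u v k [] [] = (if k = 0 then 1 else 0)"
| "shift s t u v k (x # xs) (y # ys) =
    (if x = y then (if x = t then u ^ k else 1) * shift s t u v k xs ys
     else if x = s \<and> y = t \<and> 0 < k then v ^ count_list xs t * shift s t u v (k - 1) xs ys
     else 0)"
| "shift s t u v k _ _ = 0"

definition weight_proj :: "nat multiset \<Rightarrow> nat list \<Rightarrow> nat list \<Rightarrow> 'k::field"
  where "weight_proj \<mu> i j = (if i = j \<and> mset i = \<mu> then 1 else 0)"

text \<open>The commutation with T on two tensor factors: \<open>f a b c d\<close> is the entry in
  row ab and column cd. All other letters are treated as parameters.\<close>

definition hecke_eq :: "'k::field \<Rightarrow> (nat \<Rightarrow> nat \<Rightarrow> nat \<Rightarrow> nat \<Rightarrow> 'k) \<Rightarrow> bool"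
  where "hecke_eq q f \<longleftrightarrow> (\<forall>a b c d.
    (if a < b then f b a c d else if a = b then q * f a b c d
      else q * f b a c d + (q - 1) * f a b c d) =
    (if c < d then q * f a b d c else if c = d then q * f a b c d
      else f a b d c + (q - 1) * f a b c d))"

text \<open>T preserves the multiset of the two letters, so a diagonal matrix depending
  symmetrically on them commutes with it.\<close>

lemma hecke_eq_mult:
  assumes "hecke_eq q f" "\<And>a b. g a b = g b a"
  shows "hecke_eq q (\<lambda>a b c d. g a b * f a b c d)"
  unfolding hecke_eq_def
proof (intro allI)
  fix a b c d
  have "(if a < b then g b a * f b a c d else if a = b then q * (g a b * f a b c d)
      else q * (g b a * f b a c d) + (q - 1) * (g a b * f a b c d))
    = g a b * (if a < b then f b a c d else if a = b then q * f a b c d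
      else q * f b a c d + (q - 1) * f a b c d)"
    using assms(2)[of b a] by (simp add: algebra_simps)
  also have "\<dots> = g a b * (if c < d then q * f a b d c else if c = d then q * f a b c d
      else f a b d c + (q - 1) * f a b c d)"
    using assms(1) by (auto simp only: hecke_eq_def)
  also have "\<dots> = (if c < d then q * (g a b * f a b d c) else if c = d then q * (g a b * f a b c d)
      else g a b * f a b d c + (q - 1) * (g a b * f a b c d))"
    by (simp add: algebra_simps)
  finally show "(if a < b then g b a * f b a c d else if a = b then q * (g a b * f a b c d)
      else q * (g b a * f b a c d) + (q - 1) * (g a b * f a b c d))
    = (if c < d then q * (g a b * f a b d c) else if c = d then q * (g a b * f a b c d)
      else g a b * f a b d c + (q - 1) * (g a b * f a b c d))" .
qed

lemma hecke_eq_zero: "hecke_eq q (\<lambda>a b c d. 0)"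
  by (simp add: hecke_eq_def)

lemma hecke_eq_centralizing:
  assumes "\<And>u v u' v'. length u = length u' \<Longrightarrow> length v = length v' \<Longrightarrow>
    hecke_eq q (\<lambda>a b c d. \<xi> (u @ a # b # v) (u' @ c # d # v'))"
  shows "centralizing n q \<xi>"
  unfolding centralizing_def
proof (intro allI ballI impI)
  fix r p i j assume ij: "i \<in> words n r" "j \<in> words n r" and p: "Suc p < r"
  have l: "length i = r" "length j = r"
    using ij by (auto simp: words_def)
  define u v u' v' where uv: "u = take p i" "v = drop (p + 2) i" "u' = take p j" "v' = drop (p + 2) j"
  define a b c d where abcd: "a = i ! p" "b = i ! Suc p" "c = j ! p" "d = j ! Suc p"
  have i: "i = u @ a # b # v" and j: "j = u' @ c # d # v'"
    using split_at_adjacent[of p i] split_at_adjacent[of p j] p l unfolding uv abcd by simp_all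
  have len: "length u = p" "length u' = p" "length v = length v'"
    using p l by (auto simp: uv)
  have sw: "swap_at p i = u @ b # a # v" "swap_at p j = u' @ d # c # v'"
    using swap_at_append[of u a b v] swap_at_append[of u' c d v'] i j len by simp_all
  have "length u = length u'" using len by simp
  from assms[OF this len(3), unfolded hecke_eq_def, rule_format, of a b c d]
  show "hecke_row q p (\<lambda>w. \<xi> w j) i = hecke_col q p (\<xi> i) j"
    unfolding hecke_row_def hecke_col_def sw abcd[symmetric] i[symmetric] j[symmetric] .
qed

lemma hecke_eq_add:
  assumes "hecke_eq q f" "hecke_eq q g"
  shows "hecke_eq q (\<lambda>a b c d. f a b c d + g a b c d)"
  unfolding hecke_eq_def
proof (intro allI)
  fix a b c d
  note f = assms(1)[unfolded hecke_eq_def, rule_format, of a b c d]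
    and g = assms(2)[unfolded hecke_eq_def, rule_format, of a b c d]
  have split: "(if P then x + y else if Q then q * (z + z') else q * (x + y) + (q - 1) * (z + z'))
    = (if P then x else if Q then q * z else q * x + (q - 1) * z)
    + (if P then y else if Q then q * z' else q * y + (q - 1) * z')"
    "(if P then q * (x + y) else if Q then q * (z + z') else (x + y) + (q - 1) * (z + z'))
    = (if P then q * x else if Q then q * z else x + (q - 1) * z)
    + (if P then q * y else if Q then q * z' else y + (q - 1) * z')" for P Q x y z z'
    by (simp_all add: algebra_simps)
  show "(if a < b then f b a c d + g b a c d else if a = b then q * (f a b c d + g a b c d)
      else q * (f b a c d + g b a c d) + (q - 1) * (f a b c d + g a b c d)) =
    (if c < d then q * (f a b d c + g a b d c) else if c = d then q * (f a b c d + g a b c d)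
      else (f a b d c + g a b d c) + (q - 1) * (f a b c d + g a b c d))"
    unfolding split f g ..
qed

lemma hecke_eq_diag: "hecke_eq q (\<lambda>a b c d. if a = c \<and> b = d then 1 else 0)"
  unfolding hecke_eq_def
proof (intro allI)
  fix a b c d :: nat
  show "(if a < b then if b = c \<and> a = d then 1 else 0 else if a = b then q * (if a = c \<and> b = d then 1 else 0)
      else q * (if b = c \<and> a = d then 1 else 0) + (q - 1) * (if a = c \<and> b = d then 1 else 0)) =
    (if c < d then q * (if a = d \<and> b = c then 1 else 0) else if c = d then q * (if a = c \<and> b = d then 1 else 0)
      else (if a = d \<and> b = c then 1 else 0) + (q - 1) * (if a = c \<and> b = d then 1 else 0))"
    by (cases a b rule: linorder_cases; cases c d rule: linorder_cases) auto
qed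

text \<open>This matrix is a root vector acting on the tensor square of V by its coproduct. The
  ratio q between \<open>u\<close> and \<open>v\<close> is what the rows st and ts require in column
  tt; all other letters compare with s as they do with t.\<close>

lemma hecke_eq_shift1:
  assumes "t = Suc s \<and> u = q * v \<or> s = Suc t \<and> v = q * u"
  shows "hecke_eq q (\<lambda>a b c d. (if a = c \<and> b = s \<and> d = t then if a = t then u else 1 else 0)
    + (if b = d \<and> a = s \<and> c = t then if b = t then v else 1 else 0))" (is "hecke_eq q ?h")
proof -
  define h where "h = ?h"
  have st: "s \<noteq> t" using assms by auto
  have zs: "h z s c d = (if c = z \<and> d = t then if z = t then u else 1 else 0)" if "z \<noteq> s" for z c d
    using that st unfolding h_def by simp
  have sz: "h s z c d = (if c = t \<and> d = z then if z = t then v else 1 else 0)" if "z \<noteq> s" for z c d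
    using that st unfolding h_def by simp
  have none: "h a b c d = 0" if "a \<noteq> s" "b \<noteq> s" for a b c d
    using that unfolding h_def by simp
  have same: "h a a c d = h a a d c" for a c d
    unfolding h_def by (cases "a = s") (simp_all add: conj_commute add.commute)
  \<comment> \<open>The adjacency of s and t enters here: no third letter lies between them.\<close>
  have order: "z < s \<longleftrightarrow> z < t" "s < z \<longleftrightarrow> t < z" if "z \<noteq> s" "z \<noteq> t" for z
    using assms that by auto
  have "hecke_eq q h"
    unfolding hecke_eq_def
  proof (intro allI)
    fix a b c d
    consider "a = b" | "a \<noteq> b" "a \<noteq> s" "b \<noteq> s" | "a = s" "b = t" | "a = t" "b = s"
      | "a = s" "b \<noteq> s" "b \<noteq> t" | "a \<noteq> s" "a \<noteq> t" "b = s"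
      by metis
    then show "(if a < b then h b a c d else if a = b then q * h a b c d
        else q * h b a c d + (q - 1) * h a b c d) =
      (if c < d then q * h a b d c else if c = d then q * h a b c d
        else h a b d c + (q - 1) * h a b c d)"
    proof cases
      case 1
      then show ?thesis using same[of b c d] by (simp add: algebra_simps)
    next
      case 2
      then show ?thesis using none by simp
    next
      case 3
      then show ?thesis
        using assms zs[of t] sz[of t] st by (auto simp: algebra_simps)
    next
      case 4
      then show ?thesis
        using assms zs[of t] sz[of t] st by (auto simp: algebra_simps)
    next
      case 5
      then show ?thesis
        using zs[of b] sz[of b] order[of b]
        by (cases b s rule: linorder_cases; cases c d rule: linorder_cases) auto
    next
      case 6
      then show ?thesis
        using zs[of a] sz[of a] order[of a]
        by (cases a s rule: linorder_cases; cases c d rule: linorder_cases) auto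
    qed
  qed
  then show ?thesis unfolding h_def .
qed

text \<open>The entry splits according to how many of the two leading letters change. One change
  gives the matrix of \<open>hecke_eq_shift1\<close> times a symmetric factor; two changes force row
  ss and column tt. Each changed letter also contributes \<open>C\<close>, from the letters t in the
  tail.\<close>

lemma hecke_eq_shift_base:
  assumes "t = Suc s \<and> u = q * v \<or> s = Suc t \<and> v = q * u"
  shows "hecke_eq q (\<lambda>a b c d. shift s t u v k (a # b # x) (c # d # y))"
proof -
  have st: "s \<noteq> t" using assms by auto
  define C where "C = v ^ count_list x t"
  have "hecke_eq q (\<lambda>a b c d. (if a = t then u ^ k else 1) * (if b = t then u ^ k else 1)
      * shift s t u v k x y * (if a = c \<and> b = d then 1 else 0))"
    by (rule hecke_eq_mult[OF hecke_eq_diag]) simp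
  moreover have "hecke_eq q (\<lambda>a b c d. (if a = t \<or> b = t then u ^ (k - 1) else 1) *
      (if 0 < k then C * shift s t u v (k - 1) x y else 0) *
      ((if a = c \<and> b = s \<and> d = t then if a = t then u else 1 else 0)
       + (if b = d \<and> a = s \<and> c = t then if b = t then v else 1 else 0)))"
    by (rule hecke_eq_mult[OF hecke_eq_shift1[OF assms]]) auto
  moreover have "hecke_eq q (\<lambda>a b c d. (if a = s \<and> b = s then 1 else 0) *
      (if c = t \<and> d = t \<and> 1 < k then C * C * shift s t u v (k - 2) x y else 0))"
    by (auto simp: hecke_eq_def)
  ultimately have "hecke_eq q (\<lambda>a b c d.
     ((if a = t then u ^ k else 1) * (if b = t then u ^ k else 1)
      * shift s t u v k x y * (if a = c \<and> b = d then 1 else 0)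
    + (if a = t \<or> b = t then u ^ (k - 1) else 1) *
      (if 0 < k then C * shift s t u v (k - 1) x y else 0) *
      ((if a = c \<and> b = s \<and> d = t then if a = t then u else 1 else 0)
       + (if b = d \<and> a = s \<and> c = t then if b = t then v else 1 else 0)))
    + (if a = s \<and> b = s then 1 else 0) *
      (if c = t \<and> d = t \<and> 1 < k then C * C * shift s t u v (k - 2) x y else 0))" (is "hecke_eq q ?f")
    by (intro hecke_eq_add)
  also have "?f = (\<lambda>a b c d. shift s t u v k (a # b # x) (c # d # y))"
  proof (intro ext)
    fix a b c d
    show "?f a b c d = shift s t u v k (a # b # x) (c # d # y)"
    proof (cases "a = c")
      case True
      then show ?thesis
        using st by (cases k) (auto simp: C_def)
    next
      case False
      then show ?thesis
        using st by (cases k; cases "k - 1") (auto simp: C_def algebra_simps)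
    qed
  qed
  finally show ?thesis .
qed

text \<open>A letter in front of the pair contributes a factor that sees a and b only through the
  number of letters t, hence symmetrically.\<close>

lemma hecke_eq_shift:
  assumes "t = Suc s \<and> u = q * v \<or> s = Suc t \<and> v = q * u" "length w = length w'"
  shows "hecke_eq q (\<lambda>a b c d. shift s t u v k (w @ a # b # x) (w' @ c # d # y))"
  using assms(2)
proof (induction w w' arbitrary: k rule: list_induct2)
  case Nil
  then show ?case
    using hecke_eq_shift_base[OF assms(1)] by simp
next
  case (Cons e w e' w')
  consider "e = e'" | "e \<noteq> e'" "e = s" "e' = t" "0 < k" | "e \<noteq> e'" "\<not> (e = s \<and> e' = t \<and> 0 < k)"
    by blast
  then show ?case
  proof cases
    case 1
    have "hecke_eq q (\<lambda>a b c d. (if e = t then u ^ k else 1) * shift s t u v k (w @ a # b # x) (w' @ c # d # y))"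
      by (rule hecke_eq_mult[OF Cons.IH]) simp
    then show ?thesis
      unfolding 1 append_Cons shift.simps by (simp only: if_True refl)
  next
    case 2
    have "hecke_eq q (\<lambda>a b c d. v ^ count_list (w @ a # b # x) t * shift s t u v (k - 1) (w @ a # b # x) (w' @ c # d # y))"
      by (rule hecke_eq_mult[OF Cons.IH]) simp
    then show ?thesis
      unfolding append_Cons shift.simps using 2 by (simp only: if_True if_False simp_thms)
  next
    case 3
    then have "shift s t u v k ((e # w) @ a # b # x) ((e' # w') @ c # d # y) = 0" for a b c d
      by auto
    then show ?thesis
      by (simp only: hecke_eq_zero)
  qed
qed

lemma centralizing_shift:
  assumes "t = Suc s \<and> u = q * v \<or> s = Suc t \<and> v = q * u"
  shows "centralizing n q (shift s t u v k)"
  by (rule hecke_eq_centralizing) (rule hecke_eq_shift[OF assms])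

lemma centralizing_weight_proj: "centralizing n q (weight_proj \<mu>)"
proof (rule hecke_eq_centralizing)
  fix u v u' v' :: "nat list" assume len: "length u = length u'" "length v = length v'"
  let ?g = "\<lambda>a b. if u = u' \<and> v = v' \<and> {#a, b#} + mset u + mset v = \<mu> then 1 else 0"
  have "hecke_eq q (\<lambda>a b c d. ?g a b * (if a = c \<and> b = d then 1 else 0))"
    by (rule hecke_eq_mult[OF hecke_eq_diag]) (simp add: add_mset_commute)
  also have "(\<lambda>a b c d. ?g a b * (if a = c \<and> b = d then 1 else 0))
      = (\<lambda>a b c d. weight_proj \<mu> (u @ a # b # v) (u' @ c # d # v'))"
    using len by (auto simp: weight_proj_def fun_eq_iff)
  finally show "hecke_eq q (\<lambda>a b c d. weight_proj \<mu> (u @ a # b # v) (u' @ c # d # v'))" .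
qed

section \<open>Alternation inside blocks and the action on products of exterior powers\<close>

section \<open>The action on tensor products of exterior powers\<close>

definition blocks :: "nat \<Rightarrow> nat list \<Rightarrow> nat set list set"
  where "blocks n \<alpha> = {I. list_all2 (\<lambda>B s. B \<subseteq> {1..n} \<and> card B = s) I \<alpha>}"

definition flat :: "nat set list \<Rightarrow> nat list"
  where "flat I = concat (map sorted_list_of_set I)"

fun wedges :: "nat list \<Rightarrow> nat set list \<Rightarrow> 'k::field" where
  "wedges w [] = (if w = [] then 1 else 0)"
| "wedges w (J # Js) = wedge (take (card J) w) J * wedges (drop (card J) w) Js"

text \<open>The action of \<open>\<xi>\<close> on the product of exterior powers: lift a basis
  element to the word \<open>flat I\<close>, act on tensor space, and project back by
  \<open>wedges\<close>.\<close>

definition ext :: "nat \<Rightarrow> (nat list \<Rightarrow> nat list \<Rightarrow> 'k::field) \<Rightarrow> nat set list \<Rightarrow> nat set list \<Rightarrow> 'k"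
  where "ext n \<xi> I J = (\<Sum>w\<in>words n (length (flat I)). \<xi> (flat I) w * wedges w J)"

lemma blocks_Nil [simp]: "I \<in> blocks n [] \<longleftrightarrow> I = []"
  by (simp add: blocks_def)

lemma blocks_Cons:
  "I \<in> blocks n (s # \<alpha>) \<longleftrightarrow> (\<exists>B Bs. I = B # Bs \<and> B \<subseteq> {1..n} \<and> card B = s \<and> Bs \<in> blocks n \<alpha>)"
  by (auto simp: blocks_def list_all2_Cons2)

lemma blocks_Cons_eq: "blocks n (s # \<alpha>) = (\<lambda>(B, Bs). B # Bs) ` ({B. B \<subseteq> {1..n} \<and> card B = s} \<times> blocks n \<alpha>)"
  by (auto simp: blocks_Cons)

lemma finite_blocks [simp]: "finite (blocks n \<alpha>)"
proof (induction \<alpha>)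
  case Nil
  have "blocks n [] = {[]}" by auto
  then show ?case by simp
next
  case (Cons s \<alpha>)
  then show ?case by (simp add: blocks_Cons_eq)
qed

lemma sum_blocks_Cons:
  "(\<Sum>I\<in>blocks n (s # \<alpha>). f I) = (\<Sum>B\<in>{B. B \<subseteq> {1..n} \<and> card B = s}. \<Sum>Bs\<in>blocks n \<alpha>. f (B # Bs))"
  unfolding blocks_Cons_eq
  by (subst sum.reindex) (auto simp: inj_on_def sum.cartesian_product intro!: sum.cong)

lemma flat_simps [simp]: "flat [] = []" "flat (B # Bs) = sorted_list_of_set B @ flat Bs"
  by (simp_all add: flat_def)

lemma finite_subset_atLeastAtMost: "B \<subseteq> {1..n::nat} \<Longrightarrow> finite B"
  by (rule finite_subset[OF _ finite_atLeastAtMost])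

lemma sorted_in_words:
  "B \<subseteq> {1..n} \<Longrightarrow> sorted_list_of_set B \<in> words n (card B)"
  using finite_subset_atLeastAtMost[of B n] by (simp add: words_def)

lemma flat_in_words: "I \<in> blocks n \<alpha> \<Longrightarrow> flat I \<in> words n (sum_list \<alpha>)"
proof (induction \<alpha> arbitrary: I)
  case (Cons s \<alpha>)
  then obtain B Bs where "I = B # Bs" "B \<subseteq> {1..n}" "card B = s" "Bs \<in> blocks n \<alpha>"
    by (auto simp: blocks_Cons)
  then show ?case
    using sorted_in_words[of B n] Cons.IH[of Bs] by (auto simp: append_in_words simp del: One_nat_def)
qed simp

lemma not_sorted_descent:
  "\<not> sorted w \<Longrightarrow> \<exists>p. Suc p < length w \<and> w ! Suc p < w ! p"
proof (rule ccontr)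
  assume "\<not> sorted w" and "\<not> (\<exists>p. Suc p < length w \<and> w ! Suc p < w ! p)"
  then show False
    by (simp add: sorted_iff_nth_Suc) (metis not_less)
qed

lemma inversions_swap:
  "y < x \<Longrightarrow> inversions (u @ x # y # v) = Suc (inversions (u @ y # x # v))"
  by (induction u) auto

lemma sorted_not_distinct_adjacent:
  assumes "sorted w" "\<not> distinct w"
  shows "\<exists>p. Suc p < length w \<and> w ! p = w ! Suc p"
proof (rule ccontr)
  assume "\<not> ?thesis"
  then have "sorted_wrt (<) w"
    using assms(1) by (auto simp: sorted_wrt_iff_nth_Suc_transp le_less)
  then show False
    using assms(2) by (simp add: strict_sorted_iff)
qed

text \<open>Exchanging a descent lowers the number of inversions and changes the sign of both sides,
  so everything reduces to increasing words. Vanishing at equal neighbours is a separate hypothesis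
  because in characteristic 2 it does not follow from the change of sign.\<close>

lemma alternating_expand:
  fixes g :: "nat list \<Rightarrow> 'k::field"
  assumes "\<And>w p. w \<in> words n s \<Longrightarrow> Suc p < s \<Longrightarrow> g (swap_at p w) = - g w"
    and "\<And>w p. w \<in> words n s \<Longrightarrow> Suc p < s \<Longrightarrow> w ! p = w ! Suc p \<Longrightarrow> g w = 0"
    and "w \<in> words n s"
  shows "g w = (\<Sum>B\<in>{B. B \<subseteq> {1..n} \<and> card B = s}. wedge w B * g (sorted_list_of_set B))"
  using assms(3)
proof (induction "inversions w" arbitrary: w rule: less_induct)
  case less
  let ?S = "{B. B \<subseteq> {1..n} \<and> card B = s}"
  have len: "length w = s" and sub: "set w \<subseteq> {1..n}"
    using less.prems by (auto simp: words_def)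
  show ?case
  proof (cases "sorted w")
    case True
    show ?thesis
    proof (cases "distinct w")
      case distinct: True
      then have w: "w = sorted_list_of_set (set w)"
        using True by (simp add: sorted_list_of_set.idem_if_sorted_distinct)
      have "(\<Sum>B\<in>?S. wedge w B * g (sorted_list_of_set B))
          = (\<Sum>B\<in>?S. if B = set w then g w else 0)"
        using wedge_sorted[of "set w", where 'k = 'k] by (intro sum.cong) (simp_all add: w[symmetric])
      also have "\<dots> = g w"
        using len sub distinct finite_Collect_subsets[of "{1..n}"]
        by (subst sum.delta) (auto simp: distinct_card)
      finally show ?thesis ..
    next
      case False
      then obtain p where "Suc p < length w" "w ! p = w ! Suc p"
        using sorted_not_distinct_adjacent[OF True] by blast
      then have "g w = 0"
        using assms(2)[OF less.prems] len by simp
      then show ?thesis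
        using False by (simp add: wedge_def)
    qed
  next
    case False
    then obtain p where p: "Suc p < length w" "w ! Suc p < w ! p"
      using not_sorted_descent by blast
    have w: "w = take p w @ w ! p # w ! Suc p # drop (p + 2) w"
      by (rule split_at_adjacent[OF p(1)])
    have sw: "swap_at p w = take p w @ w ! Suc p # w ! p # drop (p + 2) w"
      using swap_at_append[of "take p w" "w ! p" "w ! Suc p" "drop (p + 2) w"] w p by simp
    have "inversions w = Suc (inversions (swap_at p w))"
      unfolding sw by (subst w) (rule inversions_swap[OF p(2)])
    then have "g (swap_at p w) = (\<Sum>B\<in>?S. wedge (swap_at p w) B * g (sorted_list_of_set B))"
      using less.hyps[of "swap_at p w"] p len swap_at_in_words[OF _ less.prems] by simp
    moreover have "wedge (swap_at p w) B = - (wedge w B :: 'k)" for B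
      unfolding sw by (subst (3) w) (rule wedge_swap)
    ultimately show ?thesis
      using assms(1)[OF less.prems, of p] p len by (simp add: sum_negf)
  qed
qed

text \<open>The places p and p + 1 lie in the same exterior factor.\<close>

fun inblock :: "nat list \<Rightarrow> nat \<Rightarrow> bool" where
  "inblock [] p \<longleftrightarrow> False"
| "inblock (s # \<alpha>) p \<longleftrightarrow> Suc p < s \<or> s \<le> p \<and> inblock \<alpha> (p - s)"

lemma inblock_less: "inblock \<alpha> p \<Longrightarrow> Suc p < sum_list \<alpha>"
  by (induction \<alpha> arbitrary: p) fastforce+

lemma alternating_blocks_expand:
  fixes g :: "nat list \<Rightarrow> 'k::field"
  assumes "\<And>w p. w \<in> words n (sum_list \<alpha>) \<Longrightarrow> inblock \<alpha> p \<Longrightarrow> g (swap_at p w) = - g w"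
    and "\<And>w p. w \<in> words n (sum_list \<alpha>) \<Longrightarrow> inblock \<alpha> p \<Longrightarrow> w ! p = w ! Suc p \<Longrightarrow> g w = 0"
    and "w \<in> words n (sum_list \<alpha>)"
  shows "g w = (\<Sum>I\<in>blocks n \<alpha>. wedges w I * g (flat I))"
  using assms
proof (induction \<alpha> arbitrary: g w)
  case Nil
  have "blocks n [] = {[]}" by auto
  then show ?case using Nil by simp
next
  case (Cons s \<alpha>)
  let ?S = "{B. B \<subseteq> {1..n} \<and> card B = s}"
  define v x where vx: "v = take s w" "x = drop s w"
  have w: "w = v @ x" "v \<in> words n s" "x \<in> words n (sum_list \<alpha>)"
    using Cons.prems(3) by (auto simp: vx words_def dest: in_set_takeD in_set_dropD)
  have app: "b @ y \<in> words n (sum_list (s # \<alpha>))" if "b \<in> words n s" "y \<in> words n (sum_list \<alpha>)" for b y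
    using that by (auto simp: append_in_words)
  have "g (v @ x) = (\<Sum>B\<in>?S. wedge v B * g (sorted_list_of_set B @ x))"
  proof (rule alternating_expand[where g = "\<lambda>v. g (v @ x)"])
    fix b p assume b: "b \<in> words n s" "Suc p < s"
    show "g (swap_at p b @ x) = - g (b @ x)"
      using Cons.prems(1)[OF app[OF b(1) w(3)], of p] b by (simp add: swap_at_append2 length_words)
    show "g (b @ x) = 0" if "b ! p = b ! Suc p"
      using Cons.prems(2)[OF app[OF b(1) w(3)], of p] b that by (simp add: nth_append length_words)
  qed (rule w(2))
  also have "\<dots> = (\<Sum>B\<in>?S. \<Sum>Bs\<in>blocks n \<alpha>. wedges w (B # Bs) * g (flat (B # Bs)))"
  proof (rule sum.cong[OF refl])
    fix B assume B: "B \<in> ?S"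
    then have b: "sorted_list_of_set B \<in> words n s"
      using sorted_in_words by blast
    have "g (sorted_list_of_set B @ x)
        = (\<Sum>Bs\<in>blocks n \<alpha>. wedges x Bs * g (sorted_list_of_set B @ flat Bs))"
    proof (rule Cons.IH[where g = "\<lambda>y. g (sorted_list_of_set B @ y)"])
      fix y p assume y: "y \<in> words n (sum_list \<alpha>)" "inblock \<alpha> p"
      show "g (sorted_list_of_set B @ swap_at p y) = - g (sorted_list_of_set B @ y)"
        using Cons.prems(1)[OF app[OF b y(1)], of "s + p"] y(2) length_words[OF b]
        by (simp add: swap_at_append2)
      show "g (sorted_list_of_set B @ y) = 0" if "y ! p = y ! Suc p"
        using Cons.prems(2)[OF app[OF b y(1)], of "s + p"] y(2) length_words[OF b] that
        by (simp add: nth_append)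
    qed (rule w(3))
    then show "wedge v B * g (sorted_list_of_set B @ x)
        = (\<Sum>Bs\<in>blocks n \<alpha>. wedges w (B # Bs) * g (flat (B # Bs)))"
      using B w length_words[OF w(2)] by (simp add: sum_distrib_left mult.assoc)
  qed
  also have "\<dots> = (\<Sum>I\<in>blocks n (s # \<alpha>). wedges w I * g (flat I))"
    by (rule sum_blocks_Cons[symmetric])
  finally show ?case using w(1) by simp
qed

lemma wedges_swap:
  fixes w :: "nat list"
  assumes "I \<in> blocks n \<alpha>" "inblock \<alpha> p" "length w = sum_list \<alpha>"
  shows "(wedges (swap_at p w) I :: 'k::field) = - wedges w I"
    and "w ! p = w ! Suc p \<Longrightarrow> (wedges w I :: 'k) = 0"
proof -
  have "(wedges (swap_at p w) I :: 'k) = - wedges w I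
      \<and> (w ! p = w ! Suc p \<longrightarrow> (wedges w I :: 'k) = 0)"
    using assms
  proof (induction \<alpha> arbitrary: I p w)
    case (Cons s \<alpha>)
    then obtain B Bs where I: "I = B # Bs" "card B = s" "Bs \<in> blocks n \<alpha>"
      by (auto simp: blocks_Cons)
    define v x where vx: "v = take s w" "x = drop s w"
    have w: "w = v @ x" "length v = s" "length x = sum_list \<alpha>"
      using Cons.prems(3) by (auto simp: vx)
    show ?case
    proof (cases "Suc p < s")
      case True
      have v: "v = take p v @ v ! p # v ! Suc p # drop (p + 2) v"
        by (rule split_at_adjacent) (simp add: True w)
      have sw: "swap_at p v = take p v @ v ! Suc p # v ! p # drop (p + 2) v"
        using swap_at_append[of "take p v" "v ! p" "v ! Suc p" "drop (p + 2) v"] v True w(2) by simp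
      have "wedge (swap_at p v) B = - (wedge v B :: 'k)"
        unfolding sw by (subst (3) v) (rule wedge_swap)
      moreover have "wedge v B = (0 :: 'k)" if "v ! p = v ! Suc p"
        by (subst v, simp only: that) (rule wedge_square)
      ultimately show ?thesis
        using True I w by (simp add: swap_at_append2 nth_append)
    next
      case False
      then have "s \<le> p" "inblock \<alpha> (p - s)"
        using Cons.prems(2) by auto
      then show ?thesis
        using Cons.IH[OF I(3) _ w(3), of "p - s"] I w False
        by (simp add: swap_at_append2 nth_append Suc_diff_le)
    qed
  qed simp
  then show "(wedges (swap_at p w) I :: 'k) = - wedges w I"
    and "w ! p = w ! Suc p \<Longrightarrow> (wedges w I :: 'k) = 0"
    by simp_all
qed

text \<open>At a descent, q (-x) + (q - 1) x = -x. So plain antisymmetry already gives the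
  eigenvalue -1 of T, and the exterior algebra keeps its classical signs for every q.\<close>

lemma hecke_row_wedges:
  assumes "I \<in> blocks n \<alpha>" "inblock \<alpha> p" "length w = sum_list \<alpha>"
  shows "hecke_row q p (\<lambda>w. wedges w I) w = - (wedges w I :: 'k::field)"
  using wedges_swap[OF assms, where 'k = 'k] by (auto simp: hecke_row_def algebra_simps)

text \<open>As \<open>\<xi>\<close> commutes with T, \<open>g\<close> is again an eigenvector for -1
  at p; for distinct letters this is the change of sign. For equal letters it says only (q + 1) g w
  = 0, which is empty for q = -1, so that case is treated by cancellation in pairs.\<close>

lemma centralizing_wedges_alternating:
  fixes \<xi> :: "nat list \<Rightarrow> nat list \<Rightarrow> 'k::field"
  assumes "centralizing n q \<xi>" "q \<noteq> 0" "I \<in> blocks n \<alpha>" "inblock \<alpha> p" "w \<in> words n (sum_list \<alpha>)"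
  defines "g \<equiv> \<lambda>w. \<Sum>x\<in>words n (sum_list \<alpha>). \<xi> w x * wedges x I"
  shows "w ! p = w ! Suc p \<Longrightarrow> g w = 0" and "g (swap_at p w) = - g w"
proof -
  let ?W = "words n (sum_list \<alpha>)"
  have p: "Suc p < sum_list \<alpha>"
    by (rule inblock_less[OF assms(4)])
  have row: "hecke_row q p g w = - g w" if w: "w \<in> ?W" for w
  proof -
    have "hecke_row q p g w = (\<Sum>x\<in>?W. hecke_row q p (\<lambda>w. \<xi> w x) w * wedges x I)"
      by (simp add: g_def hecke_row_sum)
    also have "\<dots> = (\<Sum>x\<in>?W. hecke_col q p (\<xi> w) x * wedges x I)"
      using assms(1) w p by (simp add: centralizing_def)
    also have "\<dots> = (\<Sum>x\<in>?W. \<xi> w x * hecke_row q p (\<lambda>w. wedges w I) x)"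
      by (rule hecke_adjoint[OF p, symmetric])
    also have "\<dots> = - g w"
      by (simp add: g_def hecke_row_wedges[OF assms(3,4)] length_words sum_negf)
    finally show ?thesis .
  qed
  have eq: "g w = 0" if w: "w \<in> ?W" "w ! p = w ! Suc p" for w
  proof -
    \<comment> \<open>With equal row letters, the row of \<open>\<xi>\<close> is an eigenvector of
      the right action of T for q, and this makes it symmetric in the two columns.\<close>
    have sym: "\<xi> w (swap_at p x) = \<xi> w x" if x: "x \<in> ?W" for x
    proof -
      have c: "hecke_col q p (\<xi> w) y = q * \<xi> w y" if y: "y \<in> ?W" for y
        using assms(1)[unfolded centralizing_def, rule_format, OF w(1) y p] w(2)
        by (simp add: hecke_row_def)
      have s: "swap_at p x \<in> ?W"
        by (rule swap_at_in_words[OF p x])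
      show ?thesis
        using c[OF x] c[OF s] assms(2) p x
        by (cases "x ! p" "x ! Suc p" rule: linorder_cases)
          (simp_all add: hecke_col_def swap_at_nth swap_at_eq length_words algebra_simps)
    qed
    \<comment> \<open>Columns with equal letters contribute nothing; the others cancel in pairs
      under the exchange, without any division by 2.\<close>
    define L R where "L x = (if x ! p < x ! Suc p then \<xi> w x * wedges x I else 0)"
      and "R x = (if x ! Suc p < x ! p then \<xi> w x * wedges x I else 0)" for x
    have "g w = (\<Sum>x\<in>?W. L x + R x)"
      unfolding g_def
      by (rule sum.cong) (use wedges_swap(2)[OF assms(3,4), where 'k = 'k] in
          \<open>auto simp: L_def R_def length_words not_less_iff_gr_or_eq\<close>)
    also have "\<dots> = (\<Sum>x\<in>?W. L x) + (\<Sum>x\<in>?W. R (swap_at p x))"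
      by (simp add: sum.distrib sum_swap_at[OF p])
    also have "(\<Sum>x\<in>?W. R (swap_at p x)) = (\<Sum>x\<in>?W. - L x)"
      by (rule sum.cong) (use wedges_swap(1)[OF assms(3,4), where 'k = 'k] p in
          \<open>auto simp: L_def R_def length_words sym swap_at_nth\<close>)
    finally show ?thesis by (simp add: sum_negf)
  qed
  show "w ! p = w ! Suc p \<Longrightarrow> g w = 0"
    by (rule eq[OF assms(5)])
  have s: "swap_at p w \<in> ?W"
    by (rule swap_at_in_words[OF p assms(5)])
  show "g (swap_at p w) = - g w"
  proof (cases "w ! p" "w ! Suc p" rule: linorder_cases)
    case less
    then show ?thesis
      using row[OF assms(5)] by (simp add: hecke_row_def)
  next
    case equal
    then show ?thesis
      using eq[OF assms(5)] swap_at_eq[of p w] p assms(5) by (simp add: length_words)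
  next
    case greater
    have "hecke_row q p g (swap_at p w) = g w"
      using greater p assms(5) by (simp add: hecke_row_def swap_at_nth length_words)
    then show ?thesis
      using row[OF s] by (metis minus_minus)
  qed
qed

text \<open>The image of a wedge under \<open>\<eta>\<close> alternates inside the blocks. It is
  therefore recovered from its values on the words \<open>flat K\<close>, and the action on tensor
  space passes to the exterior powers multiplicatively.\<close>

lemma ext_convolve:
  fixes \<xi> \<eta> :: "nat list \<Rightarrow> nat list \<Rightarrow> 'k::field"
  assumes "centralizing n q \<eta>" "q \<noteq> 0" "I \<in> blocks n \<alpha>" "J \<in> blocks n \<alpha>"
  shows "ext n (convolve n \<xi> \<eta>) I J = (\<Sum>K\<in>blocks n \<alpha>. ext n \<xi> I K * ext n \<eta> K J)"
proof -
  let ?W = "words n (sum_list \<alpha>)"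
  define g where "g w = (\<Sum>x\<in>?W. \<eta> w x * wedges x J)" for w
  have len: "length (flat K) = sum_list \<alpha>" if "K \<in> blocks n \<alpha>" for K
    using flat_in_words[OF that] by (rule length_words)
  have g: "g w = (\<Sum>K\<in>blocks n \<alpha>. wedges w K * g (flat K))" if "w \<in> ?W" for w
    using centralizing_wedges_alternating[OF assms(1,2,4)] that
    unfolding g_def[symmetric] by (intro alternating_blocks_expand) auto
  have "ext n (convolve n \<xi> \<eta>) I J = (\<Sum>w\<in>?W. \<Sum>l\<in>?W. \<xi> (flat I) l * (\<eta> l w * wedges w J))"
    by (simp add: ext_def convolve_def len assms sum_distrib_right mult.assoc)
  also have "\<dots> = (\<Sum>l\<in>?W. \<xi> (flat I) l * g l)"
    by (subst sum.swap) (simp add: g_def sum_distrib_left)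
  also have "\<dots> = (\<Sum>l\<in>?W. \<Sum>K\<in>blocks n \<alpha>. \<xi> (flat I) l * wedges l K * g (flat K))"
    by (rule sum.cong) (simp_all add: g sum_distrib_left mult.assoc)
  also have "\<dots> = (\<Sum>K\<in>blocks n \<alpha>. ext n \<xi> I K * g (flat K))"
    by (subst sum.swap) (simp add: ext_def len assms(3) sum_distrib_right)
  also have "\<dots> = (\<Sum>K\<in>blocks n \<alpha>. ext n \<xi> I K * ext n \<eta> K J)"
    by (rule sum.cong) (simp_all add: ext_def len g_def)
  finally show ?thesis .
qed

lemma wedges_flat:
  assumes "I \<in> blocks n \<alpha>" "J \<in> blocks n \<alpha>"
  shows "(wedges (flat I) J :: 'k::field) = (if I = J then 1 else 0)"
  using assms
proof (induction \<alpha> arbitrary: I J)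
  case (Cons s \<alpha>)
  then obtain B Bs C Cs where *: "I = B # Bs" "J = C # Cs" "B \<subseteq> {1..n}" "C \<subseteq> {1..n}"
      "card B = s" "card C = s" "Bs \<in> blocks n \<alpha>" "Cs \<in> blocks n \<alpha>"
    by (auto simp: blocks_Cons)
  then show ?case
    using Cons.IH[of Bs Cs] wedge_sorted[OF finite_subset_atLeastAtMost[of B n], of C, where 'k = 'k]
    by simp
qed simp

lemma ext_weight_proj:
  assumes "I \<in> blocks n \<alpha>" "J \<in> blocks n \<alpha>"
  shows "(ext n (weight_proj \<mu>) I J :: 'k::field) = (if I = J \<and> mset (flat I) = \<mu> then 1 else 0)"
proof -
  have "(ext n (weight_proj \<mu>) I J :: 'k) = (\<Sum>w\<in>words n (length (flat I)).
      if w = flat I then (if mset (flat I) = \<mu> then wedges w J else 0) else 0)"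
    unfolding ext_def by (rule sum.cong) (auto simp: weight_proj_def)
  then show ?thesis
    using flat_in_words[OF assms(1)] wedges_flat[OF assms, where 'k = 'k]
    by (cases "I = J") (simp_all add: length_words)
qed

section \<open>Divided powers acting on blocks, with sets in the role of letters\<close>

fun block_shift :: "nat \<Rightarrow> nat \<Rightarrow> 'k::field \<Rightarrow> 'k \<Rightarrow> nat \<Rightarrow> nat set list \<Rightarrow> nat set list \<Rightarrow> 'k" where
  "block_shift s t u v k [] [] = (if k = 0 then 1 else 0)"
| "block_shift s t u v k (B # Bs) (C # Cs) =
    (if B = C then (if t \<in> B then u ^ k else 1) * block_shift s t u v k Bs Cs
     else if s \<in> B \<and> t \<notin> B \<and> C = insert t (B - {s}) \<and> 0 < k
       then v ^ length (filter (\<lambda>B. t \<in> B) Bs) * block_shift s t u v (k - 1) Bs Cs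
     else 0)"
| "block_shift s t u v k _ _ = 0"

text \<open>The letters of a block are distinct, so s occurs at most once and at most one letter
  changes. If t were present already, the change would produce it twice.\<close>

lemma shift_append:
  assumes "length a = length l" "distinct a" "distinct l" "s \<noteq> t"
  shows "shift s t u v k (a @ x) (l @ y) =
    (if l = a then (if t \<in> set a then u ^ k else 1) * shift s t u v k x y
     else if s \<in> set a \<and> t \<notin> set a \<and> l = map (\<lambda>z. if z = s then t else z) a \<and> 0 < k
       then v ^ count_list x t * shift s t u v (k - 1) x y
     else 0)"
  using assms(1-3)
proof (induction a l arbitrary: k rule: list_induct2)
  case (Cons a as l ls)
  let ?m = "map (\<lambda>z. if z = s then t else z)"
  have IH: "shift s t u v k (as @ x) (ls @ y) =
    (if ls = as then (if t \<in> set as then u ^ k else 1) * shift s t u v k x y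
     else if s \<in> set as \<and> t \<notin> set as \<and> ls = ?m as \<and> 0 < k
       then v ^ count_list x t * shift s t u v (k - 1) x y
     else 0)" for k
    using Cons by simp
  have id: "?m as = as" if "s \<notin> set as"
    using that by (induction as) auto
  show ?case
  proof (cases "a = l")
    case True
    show ?thesis
    proof (cases "a = t")
      case t: True
      have "t \<notin> set (?m as)" if "ls = ?m as"
        using Cons.prems True t that by auto
      then have "ls \<noteq> ?m as \<or> s \<notin> set as"
        by auto
      then show ?thesis
        using True t IH[of k] Cons.prems assms(4) by auto
    next
      case False
      then show ?thesis
        using True IH[of k] Cons.prems assms(4) by auto
    qed
  next
    case False
    show ?thesis
    proof (cases "a = s \<and> l = t \<and> 0 < k")
      case True
      then have "s \<notin> set as" "t \<notin> set ls"
        using Cons.prems by auto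
      then show ?thesis
        using True IH[of "k - 1"] False id assms(4) by auto
    next
      case f: False
      then show ?thesis
        using False by auto
    qed
  qed
qed simp

lemma count_list_distinct: "distinct l \<Longrightarrow> count_list l t = (if t \<in> set l then 1 else 0)"
  by (induction l) auto

lemma count_list_flat: "count_list (flat Bs) t = length (filter (\<lambda>B. t \<in> B) Bs)"
  if "\<forall>B\<in>set Bs. finite B"
  using that
proof (induction Bs)
  case (Cons B Bs)
  then have "count_list (sorted_list_of_set B) t = (if t \<in> B then 1 else 0)"
    by (simp add: count_list_distinct)
  then show ?case using Cons by simp
qed simp

lemma blocks_subset: "I \<in> blocks n \<alpha> \<Longrightarrow> B \<in> set I \<Longrightarrow> B \<subseteq> {1..n}"
  by (induction \<alpha> arbitrary: I) (simp, metis blocks_Cons set_ConsD)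

text \<open>Replacing s by its neighbour t keeps an increasing word increasing, so no sign appears.
  For distant s and t, the letters in between would produce one.\<close>

lemma wedge_map_adjacent:
  assumes "finite B" "s \<in> B" "t \<notin> B" "t = Suc s \<or> s = Suc t"
  shows "(wedge (map (\<lambda>z. if z = s then t else z) (sorted_list_of_set B)) C :: 'k::field)
    = (if C = insert t (B - {s}) then 1 else 0)"
proof -
  let ?f = "\<lambda>z. if z = s then t else z" and ?l = "sorted_list_of_set B"
  have "sorted_wrt (<) (map ?f ?l)"
    unfolding sorted_wrt_map
    by (rule sorted_wrt_mono_rel[of _ "(<)"]) (use assms in \<open>auto simp: strict_sorted_iff less_Suc_eq intro!: Suc_lessI\<close>)
  then have "map ?f ?l = sorted_list_of_set (set (map ?f ?l))"
    by (metis strict_sorted_iff sorted_list_of_set.idem_if_sorted_distinct)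
  also have "set (map ?f ?l) = insert t (B - {s})"
    using assms by (auto simp: image_iff)
  finally have eq: "map ?f ?l = sorted_list_of_set (insert t (B - {s}))" .
  show ?thesis
    unfolding eq by (rule wedge_sorted) (simp add: assms(1))
qed

text \<open>Column words with a repeated letter in the leading block are killed by
  \<open>wedge\<close>. Among the others only the block itself and its image under the change of s
  into t survive, whence two terms \<open>P\<close> and \<open>Q\<close>.\<close>

lemma ext_shift:
  assumes "t = Suc s \<or> s = Suc t" "t \<in> {1..n}"
    and "I \<in> blocks n \<alpha>" "J \<in> blocks n \<alpha>"
  shows "(ext n (shift s t u v k) I J :: 'k::field) = block_shift s t u v k I J"
  using assms(3,4)
proof (induction \<alpha> arbitrary: I J k)
  case Nil
  then show ?case by (simp add: ext_def)
next
  case (Cons a \<alpha>)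
  obtain B Bs where I: "I = B # Bs" "B \<subseteq> {1..n}" "card B = a" "Bs \<in> blocks n \<alpha>"
    using Cons.prems by (auto simp: blocks_Cons)
  obtain C Cs where J: "J = C # Cs" "C \<subseteq> {1..n}" "card C = a" "Cs \<in> blocks n \<alpha>"
    using Cons.prems by (auto simp: blocks_Cons)
  have fin: "finite B" "\<forall>B\<in>set Bs. finite B"
    using finite_subset_atLeastAtMost[OF I(2)] finite_subset_atLeastAtMost[OF blocks_subset[OF I(4)]]
    by simp_all
  have st: "s \<noteq> t" using assms(1) by auto
  let ?b = "sorted_list_of_set B" and ?L = "length (flat Bs)"
  let ?b' = "map (\<lambda>z. if z = s then t else z) ?b"
  have b: "?b \<in> words n a"
    using sorted_in_words[OF I(2)] I(3) by simp
  have b': "?b' \<in> words n a"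
    using b assms(2) by (auto simp: words_def)
  let ?change = "s \<in> B \<and> t \<notin> B \<and> 0 < k"
  define P where "P = (if t \<in> B then u ^ k else 1) * ext n (shift s t u v k) Bs Cs"
  define Q where "Q = v ^ length (filter (\<lambda>B. t \<in> B) Bs) * ext n (shift s t u v (k - 1)) Bs Cs"
  have "ext n (shift s t u v k) I J = (\<Sum>l\<in>words n a. \<Sum>x\<in>words n ?L.
      shift s t u v k (?b @ flat Bs) (l @ x) * wedges (l @ x) J)"
    using I by (simp add: ext_def sum_words_add)
  also have "\<dots> = (\<Sum>l\<in>words n a. wedge l C * (\<Sum>x\<in>words n ?L.
      shift s t u v k (?b @ flat Bs) (l @ x) * wedges x Cs))"
    using J by (intro sum.cong) (simp_all add: length_words sum_distrib_left mult_ac)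
  also have "\<dots> = (\<Sum>l\<in>words n a. (if l = ?b then wedge ?b C * P else 0)
      + (if l = ?b' then if ?change then wedge ?b' C * Q else 0 else 0))"
  proof (rule sum.cong[OF refl])
    fix l assume l: "l \<in> words n a"
    have ne: "?b \<noteq> ?b'" if "?change"
    proof
      assume "?b = ?b'"
      then have "set ?b = set ?b'" by simp
      then show False using that fin st by (auto simp: image_iff)
    qed
    show "wedge l C * (\<Sum>x\<in>words n ?L. shift s t u v k (?b @ flat Bs) (l @ x) * wedges x Cs)
      = (if l = ?b then wedge ?b C * P else 0)
      + (if l = ?b' then if ?change then wedge ?b' C * Q else 0 else 0)"
    proof (cases "distinct l")
      case True
      have len: "length ?b = length l"
        using b l by (simp add: words_def)
      have app: "shift s t u v k (?b @ flat Bs) (l @ x) =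
        (if l = ?b then (if t \<in> B then u ^ k else 1) * shift s t u v k (flat Bs) x
         else if ?change \<and> l = ?b'
           then v ^ length (filter (\<lambda>B. t \<in> B) Bs) * shift s t u v (k - 1) (flat Bs) x
         else 0)" for x
        using shift_append[OF len _ True st, of u v k "flat Bs" x] fin(1) count_list_flat[OF fin(2)]
        by simp
      consider "l = ?b" | "l \<noteq> ?b" "l = ?b'" ?change | "l \<noteq> ?b" "\<not> (l = ?b' \<and> ?change)"
        by blast
      then show ?thesis
      proof cases
        case 1
        then have "(if l = ?b' then if ?change then wedge ?b' C * Q else 0 else 0) = 0"
          using ne by argo
        moreover have "shift s t u v k (?b @ flat Bs) (l @ x)
            = (if t \<in> B then u ^ k else 1) * shift s t u v k (flat Bs) x" for x
          unfolding app using 1 by argo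
        then have "(\<Sum>x\<in>words n ?L. shift s t u v k (?b @ flat Bs) (l @ x) * wedges x Cs) = P"
          by (simp only: P_def ext_def sum_distrib_left mult.assoc)
        ultimately show ?thesis
          using 1 by simp
      next
        case 2
        have "shift s t u v k (?b @ flat Bs) (l @ x)
            = v ^ length (filter (\<lambda>B. t \<in> B) Bs) * shift s t u v (k - 1) (flat Bs) x" for x
          unfolding app using 2 by (simp only: if_True if_False simp_thms)
        then have "(\<Sum>x\<in>words n ?L. shift s t u v k (?b @ flat Bs) (l @ x) * wedges x Cs) = Q"
          by (simp only: Q_def ext_def sum_distrib_left mult.assoc)
        then show ?thesis
          using 2 by simp
      next
        case 3
        then have "(if l = ?b' then if ?change then wedge ?b' C * Q else 0 else 0) = 0"
          by argo
        moreover have "shift s t u v k (?b @ flat Bs) (l @ x) = 0" for x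
          unfolding app using 3 by argo
        ultimately show ?thesis
          using 3(1) by simp
      qed
    next
      case False
      then have "l \<noteq> ?b" by auto
      then show ?thesis
        using False by (auto simp: wedge_def)
    qed
  qed
  also have "\<dots> = wedge ?b C * P + (if ?change then wedge ?b' C * Q else 0)"
    by (simp only: sum.distrib sum.delta' sum.delta finite_words b b' if_True)
  also have "\<dots> = block_shift s t u v k I J"
  proof -
    have b1: "wedge ?b C = (if C = B then 1 else 0 :: 'k)"
      by (rule wedge_sorted[OF fin(1)])
    have b2: "wedge ?b' C = (if C = insert t (B - {s}) then 1 else 0 :: 'k)" if ?change
      using wedge_map_adjacent[where 'k = 'k, OF fin(1) _ _ assms(1)] that
      by simp
    have PQ: "P = (if t \<in> B then u ^ k else 1) * block_shift s t u v k Bs Cs"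
      "Q = v ^ length (filter (\<lambda>B. t \<in> B) Bs) * block_shift s t u v (k - 1) Bs Cs"
      unfolding P_def Q_def Cons.IH[OF I(4) J(4)] by (rule refl)+
    show ?thesis
    proof (cases "B = C")
      case True
      then have "?change \<Longrightarrow> C \<noteq> insert t (B - {s})" by blast
      then show ?thesis
        unfolding b1 I(1) J(1) block_shift.simps PQ using True b2 by auto
    next
      case False
      then show ?thesis
        unfolding b1 I(1) J(1) block_shift.simps PQ using b2 by auto
    qed
  qed
  finally show ?case .
qed

text \<open>Read from the right end, \<open>u\<close> and \<open>v\<close> exchange their roles.
  This form is needed because complementation reverses the blocks.\<close>

lemma block_shift_snoc:
  assumes "length I = length J"
  shows "block_shift s t u v k (I @ [B]) (J @ [C]) =
    (if B = C then (if t \<in> B then v ^ k else 1) * block_shift s t u v k I J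
     else if s \<in> B \<and> t \<notin> B \<and> C = insert t (B - {s}) \<and> 0 < k
       then u ^ length (filter (\<lambda>B. t \<in> B) I) * block_shift s t u v (k - 1) I J
     else 0)"
  using assms
proof (induction I J arbitrary: k rule: list_induct2)
  case Nil
  then show ?case by (cases k) auto
next
  case (Cons A I A' J)
  show ?case
  proof (cases k)
    case 0
    then show ?thesis using Cons.IH[of 0] by auto
  next
    case (Suc k')
    have 1: "block_shift s t u v k ((A # I) @ [B]) ((A' # J) @ [C]) =
      (if A = A' then (if t \<in> A then u ^ k else 1) * block_shift s t u v k (I @ [B]) (J @ [C])
       else if s \<in> A \<and> t \<notin> A \<and> A' = insert t (A - {s})
       then v ^ length (filter (\<lambda>B. t \<in> B) (I @ [B])) * block_shift s t u v k' (I @ [B]) (J @ [C])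
       else 0)"
      by (simp add: Suc)
    show ?thesis
      unfolding 1 Cons.IH[of k] Cons.IH[of k']
      by (simp add: Suc mult_ac)
  qed
qed

section \<open>Complementation, reversal of blocks and the compensating power of q\<close>

section \<open>Complements\<close>

text \<open>Counts the pairs y < x with x in B and y in the complement of C.\<close>

definition crossings :: "nat set \<Rightarrow> nat set \<Rightarrow> nat"
  where "crossings B C = (\<Sum>x\<in>B. card ({1..<x} - C))"

text \<open>Conjugation with the diagonal matrix with entries $q^{c(I)}$, where $c(I)$ is the crossing
  number, turns the action of the root vectors on $\bigwedge^\alpha V$ into the action of the
  opposite root vectors on $\bigwedge^{n - \alpha} V$.\<close>

fun crossing_number :: "nat set list \<Rightarrow> nat" where
  "crossing_number [] = 0"
| "crossing_number (B # Bs) = (\<Sum>C\<leftarrow>Bs. crossings B C) + crossing_number Bs"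

text \<open>Only the pair x = s + 1, y = s is new: for larger x the new y = s replaces the lost y =
  s + 1.\<close>

lemma crossings_raise_right:
  assumes "finite B" "s \<in> C" "Suc s \<notin> C" "1 \<le> s"
  shows "crossings B (insert (Suc s) (C - {s})) = crossings B C + (if Suc s \<in> B then 1 else 0)"
proof -
  have "card ({1..<x} - insert (Suc s) (C - {s})) = card ({1..<x} - C) + (if x = Suc s then 1 else 0)" for x
  proof -
    consider "x \<le> s" | "x = Suc s" | "Suc s < x" by linarith
    then show ?thesis
    proof cases
      case 1
      then have "{1..<x} - insert (Suc s) (C - {s}) = {1..<x} - C" by auto
      then show ?thesis using 1 by simp
    next
      case 2
      then have "{1..<x} - insert (Suc s) (C - {s}) = insert s ({1..<x} - C)"
        using assms by auto
      then show ?thesis using 2 assms by simp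
    next
      case 3
      then have "{1..<x} - insert (Suc s) (C - {s}) = insert s ({1..<x} - C - {Suc s})"
        using assms by auto
      moreover have "Suc s \<in> {1..<x} - C" using 3 assms by auto
      ultimately show ?thesis
        using 3 assms by (simp add: card_Suc_Diff1 del: card_Diff_insert)
    qed
  qed
  then show ?thesis
    using assms(1) by (simp add: crossings_def sum.distrib)
qed

text \<open>Moving x from s to s + 1 adds y = s to the elements below it, and this counts unless s
  lies in C.\<close>

lemma crossings_raise_left:
  assumes "finite B" "s \<in> B" "Suc s \<notin> B" "1 \<le> s"
  shows "crossings (insert (Suc s) (B - {s})) C = crossings B C + (if s \<in> C then 0 else 1)"
proof -
  have "crossings (insert (Suc s) (B - {s})) C
      = card ({1..<Suc s} - C) + (\<Sum>x\<in>B - {s}. card ({1..<x} - C))"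
    unfolding crossings_def using assms by simp
  moreover have "crossings B C = card ({1..<s} - C) + (\<Sum>x\<in>B - {s}. card ({1..<x} - C))"
    unfolding crossings_def using assms by (intro sum.remove)
  moreover have "{1..<Suc s} - C = (if s \<in> C then {1..<s} - C else insert s ({1..<s} - C))"
    using assms by (auto simp: less_Suc_eq)
  ultimately show ?thesis by simp
qed

text \<open>A nonzero entry raises exactly k blocks, and each of them gains one crossing with B if s
  + 1 lies in B.\<close>

lemma block_shift_up_crossings:
  assumes "block_shift s (Suc s) u v k Bs Cs \<noteq> 0" "finite B" "1 \<le> s"
  shows "(\<Sum>C\<leftarrow>Cs. crossings B C) = (\<Sum>C\<leftarrow>Bs. crossings B C) + (if Suc s \<in> B then k else 0)"
  using assms(1)
proof (induction Bs arbitrary: Cs k)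
  case Nil
  then show ?case by (cases Cs) (auto split: if_splits)
next
  case (Cons D Ds)
  then obtain E Es where "Cs = E # Es" by (cases Cs) auto
  with Cons crossings_raise_right[OF assms(2) _ _ assms(3)] show ?case
    by (auto split: if_splits)
qed

lemma block_shift_down_crossings:
  assumes "block_shift (Suc s) s u v k Bs Cs \<noteq> 0" "finite B" "1 \<le> s"
  shows "(\<Sum>C\<leftarrow>Bs. crossings B C) = (\<Sum>C\<leftarrow>Cs. crossings B C) + (if Suc s \<in> B then k else 0)"
  using assms(1)
proof (induction Bs arbitrary: Cs k)
  case Nil
  then show ?case by (cases Cs) (auto split: if_splits)
next
  case (Cons D Ds)
  then obtain E Es where Cs: "Cs = E # Es" by (cases Cs) auto
  show ?case
  proof (cases "D = E")
    case True
    then show ?thesis using Cons Cs by (auto split: if_splits)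
  next
    case False
    then have *: "Suc s \<in> D" "s \<notin> D" "E = insert s (D - {Suc s})" "0 < k"
      "block_shift (Suc s) s u v (k - 1) Ds Es \<noteq> 0"
      using Cons.prems Cs by (auto split: if_splits)
    then have "D = insert (Suc s) (E - {s})" "s \<in> E" "Suc s \<notin> E" by auto
    then have "crossings B D = crossings B E + (if Suc s \<in> B then 1 else 0)"
      using crossings_raise_right[OF assms(2) _ _ assms(3), of E] by simp
    then show ?thesis
      using Cons.IH[OF *(5)] Cs *(4) by auto
  qed
qed

lemma block_shift_le: "block_shift s t u v k Bs Cs \<noteq> 0 \<Longrightarrow> k \<le> length Bs \<and> length Cs = length Bs"
proof (induction Bs arbitrary: k Cs)
  case Nil
  then show ?case by (cases Cs) (auto split: if_splits)
next
  case (Cons B Bs)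
  then obtain C Cs' where Cs: "Cs = C # Cs'" by (cases Cs) auto
  show ?case
  proof (cases "B = C")
    case True
    then show ?thesis using Cons.IH[of k Cs'] Cons.prems Cs by auto
  next
    case False
    then show ?thesis using Cons.IH[of "k - 1" Cs'] Cons.prems Cs by (auto split: if_splits)
  qed
qed

abbreviation complements :: "nat \<Rightarrow> nat set list \<Rightarrow> nat set list"
  where "complements n I \<equiv> rev (map (\<lambda>B. {1..n} - B) I)"

text \<open>Exchanging s for t in B is exchanging t for s in its complement. The free
  \<open>P\<close> allows the condition of \<open>block_shift\<close> to be rewritten together with
  \<open>0 < k\<close>.\<close>

lemma complement_exchange:
  assumes "B \<subseteq> {1..n}" "C \<subseteq> {1..n}" "s \<in> {1..n}" "t \<in> {1..n}" "s \<noteq> t"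
  shows "{1..n} - B = {1..n} - C \<longleftrightarrow> B = C"
    and "t \<in> {1..n} - B \<and> s \<notin> {1..n} - B \<and> {1..n} - C = insert s ({1..n} - B - {t}) \<and> P
      \<longleftrightarrow> s \<in> B \<and> t \<notin> B \<and> C = insert t (B - {s}) \<and> P"
proof -
  have inj: "{1..n} - B = {1..n} - C \<longleftrightarrow> B = C" if "B \<subseteq> {1..n}" "C \<subseteq> {1..n}" for B C
    using that by blast
  show "{1..n} - B = {1..n} - C \<longleftrightarrow> B = C"
    by (rule inj[OF assms(1,2)])
  have "insert s ({1..n} - B - {t}) = {1..n} - insert t (B - {s})"
    using assms by blast
  moreover have "insert t (B - {s}) \<subseteq> {1..n}"
    using assms by blast
  ultimately have "{1..n} - C = insert s ({1..n} - B - {t}) \<longleftrightarrow> C = insert t (B - {s})"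
    using inj[OF assms(2), of "insert t (B - {s})"] by simp
  then show "t \<in> {1..n} - B \<and> s \<notin> {1..n} - B \<and> {1..n} - C = insert s ({1..n} - B - {t}) \<and> P
      \<longleftrightarrow> s \<in> B \<and> t \<notin> B \<and> C = insert t (B - {s}) \<and> P"
    using assms(3,4) by blast
qed

lemma length_filter_complements:
  "x \<in> {1..n} \<Longrightarrow> length (filter (\<lambda>B. x \<in> B) (complements n I)) = length (filter (\<lambda>B. x \<notin> B) I)"
  by (induction I) auto

lemma sum_list_crossings_raise:
  assumes "finite B" "s \<in> B" "Suc s \<notin> B" "1 \<le> s"
  shows "(\<Sum>C\<leftarrow>Bs. crossings (insert (Suc s) (B - {s})) C)
    = (\<Sum>C\<leftarrow>Bs. crossings B C) + length (filter (\<lambda>C. s \<notin> C) Bs)"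
  by (induction Bs) (simp_all add: crossings_raise_left[OF assms])

text \<open>For an unchanged leading block, the factor \<open>q ^ k\<close> is the growth of its
  crossings with the later blocks. For a changed one, the growth consists of the number of later
  blocks without s, which the factors 1/q on the complements cancel, and of k - 1 from the later
  changed blocks. Thus one q remains for each pair of changed blocks, which gives k choose
  2.\<close>

lemma block_shift_complements_up:
  fixes q :: "'k::field"
  assumes "q \<noteq> 0" "length I = length J" "\<forall>B\<in>set I \<union> set J. B \<subseteq> {1..n}" "1 \<le> s" "Suc s \<le> n"
  shows "block_shift (Suc s) s (1 / q) 1 k (complements n I) (complements n J) * q ^ crossing_number J
    = q ^ (k choose 2) * q ^ crossing_number I * block_shift s (Suc s) q 1 k I J"
  using assms(2,3)
proof (induction I J arbitrary: k rule: list_induct2)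
  case (Cons B Is C Js)
  let ?X' = "\<lambda>k. block_shift (Suc s) s (1 / q) 1 k (complements n Is) (complements n Js)"
  let ?X = "\<lambda>k. block_shift s (Suc s) q 1 k Is Js"
  have sub: "B \<subseteq> {1..n}" "C \<subseteq> {1..n}" and finB: "finite B" "finite C"
    using Cons.prems finite_subset_atLeastAtMost by auto
  have IH: "?X' k * q ^ crossing_number Js = q ^ (k choose 2) * q ^ crossing_number Is * ?X k" for k
    using Cons by simp
  have n: "s \<in> {1..n}" "Suc s \<in> {1..n}" "s \<noteq> Suc s" using assms(4,5) by auto
  note co = complement_exchange[OF sub n]
  have len: "length (complements n Is) = length (complements n Js)"
    using Cons.hyps by simp
  have snoc: "block_shift (Suc s) s (1 / q) 1 k (complements n (B # Is)) (complements n (C # Js)) =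
    (if B = C then ?X' k
     else if s \<in> B \<and> Suc s \<notin> B \<and> C = insert (Suc s) (B - {s}) \<and> 0 < k
       then (1 / q) ^ length (filter (\<lambda>B. s \<notin> B) Is) * ?X' (k - 1)
     else 0)"
    unfolding list.map rev.simps block_shift_snoc[OF len] co length_filter_complements[OF n(1)] power_one
    by simp
  consider "B = C" | "B \<noteq> C" "s \<in> B" "Suc s \<notin> B" "C = insert (Suc s) (B - {s})" "0 < k"
    | "B \<noteq> C" "\<not> (s \<in> B \<and> Suc s \<notin> B \<and> C = insert (Suc s) (B - {s}) \<and> 0 < k)"
    by blast
  then show ?case
  proof cases
    case 1
    have "?X' k * q ^ crossing_number (C # Js) = q ^ (\<Sum>D\<leftarrow>Js. crossings C D) * (?X' k * q ^ crossing_number Js)"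
      by (simp add: power_add mult_ac)
    also have "\<dots> = q ^ (k choose 2) * q ^ crossing_number Is * (q ^ (\<Sum>D\<leftarrow>Js. crossings C D) * ?X k)"
      unfolding IH by (simp add: mult_ac)
    also have "q ^ (\<Sum>D\<leftarrow>Js. crossings C D) * ?X k
        = q ^ (\<Sum>D\<leftarrow>Is. crossings C D) * ((if Suc s \<in> C then q ^ k else 1) * ?X k)"
      using block_shift_up_crossings[of s q 1 k Is Js C] finB assms(4)
      by (cases "?X k = 0") (simp_all add: power_add)
    finally show ?thesis
      unfolding snoc using 1 by (simp add: power_add mult_ac)
  next
    case 2
    let ?N = "length (filter (\<lambda>B. s \<notin> B) Is)"
    have "k choose 2 = (k - 1 choose 2) + (k - 1)"
      using 2(5) by (cases k) (simp_all add: numeral_2_eq_2)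
    then have k: "q ^ (k choose 2) = q ^ (k - 1 choose 2) * q ^ (k - 1)"
      by (simp only: power_add)
    have "block_shift (Suc s) s (1 / q) 1 k (complements n (B # Is)) (complements n (C # Js))
        * q ^ crossing_number (C # Js)
      = (1 / q) ^ ?N * q ^ (\<Sum>D\<leftarrow>Js. crossings C D) * (?X' (k - 1) * q ^ crossing_number Js)"
      unfolding snoc using 2 by (simp add: power_add mult_ac)
    also have "\<dots> = q ^ (k - 1 choose 2) * q ^ crossing_number Is
        * ((1 / q) ^ ?N * (q ^ (\<Sum>D\<leftarrow>Js. crossings C D) * ?X (k - 1)))"
      unfolding IH by (simp add: mult_ac)
    also have "q ^ (\<Sum>D\<leftarrow>Js. crossings C D) * ?X (k - 1)
        = q ^ (\<Sum>D\<leftarrow>Is. crossings B D) * q ^ ?N * q ^ (k - 1) * ?X (k - 1)"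
      using block_shift_up_crossings[of s q 1 "k - 1" Is Js C] finB assms(4) 2
        sum_list_crossings_raise[OF finB(1) 2(2,3) assms(4), of Is]
      by (cases "?X (k - 1) = 0"; cases k) (simp_all add: power_add)
    also have "(1 / q) ^ ?N * (q ^ (\<Sum>D\<leftarrow>Is. crossings B D) * q ^ ?N * q ^ (k - 1) * ?X (k - 1))
        = q ^ (\<Sum>D\<leftarrow>Is. crossings B D) * q ^ (k - 1) * ?X (k - 1)"
      using assms(1) by (simp add: power_divide)
    finally show ?thesis
      using 2 by (simp add: k power_add mult_ac)
  next
    case 3
    then show ?thesis unfolding snoc by (auto simp del: One_nat_def)
  qed
qed (simp add: numeral_2_eq_2)

text \<open>The same count for lowering. With m blocks the scalar is q to the power (m - k choose 2)
  - (m choose 2); this exponent is never positive, so its two parts stand on different sides. Both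
  depend only on the number of blocks and on k.\<close>

lemma block_shift_complements_down:
  fixes q :: "'k::field"
  assumes "q \<noteq> 0" "length I = length J" "\<forall>B\<in>set I \<union> set J. B \<subseteq> {1..n}" "1 \<le> s" "Suc s \<le> n"
  shows "block_shift s (Suc s) 1 (1 / q) k (complements n I) (complements n J)
      * q ^ crossing_number J * q ^ (length I choose 2)
    = q ^ (length I - k choose 2) * q ^ crossing_number I * block_shift (Suc s) s 1 q k I J"
  using assms(2,3)
proof (induction I J arbitrary: k rule: list_induct2)
  case (Cons B Is C Js)
  let ?X' = "\<lambda>k. block_shift s (Suc s) 1 (1 / q) k (complements n Is) (complements n Js)"
  let ?X = "\<lambda>k. block_shift (Suc s) s 1 q k Is Js" and ?m = "length Is"
  have sub: "B \<subseteq> {1..n}" "C \<subseteq> {1..n}" and finB: "finite B" "finite C"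
    using Cons.prems finite_subset_atLeastAtMost by auto
  have IH: "?X' k * q ^ crossing_number Js * q ^ (?m choose 2)
      = q ^ (?m - k choose 2) * q ^ crossing_number Is * ?X k" for k
    using Cons by simp
  have n: "Suc s \<in> {1..n}" "s \<in> {1..n}" "Suc s \<noteq> s" using assms(4,5) by auto
  note co = complement_exchange[OF sub n]
  have len: "length (complements n Is) = length (complements n Js)"
    using Cons.hyps by simp
  have snoc: "block_shift s (Suc s) 1 (1 / q) k (complements n (B # Is)) (complements n (C # Js)) =
    (if B = C then (if Suc s \<in> B then 1 else (1 / q) ^ k) * ?X' k
     else if Suc s \<in> B \<and> s \<notin> B \<and> C = insert s (B - {Suc s}) \<and> 0 < k
       then ?X' (k - 1)
     else 0)"
    unfolding list.map rev.simps block_shift_snoc[OF len] co power_one using n by simp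
  have m: "Suc ?m choose 2 = (?m choose 2) + ?m"
    by (simp add: numeral_2_eq_2)
  consider "B = C" | "B \<noteq> C" "Suc s \<in> B" "s \<notin> B" "C = insert s (B - {Suc s})" "0 < k"
    | "B \<noteq> C" "\<not> (Suc s \<in> B \<and> s \<notin> B \<and> C = insert s (B - {Suc s}) \<and> 0 < k)"
    by blast
  then show ?case
  proof cases
    case 1
    show ?thesis
    proof (cases "?X k = 0")
      case True
      then have "?X' k = 0" using IH[of k] assms(1) by simp
      then show ?thesis using True snoc 1 by simp
    next
      case False
      \<comment> \<open>A nonzero entry changes k different blocks, so the subtraction m - k is not
        truncated.\<close>
      then have "k \<le> ?m" using block_shift_le by blast
      then have mk: "Suc ?m - k choose 2 = (?m - k choose 2) + (?m - k)"
        by (simp add: Suc_diff_le numeral_2_eq_2)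
      have q: "(if Suc s \<in> C then 1 else (1 / q) ^ k) * (q ^ (\<Sum>D\<leftarrow>Js. crossings C D) * q ^ ?m)
        = q ^ (?m - k) * q ^ (\<Sum>D\<leftarrow>Is. crossings C D)"
        using block_shift_down_crossings[OF False finB(2) assms(4)] \<open>k \<le> ?m\<close> assms(1)
        by (simp add: power_add power_divide power_diff)
      have "block_shift s (Suc s) 1 (1 / q) k (complements n (B # Is)) (complements n (C # Js))
          * q ^ crossing_number (C # Js) * q ^ (length (B # Is) choose 2)
        = (if Suc s \<in> C then 1 else (1 / q) ^ k) * (q ^ (\<Sum>D\<leftarrow>Js. crossings C D) * q ^ ?m)
          * (?X' k * q ^ crossing_number Js * q ^ (?m choose 2))"
        unfolding snoc using 1 m by (simp add: power_add mult_ac)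
      also have "\<dots> = q ^ (?m - k) * q ^ (\<Sum>D\<leftarrow>Is. crossings C D)
          * (q ^ (?m - k choose 2) * q ^ crossing_number Is * ?X k)"
        unfolding q IH ..
      finally show ?thesis
        using 1 mk by (simp add: power_add mult_ac)
    qed
  next
    case 2
    let ?N = "length (filter (\<lambda>B. s \<in> B) Is)"
    have B: "B = insert (Suc s) (C - {s})" "s \<in> C" "Suc s \<notin> C"
      using 2 by auto
    \<comment> \<open>Going from \<open>C\<close> up to \<open>B\<close> gains a crossing for each
      later block without s, while the factors \<open>v\<close> count those with s; together these
      are all later blocks.\<close>
    have len: "length (filter (\<lambda>B. s \<notin> B) Is) + ?N = ?m"
      using sum_length_filter_compl[of "\<lambda>B. s \<in> B" Is] by simp
    have q: "q ^ (\<Sum>D\<leftarrow>Js. crossings C D) * q ^ ?m * ?X (k - 1)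
        = q ^ (\<Sum>D\<leftarrow>Is. crossings B D) * q ^ ?N * ?X (k - 1)"
    proof (cases "?X (k - 1) = 0")
      case False
      have "(\<Sum>D\<leftarrow>Js. crossings C D) + ?m = (\<Sum>D\<leftarrow>Is. crossings B D) + ?N"
        using block_shift_down_crossings[OF False finB(2) assms(4)] B(3) len
          sum_list_crossings_raise[OF finB(2) B(2,3) assms(4), of Is]
        unfolding B(1)[symmetric] by simp
      then show ?thesis by (simp only: power_add[symmetric])
    qed (simp add: numeral_2_eq_2)
    have "block_shift s (Suc s) 1 (1 / q) k (complements n (B # Is)) (complements n (C # Js))
        * q ^ crossing_number (C # Js) * q ^ (length (B # Is) choose 2)
      = q ^ (\<Sum>D\<leftarrow>Js. crossings C D) * q ^ ?m
        * (?X' (k - 1) * q ^ crossing_number Js * q ^ (?m choose 2))"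
      unfolding snoc using 2 m by (simp add: power_add mult_ac)
    also have "\<dots> = q ^ (?m - (k - 1) choose 2) * q ^ crossing_number Is
        * (q ^ (\<Sum>D\<leftarrow>Js. crossings C D) * q ^ ?m * ?X (k - 1))"
      unfolding IH by (simp add: mult_ac)
    finally show ?thesis
      unfolding q using 2 by (simp add: power_add mult_ac)
  next
    case 3
    then show ?thesis unfolding snoc by (auto simp del: One_nat_def)
  qed
qed (simp add: numeral_2_eq_2)

section \<open>Ordered monomials span A(n)\<close>

section \<open>Straightening\<close>

declare One_nat_def [simp del]

context
  fixes n :: nat and q :: "'k::field"
begin

interpretation F: ring "qfree n :: ((nat \<times> nat) word \<Rightarrow>\<^sub>0 'k) ring"
  by (rule ring_free_alg)

interpretation I: ideal "qideal n q" "qfree n"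
  by (rule ideal_qideal)

lemmas qfree_add = F.a_closed[unfolded free_alg_simps]
  and qfree_mult = F.m_closed[unfolded free_alg_simps]
  and qfree_zero = F.zero_closed[unfolded free_alg_simps]
  and qideal_add = I.a_closed[unfolded free_alg_simps]
  and qideal_left = I.I_l_closed[unfolded free_alg_simps]
  and qideal_right = I.I_r_closed[unfolded free_alg_simps]
  and qideal_zero = I.zero_closed[unfolded free_alg_simps]

lemma qfree_uminus: "p \<in> carrier (qfree n) \<Longrightarrow> - p \<in> carrier (qfree n :: ((nat \<times> nat) word \<Rightarrow>\<^sub>0 'k) ring)"
  by (simp add: free_alg_def)

lemma qfree_diff: "p \<in> carrier (qfree n) \<Longrightarrow> p' \<in> carrier (qfree n)
    \<Longrightarrow> p - p' \<in> carrier (qfree n :: ((nat \<times> nat) word \<Rightarrow>\<^sub>0 'k) ring)"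
  using qfree_add[of p "- p'"] qfree_uminus[of p'] by simp

lemma qfree_sum: "(\<And>x. x \<in> S \<Longrightarrow> f x \<in> carrier (qfree n))
    \<Longrightarrow> (\<Sum>x\<in>S. f x) \<in> carrier (qfree n :: ((nat \<times> nat) word \<Rightarrow>\<^sub>0 'k) ring)"
  by (induction S rule: infinite_finite_induct) (simp_all add: qfree_add qfree_zero)

lemma qideal_sum: "(\<And>x. x \<in> S \<Longrightarrow> f x \<in> qideal n q) \<Longrightarrow> (\<Sum>x\<in>S. f x) \<in> qideal n q"
  by (induction S rule: infinite_finite_induct) (simp_all add: qideal_add qideal_zero)

lemma qideal_const: "p \<in> qideal n q \<Longrightarrow> const a * p \<in> qideal n q"
  by (rule qideal_left[OF _ const_in_free_alg])

lemma qideal_trans: "p - p' \<in> qideal n q \<Longrightarrow> p' - p'' \<in> qideal n q \<Longrightarrow> p - p'' \<in> qideal n q"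
  using qideal_add[of "p - p'" "p' - p''"] by simp

lemma qcoset_eq_iff:
  assumes "p \<in> carrier (qfree n)" "p' \<in> carrier (qfree n)"
  shows "qcoset n q p = qcoset n q p' \<longleftrightarrow> p - p' \<in> qideal n q"
proof
  assume eq: "qcoset n q p = qcoset n q p'"
  have "p \<in> qcoset n q p"
    unfolding qcoset_def by (rule I.a_rcos_self[OF assms(1)])
  then obtain h where "h \<in> qideal n q" "p = h + p'"
    unfolding eq by (auto simp: qcoset_def a_r_coset_def' free_alg_simps)
  then show "p - p' \<in> qideal n q" by simp
next
  assume d: "p - p' \<in> qideal n q"
  have "p = (p - p') + p'" by simp
  then have "p \<in> qcoset n q p'"
    unfolding qcoset_def a_r_coset_def' free_alg_simps using d by blast
  then show "qcoset n q p = qcoset n q p'"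
    unfolding qcoset_def using F.a_repr_independence[OF _ assms(2) I.additive_subgroup_axioms[unfolded additive_subgroup_def]] by simp
qed

abbreviation monom_word :: "(nat \<times> nat) list \<Rightarrow> (nat \<times> nat) word \<Rightarrow>\<^sub>0 'k"
  where "monom_word z \<equiv> Poly_Mapping.single (Word z) 1"

lemma monom_word_carrier:
  "set z \<subseteq> {1..n} \<times> {1..n} \<Longrightarrow> monom_word z \<in> carrier (qfree n)"
  by (simp add: free_alg_def)

lemma qideal_relation:
  assumes "set z \<subseteq> {1..n} \<times> {1..n}" "set z' \<subseteq> {1..n} \<times> {1..n}" "p - p' \<in> qrels n q"
  shows "monom_word z * p * monom_word z' - monom_word z * p' * monom_word z' \<in> qideal n q"
proof -
  have "p - p' \<in> qideal n q"
    unfolding qideal_def using F.genideal_self[OF qrels_subset, of q] assms(3) by blast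
  then have "monom_word z * (p - p') * monom_word z' \<in> qideal n q"
    by (intro qideal_right qideal_left monom_word_carrier assms)
  then show ?thesis
    by (simp add: algebra_simps)
qed

text \<open>Sorting refers to the lexicographic order of index pairs, row index before column
  index.\<close>

definition straightens :: "((nat \<times> nat) word \<Rightarrow>\<^sub>0 'k) \<Rightarrow> bool"
  where "straightens p \<longleftrightarrow> (\<exists>p'\<in>carrier (qfree n).
    (\<forall>w\<in>Poly_Mapping.keys p'. sorted (letters w)) \<and> p - p' \<in> qideal n q)"

lemma straightens_add:
  assumes "straightens p" "straightens p'"
  shows "straightens (p + p')"
proof -
  obtain x y where x: "x \<in> carrier (qfree n)" "\<forall>w\<in>Poly_Mapping.keys x. sorted (letters w)" "p - x \<in> qideal n q"
    and y: "y \<in> carrier (qfree n)" "\<forall>w\<in>Poly_Mapping.keys y. sorted (letters w)" "p' - y \<in> qideal n q"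
    using assms unfolding straightens_def by blast
  have "(p + p') - (x + y) \<in> qideal n q"
    using qideal_add[OF x(3) y(3)] by (simp add: algebra_simps)
  then show ?thesis
    unfolding straightens_def
    using x y qfree_add[OF x(1) y(1)] subsetD[OF Poly_Mapping.keys_add[of x y]] by blast
qed

lemma straightens_const:
  assumes "straightens p"
  shows "straightens (const a * p)"
proof -
  obtain x where x: "x \<in> carrier (qfree n)" "\<forall>w\<in>Poly_Mapping.keys x. sorted (letters w)" "p - x \<in> qideal n q"
    using assms unfolding straightens_def by blast
  have "const a * p - const a * x \<in> qideal n q"
    using qideal_const[OF x(3), of a] by (simp add: algebra_simps)
  moreover have "Poly_Mapping.keys (const a * x) \<subseteq> Poly_Mapping.keys x"
    using Poly_Mapping.keys_mult[of "const a" x]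
    by (auto simp: const_def plus_word_def zero_word_def split: if_splits)
  ultimately show ?thesis
    unfolding straightens_def
    using x qfree_mult[OF const_in_free_alg x(1)] by blast
qed

lemma straightens_cong: "p - p' \<in> qideal n q \<Longrightarrow> straightens p' \<Longrightarrow> straightens p"
  unfolding straightens_def using qideal_trans by blast

text \<open>The relations, read as rewriting rules, terminate. Exchanging distinct rows lowers the
  inversions of the row indices in every monomial of the result, whatever happens to the columns;
  inside equal rows the row indices stay and the column inversions drop.\<close>

lemma straightens_monom_word:
  assumes "set z \<subseteq> {1..n} \<times> {1..n}"
  shows "straightens (monom_word z)"
  using assms
proof (induction z rule: wf_induct_rule[OF wf_measures[of "[\<lambda>z. inversions (map fst z), \<lambda>z. inversions (map snd z)]"]])
  case (1 z)
  note IH = 1(1)[unfolded measures_less measures_lesseq in_measures]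
  show ?case
  proof (cases "sorted z")
    case True
    then show ?thesis
      unfolding straightens_def using monom_word_carrier[OF 1(2)] qideal_zero
      by (intro bexI[of _ "monom_word z"]) simp_all
  next
    case False
    then obtain p where p: "Suc p < length z" "z ! Suc p < z ! p"
      by (simp add: sorted_iff_nth_Suc) (metis not_less)
    obtain j r where jr: "z ! p = (j, r)" by fastforce
    obtain i s where es: "z ! Suc p = (i, s)" by fastforce
    define a b where "a = take p z" and "b = drop (p + 2) z"
    have z: "z = a @ (j, r) # (i, s) # b"
      using split_at_adjacent[OF p(1)] jr es by (simp add: a_def b_def)
    have ab: "set a \<subseteq> {1..n} \<times> {1..n}" "set b \<subseteq> {1..n} \<times> {1..n}"
      and ijrs: "i \<in> {1..n}" "j \<in> {1..n}" "r \<in> {1..n}" "s \<in> {1..n}"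
      using 1(2) unfolding z by auto
    have m: "monom_word (a @ x # y # b) = monom_word a * (gen x * gen y) * monom_word b" for x y
      by (simp add: gen_def mult_single plus_word_def)
    have sub: "set (a @ (i', s') # (j', r') # b) \<subseteq> {1..n} \<times> {1..n}"
      if "{i', j', r', s'} \<subseteq> {1..n}" for i' s' j' r'
      using ab that by auto
    have mc: "monom_word a * (const x * p) * monom_word b = const x * (monom_word a * p * monom_word b)" for x p
    proof -
      have "monom_word a * const x = const x * monom_word a"
        by (simp add: const_def mult_single)
      then show ?thesis
        by (simp only: mult.assoc[symmetric])
    qed
    have "i < j \<or> i = j \<and> s < r"
      using p(2) unfolding jr es by auto
    then consider "i = j" "s < r" | "i < j" "r \<le> s" | "i < j" "s < r"
      using not_less by blast
    then show ?thesis
    proof cases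
      case 1
      have "straightens (monom_word (a @ (i, s) # (j, r) # b))"
        using IH[of "a @ (i, s) # (j, r) # b"] sub ab ijrs
          inversions_swap[OF 1(2), of "map snd a" "map snd b"] 1(1)
        by (simp add: z)
      moreover have "gen (j, r) * gen (i, s) - gen (i, s) * gen (j, r) \<in> qrels n q"
        unfolding qrels_def using ijrs 1 by blast
      from qideal_relation[OF ab this] have "monom_word z - monom_word (a @ (i, s) # (j, r) # b) \<in> qideal n q"
        unfolding z m .
      ultimately show ?thesis
        using straightens_cong by blast
    next
      case 2
      have "straightens (monom_word (a @ (i, s) # (j, r) # b))"
        using IH[of "a @ (i, s) # (j, r) # b"] sub ab ijrs
          inversions_swap[OF 2(1), of "map fst a" "map fst b"]
        by (simp add: z)
      then have "straightens (const q * monom_word (a @ (i, s) # (j, r) # b))"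
        by (rule straightens_const)
      moreover have "gen (j, r) * gen (i, s) - const q * (gen (i, s) * gen (j, r)) \<in> qrels n q"
        unfolding qrels_def using ijrs 2 by blast
      from qideal_relation[OF ab this] have "monom_word z - const q * monom_word (a @ (i, s) # (j, r) # b) \<in> qideal n q"
        unfolding z m mc .
      ultimately show ?thesis
        using straightens_cong by blast
    next
      case 3
      have "straightens (monom_word (a @ (i, s) # (j, r) # b))" "straightens (monom_word (a @ (i, r) # (j, s) # b))"
        using IH[of "a @ (i, s) # (j, r) # b"] IH[of "a @ (i, r) # (j, s) # b"] sub ab ijrs
          inversions_swap[OF 3(1), of "map fst a" "map fst b"]
        by (simp_all add: z)
      then have "straightens (monom_word (a @ (i, s) # (j, r) # b) + const (q - 1) * monom_word (a @ (i, r) # (j, s) # b))"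
        by (intro straightens_add straightens_const)
      moreover have "gen (j, r) * gen (i, s) - (gen (i, s) * gen (j, r) + const (q - 1) * (gen (i, r) * gen (j, s))) \<in> qrels n q"
        unfolding qrels_def using ijrs 3 by blast
      from qideal_relation[OF ab this] have "monom_word z - (monom_word (a @ (i, s) # (j, r) # b)
          + const (q - 1) * monom_word (a @ (i, r) # (j, s) # b)) \<in> qideal n q"
        unfolding z m mc[symmetric] by (simp only: distrib_left distrib_right)
      ultimately show ?thesis
        using straightens_cong by blast
    qed
  qed
qed

lemma straightening:
  assumes "p \<in> carrier (qfree n)"
  shows "straightens p"
proof -
  have "straightens (\<Sum>w\<in>S. Poly_Mapping.single w (Poly_Mapping.lookup p w))"
    if "finite S" "S \<subseteq> Poly_Mapping.keys p" for S
    using that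
  proof (induction S rule: finite_induct)
    case empty
    show ?case
      unfolding straightens_def using qideal_zero qfree_zero by (intro bexI[of _ 0]) simp_all
  next
    case (insert w S)
    have "set (letters w) \<subseteq> {1..n} \<times> {1..n}"
      using assms insert by (auto simp: free_alg_def)
    from straightens_const[OF straightens_monom_word[OF this], of "Poly_Mapping.lookup p w"]
    have "straightens (Poly_Mapping.single w (Poly_Mapping.lookup p w))"
      by (simp add: const_def mult_single plus_word_def zero_word_def)
    then show ?case
      using insert by (simp add: straightens_add)
  qed
  from this[of "Poly_Mapping.keys p"] show ?thesis
    by (subst poly_mapping_expand) simp
qed

end

section \<open>Triangularity of products of divided powers on ordered monomials\<close>

section \<open>Separation\<close>

text \<open>The steps change the row word one after another, and the projection at the end fixes the
  content of the resulting column word.\<close>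

fun shift_product :: "nat \<Rightarrow> (nat \<Rightarrow> nat \<Rightarrow> 'k::field) \<Rightarrow> (nat \<Rightarrow> nat \<Rightarrow> 'k) \<Rightarrow> nat multiset
    \<Rightarrow> (nat \<times> nat) list \<Rightarrow> nat list \<Rightarrow> nat list \<Rightarrow> nat list \<Rightarrow> 'k" where
  "shift_product n u v \<mu> [] [] = weight_proj \<mu>"
| "shift_product n u v \<mu> ((s, t) # os) (k # ks) =
    convolve n (shift s t (u s t) (v s t) k) (shift_product n u v \<mu> os ks)"
| "shift_product n u v \<mu> _ _ = (\<lambda>i j. 0)"

text \<open>A letter x can become j by taking part in some of the steps, in the given order.\<close>

fun reach :: "(nat \<times> nat) list \<Rightarrow> nat \<Rightarrow> nat \<Rightarrow> bool" where
  "reach [] x j \<longleftrightarrow> x = j"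
| "reach ((s, t) # os) x j \<longleftrightarrow> reach os x j \<or> x = s \<and> reach os t j"

text \<open>A pair consists of the current letter and its target. It is forced at a step if skipping
  this step would put the target out of reach.\<close>

definition forced :: "nat \<Rightarrow> (nat \<times> nat) list \<Rightarrow> nat \<times> nat \<Rightarrow> bool"
  where "forced s os y \<longleftrightarrow> fst y = s \<and> \<not> reach os (fst y) (snd y)"

definition advance :: "nat \<Rightarrow> nat \<Rightarrow> (nat \<times> nat) list \<Rightarrow> nat \<times> nat \<Rightarrow> nat \<times> nat"
  where "advance s t os y = (if forced s os y then t else fst y, snd y)"

lemma forced_iff: "forced s os y \<longleftrightarrow> fst y = s \<and> \<not> reach os s (snd y)"
  by (auto simp: forced_def)

text \<open>Number of letters moved by each step, if all letters move as late as possible.\<close>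

fun lazy_counts :: "(nat \<times> nat) list \<Rightarrow> (nat \<times> nat) list \<Rightarrow> nat list" where
  "lazy_counts [] z = []"
| "lazy_counts ((s, t) # os) z =
    length (filter (forced s os) z) # lazy_counts os (map (advance s t os) z)"

lemma shift_nonzeroD:
  assumes "shift s t u v k i l \<noteq> 0"
  shows "length i = length l \<and> (\<forall>y\<in>set (zip i l). snd y = fst y \<or> y = (s, t))
    \<and> k = length (filter (\<lambda>y. fst y \<noteq> snd y) (zip i l))"
  using assms
proof (induction s t u v k i l rule: shift.induct)
  case (2 s t u v k x xs y ys)
  then show ?case by (auto split: if_splits)
qed (auto split: if_splits)

lemma shift_nonzeroI:
  assumes "u \<noteq> 0" "v \<noteq> 0" "length i = length l" "\<forall>y\<in>set (zip i l). snd y = fst y \<or> y = (s, t)"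
  shows "shift s t u v (length (filter (\<lambda>y. fst y \<noteq> snd y) (zip i l))) i l \<noteq> 0"
  using assms(3,4)
proof (induction i l rule: list_induct2)
  case (Cons x xs y ys)
  then show ?case using assms(1,2) by (cases "x = y") auto
qed simp

text \<open>Every forced letter has to move, so their number is a lower bound. If it is attained, no
  other letter has moved, and the intermediate word is determined.\<close>

lemma forced_moves:
  assumes "length z = length l" "\<forall>y\<in>set (zip (map fst z) l). snd y = fst y \<or> y = (s, t)" "s \<noteq> t"
    and "\<forall>y\<in>set (zip l (map snd z)). reach os (fst y) (snd y)"
  shows "length (filter (forced s os) z) \<le> length (filter (\<lambda>y. fst y \<noteq> snd y) (zip (map fst z) l))
    \<and> (length (filter (forced s os) z) = length (filter (\<lambda>y. fst y \<noteq> snd y) (zip (map fst z) l))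
      \<longrightarrow> l = map fst (map (advance s t os) z))"
  using assms(1,2,4)
proof (induction z l rule: list_induct2)
  case (Cons y z x l)
  have IH: "length (filter (forced s os) z) \<le> length (filter (\<lambda>y. fst y \<noteq> snd y) (zip (map fst z) l))"
    "length (filter (forced s os) z) = length (filter (\<lambda>y. fst y \<noteq> snd y) (zip (map fst z) l))
      \<Longrightarrow> l = map fst (map (advance s t os) z)"
    using Cons by auto
  have x: "x = fst y \<or> fst y = s \<and> x = t" and r: "reach os x (snd y)"
    using Cons.prems by auto
  have a: "fst (advance s t os y) = (if forced s os y then t else fst y)"
    by (simp add: advance_def)
  consider "forced s os y" "fst y \<noteq> x" "x = t" | "\<not> forced s os y" "fst y = x" | "\<not> forced s os y" "fst y \<noteq> x"
    using x r unfolding forced_def by blast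
  then show ?case
    by cases (use IH a in simp_all)
qed simp

text \<open>Lists are compared lexicographically. A path contributing to the convolution moves at
  least the forced letters at its first step: an excess decides the comparison at once, and equality
  means that the step was the lazy one, so the comparison passes to the remaining steps.\<close>

lemma shift_product_nonzeroD:
  assumes "shift_product n u v \<mu> os ks (map fst z) (map snd z) \<noteq> 0" "\<forall>(s, t)\<in>set os. s \<noteq> t"
  shows "lazy_counts os z \<le> ks \<and> mset (map snd z) = \<mu> \<and> (\<forall>y\<in>set z. reach os (fst y) (snd y))"
  using assms
proof (induction os arbitrary: ks z)
  case Nil
  then have "ks = []" by (cases ks) auto
  then have eq: "map fst z = map snd z" and "mset (map fst z) = \<mu>"
    using Nil by (auto simp: weight_proj_def split: if_splits)
  have "mset (map snd z) = \<mu>" "\<forall>y\<in>set z. fst y = snd y"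
    using \<open>mset (map fst z) = \<mu>\<close>[unfolded eq] eq[unfolded map_eq_conv] by blast+
  then show ?case
    using \<open>ks = []\<close> by (simp del: mset_map)
next
  case (Cons e os)
  obtain s t where e: "e = (s, t)" by fastforce
  obtain k ks' where ks: "ks = k # ks'" using Cons.prems(1) by (cases ks) (auto simp: e)
  have "(\<Sum>l\<in>words n (length z). shift s t (u s t) (v s t) k (map fst z) l
      * shift_product n u v \<mu> os ks' l (map snd z)) \<noteq> 0"
    using Cons.prems(1) by (simp add: e ks convolve_def)
  then obtain l where l: "l \<in> words n (length z)" "shift s t (u s t) (v s t) k (map fst z) l \<noteq> 0"
    "shift_product n u v \<mu> os ks' l (map snd z) \<noteq> 0"
    by (metis (no_types, lifting) mult_zero_left mult_zero_right sum.neutral)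
  define z' where "z' = zip l (map snd z)"
  have len: "length l = length z" using l(1) by (rule length_words)
  then have z': "map fst z' = l" "map snd z' = map snd z" by (simp_all add: z'_def)
  have IH: "lazy_counts os z' \<le> ks'" "mset (map snd z) = \<mu>" "\<forall>y\<in>set z'. reach os (fst y) (snd y)"
    using Cons.IH[of ks' z'] l(3) Cons.prems(2) by (simp_all add: z')
  note sh = shift_nonzeroD[OF l(2)]
  have st: "s \<noteq> t" using Cons.prems(2) e by auto
  have forced: "length (filter (forced s os) z) \<le> k"
    "length (filter (forced s os) z) = k \<Longrightarrow> l = map fst (map (advance s t os) z)"
    using forced_moves[of z l s t os] sh len st IH(3) unfolding z'_def by auto
  have "lazy_counts (e # os) z \<le> ks"
  proof (cases "length (filter (forced s os) z) = k")
    case True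
    have "z' = map (advance s t os) z"
      unfolding z'_def forced(2)[OF True]
      by (rule nth_equalityI) (auto simp: advance_def)
    then show ?thesis using IH(1) True by (simp add: e ks)
  next
    case False
    then show ?thesis using forced(1) by (simp add: e ks)
  qed
  moreover have "reach (e # os) (fst y) (snd y)" if y: "y \<in> set z" for y
  proof -
    obtain p where p: "p < length z" "y = z ! p" using y by (auto simp: in_set_conv_nth)
    then have "(l ! p, snd y) \<in> set z'" "(fst y, l ! p) \<in> set (zip (map fst z) l)"
      using len nth_mem[of p z'] nth_mem[of p "zip (map fst z) l"] by (simp_all add: z'_def)
    then show ?thesis using IH(3) sh by (fastforce simp: e)
  qed
  ultimately show ?case using IH(2) by blast
qed

text \<open>With the lazy counts, the lower bound leaves no choice at any step. A single path
  contributes, so nothing can cancel, and its value is a product of nonzero factors.\<close>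

lemma shift_product_lazy_nonzero:
  assumes "\<forall>(s, t)\<in>set os. s \<noteq> t \<and> t \<in> {1..n} \<and> u s t \<noteq> 0 \<and> v s t \<noteq> (0 :: 'k::field)"
    and "map fst z \<in> words n (length z)" "\<forall>y\<in>set z. reach os (fst y) (snd y)"
  shows "shift_product n u v (mset (map snd z)) os (lazy_counts os z) (map fst z) (map snd z) \<noteq> 0"
  using assms
proof (induction os arbitrary: z)
  case Nil
  then have eq: "map fst z = map snd z" by auto
  show ?case unfolding shift_product.simps lazy_counts.simps weight_proj_def eq by simp
next
  case (Cons e os)
  obtain s t where e: "e = (s, t)" by fastforce
  have st: "s \<noteq> t" "t \<in> {1..n}" "u s t \<noteq> 0" "v s t \<noteq> 0" using Cons.prems(1) e by auto
  define z' where "z' = map (advance s t os) z"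
  define k where "k = length (filter (forced s os) z)"
  let ?\<mu> = "mset (map snd z)" and ?l = "map fst z'"
  have z': "map snd z' = map snd z" "length z' = length z"
    by (simp_all add: z'_def advance_def)
  have l: "?l \<in> words n (length z)"
    using Cons.prems(2) st(2) by (auto simp: words_def z'_def advance_def)
  let ?f = "\<lambda>l. shift s t (u s t) (v s t) k (map fst z) l
    * shift_product n u v ?\<mu> os (lazy_counts os z') l (map snd z)"
  have "\<forall>y\<in>set z'. reach os (fst y) (snd y)"
    using Cons.prems(3) by (auto simp: z'_def e advance_def forced_def)
  then have 1: "shift_product n u v ?\<mu> os (lazy_counts os z') ?l (map snd z) \<noteq> 0"
    using Cons.IH[of z'] Cons.prems(1) l z' by simp
  have "length (filter (\<lambda>y. fst y \<noteq> snd y) (zip (map fst z) ?l)) = k"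
    "\<forall>y\<in>set (zip (map fst z) ?l). snd y = fst y \<or> y = (s, t)"
    unfolding k_def z'_def using st(1)
    by (induction z) (auto simp: advance_def forced_def)
  then have 2: "shift s t (u s t) (v s t) k (map fst z) ?l \<noteq> 0"
    using shift_nonzeroI[OF st(3,4), of "map fst z" ?l s t] z' by simp
  \<comment> \<open>The count k is the least possible one, so an intermediate word from which the
    targets remain reachable must be the lazy one.\<close>
  have "?f l = 0" if "l \<in> words n (length z)" "l \<noteq> ?l" for l
  proof (rule ccontr)
    assume "?f l \<noteq> 0"
    then have sh: "shift s t (u s t) (v s t) k (map fst z) l \<noteq> 0"
      and sp: "shift_product n u v ?\<mu> os (lazy_counts os z') l (map snd z) \<noteq> 0" by auto
    have len: "length l = length z" using that(1) by (rule length_words)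
    define y where "y = zip l (map snd z)"
    have y: "map fst y = l" "map snd y = map snd z" using len by (simp_all add: y_def)
    have "\<forall>x\<in>set y. reach os (fst x) (snd x)"
      using shift_product_nonzeroD[of n u v ?\<mu> os "lazy_counts os z'" y] sp Cons.prems(1) y by auto
    then have "l = ?l"
      using forced_moves[of z l s t os] shift_nonzeroD[OF sh] len st(1)
      unfolding y_def z'_def k_def by auto
    then show False using that(2) by blast
  qed
  then have "(\<Sum>l\<in>words n (length z) - {?l}. ?f l) = 0"
    by (intro sum.neutral) blast
  then have "(\<Sum>l\<in>words n (length z). ?f l) = ?f ?l"
    using sum.remove[OF finite_words l, of ?f] by simp
  then show ?case
    using 1 2 by (simp add: e convolve_def k_def z'_def)
qed


section \<open>A sequence of simple roots whose lazy counts determine an ordered monomial\<close>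

definition raising :: "nat \<Rightarrow> nat \<Rightarrow> (nat \<times> nat) list"
  where "raising h s = map (\<lambda>h. (h, Suc h)) [h..<s]"

definition lowering :: "nat \<Rightarrow> nat \<Rightarrow> (nat \<times> nat) list"
  where "lowering s h = map (\<lambda>h. (Suc h, h)) (rev [s..<h])"

fun raising_stages :: "nat \<Rightarrow> (nat \<times> nat) list" where
  "raising_stages 0 = []"
| "raising_stages (Suc s) = raising 1 (Suc s) @ raising_stages s"

text \<open>A letter \<open>i < j\<close> can be moved to \<open>j\<close> only in one of the raising stages \<open>n, \<dots>, j\<close>, and a
  letter \<open>i > j\<close> only in one of the lowering stages \<open>1, \<dots>, j\<close>, so that a lazy letter makes all
  its moves in stage \<open>j\<close>.\<close>

definition stages_from :: "nat \<Rightarrow> nat \<Rightarrow> (nat \<times> nat) list"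
  where "stages_from n s = concat (map (\<lambda>s. lowering s n) [s..<n]) @ raising_stages n"

lemma raising_Cons: "h < s \<Longrightarrow> raising h s = (h, Suc h) # raising (Suc h) s"
  by (simp add: raising_def upt_conv_Cons)

lemma raising_refl: "raising s s = []"
  by (simp add: raising_def)

lemma lowering_Suc: "s \<le> h \<Longrightarrow> lowering s (Suc h) = (Suc h, h) # lowering s h"
  by (simp add: lowering_def)

lemma lowering_refl: "lowering s s = []"
  by (simp add: lowering_def)

lemma stages_from_less: "s < n \<Longrightarrow> stages_from n s = lowering s n @ stages_from n (Suc s)"
  by (simp add: stages_from_def upt_conv_Cons)

lemma stages_from_n: "stages_from n n = raising_stages n"
  by (simp add: stages_from_def)

text \<open>The sweep towards s + 1 has arrived at h: letters below h have missed it and can only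
  reach targets served by later stages.\<close>

lemma reach_raising:
  assumes "\<And>x j. 1 \<le> x \<Longrightarrow> reach os x j \<longleftrightarrow> x = j \<or> x < j \<and> j \<le> s" "h \<le> Suc s" "1 \<le> h" "1 \<le> x"
  shows "reach (raising h (Suc s) @ os) x j \<longleftrightarrow> x = j \<or> x < j \<and> (j \<le> s \<or> j = Suc s \<and> h \<le> x)"
  using assms(2,3,4)
proof (induction h arbitrary: x rule: inc_induct)
  case base
  then show ?case using assms(1) by (auto simp: raising_refl)
next
  case (step h)
  have "reach (raising h (Suc s) @ os) x j \<longleftrightarrow> reach (raising (Suc h) (Suc s) @ os) x j
      \<or> x = h \<and> reach (raising (Suc h) (Suc s) @ os) (Suc h) j"
    using step.hyps by (simp add: raising_Cons)
  then show ?case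
    using step.IH[of x] step.IH[of "Suc h"] step.prems step.hyps by auto
qed

lemma reach_raising_stages: "1 \<le> x \<Longrightarrow> reach (raising_stages s) x j \<longleftrightarrow> x = j \<or> x < j \<and> j \<le> s"
proof (induction s arbitrary: x j)
  case (Suc s)
  then show ?case
    using reach_raising[of "raising_stages s" s 1 x j] by auto
qed auto

text \<open>The later stages no longer bring a larger letter down to s. The current sweep still does
  so for the letters up to h, which it has not passed yet.\<close>

lemma reach_lowering:
  assumes "\<And>x j. x \<in> {1..n} \<Longrightarrow> j \<in> {1..n} \<Longrightarrow> reach os x j \<longleftrightarrow> x \<le> j \<or> Suc s \<le> j"
    and "s \<le> h" "1 \<le> s" "h \<le> n" "x \<in> {1..n}" "j \<in> {1..n}"
  shows "reach (lowering s h @ os) x j \<longleftrightarrow> x \<le> j \<or> Suc s \<le> j \<or> j = s \<and> x \<le> h"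
  using assms(2,4,5)
proof (induction h arbitrary: x rule: dec_induct)
  case base
  then show ?case using assms(1,6) by (auto simp: lowering_refl)
next
  case (step h)
  have "reach (lowering s (Suc h) @ os) x j \<longleftrightarrow> reach (lowering s h @ os) x j
      \<or> x = Suc h \<and> reach (lowering s h @ os) h j"
    using step.hyps by (simp add: lowering_Suc)
  then show ?case
    using step.IH[of x] step.IH[of h] step.prems step.hyps assms(3) by auto
qed

lemma reach_stages_from:
  assumes "s \<le> n" "1 \<le> s" "x \<in> {1..n}" "j \<in> {1..n}"
  shows "reach (stages_from n s) x j \<longleftrightarrow> x \<le> j \<or> s \<le> j"
  using assms
proof (induction s arbitrary: x j rule: inc_induct)
  case base
  then show ?case by (auto simp: stages_from_n reach_raising_stages)
next
  case (step s)
  have "reach (lowering s n @ stages_from n (Suc s)) x j \<longleftrightarrow> x \<le> j \<or> Suc s \<le> j \<or> j = s \<and> x \<le> n"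
    by (rule reach_lowering[where n = n]) (use step in auto)
  moreover have "stages_from n s = lowering s n @ stages_from n (Suc s)"
    using step.hyps by (intro stages_from_less) simp
  ultimately have "reach (stages_from n s) x j \<longleftrightarrow> x \<le> j \<or> Suc s \<le> j \<or> j = s \<and> x \<le> n"
    by simp
  moreover have "x \<le> n" using step.prems by simp
  moreover have "s \<le> j \<longleftrightarrow> Suc s \<le> j \<or> j = s" by auto
  ultimately show ?case by blast
qed

lemma reach_stages:
  assumes "x \<in> {1..n}" "j \<in> {1..n}"
  shows "reach (stages_from n 1) x j"
  using reach_stages_from[of 1 n x j] assms by auto

text \<open>Where a lazy letter stands when stage s has arrived at h: larger targets have been
  attained, smaller ones have not been started. In \<open>lowered\<close> it is the smaller targets
  whose lowering is finished.\<close>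

definition raised :: "nat \<Rightarrow> nat \<Rightarrow> nat \<times> nat \<Rightarrow> nat \<times> nat"
  where "raised s h y = (if snd y = s then max (fst y) h else if snd y > s then snd y else fst y, snd y)"

definition lowered :: "nat \<Rightarrow> nat \<Rightarrow> nat \<times> nat \<Rightarrow> nat \<times> nat"
  where "lowered s h y = (if snd y = s then min (fst y) h else if snd y < s then min (fst y) (snd y) else fst y, snd y)"

text \<open>At the step from h to h + 1, the forced letters are those with target s + 1 that started
  at or below h; smaller targets still have their own stage. So the stage records cumulative counts
  of the rows in column s + 1.\<close>

lemma lazy_counts_raising:
  assumes "h \<le> Suc s" "1 \<le> h" "\<forall>y\<in>set z. 1 \<le> fst y \<and> fst y \<le> snd y"
  shows "lazy_counts (raising h (Suc s) @ raising_stages s) (map (raised (Suc s) h) z) =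
    map (\<lambda>h. length (filter (\<lambda>y. snd y = Suc s \<and> fst y \<le> h) z)) [h..<Suc s]
    @ lazy_counts (raising_stages s) (map (raised (Suc s) (Suc s)) z)"
  using assms(1,2)
proof (induction h rule: inc_induct)
  case base
  then show ?case by (simp add: raising_refl)
next
  case (step h)
  let ?os = "raising (Suc h) (Suc s) @ raising_stages s"
  have f: "forced h ?os (raised (Suc s) h y) \<longleftrightarrow> snd y = Suc s \<and> fst y \<le> h" if "y \<in> set z" for y
  proof -
    have R: "reach ?os h (snd y) \<longleftrightarrow> h = snd y \<or> h < snd y \<and> (snd y \<le> s \<or> snd y = Suc s \<and> Suc h \<le> h)"
      by (rule reach_raising) (use step reach_raising_stages in auto)
    have "snd (raised (Suc s) h y) = snd y" by (simp add: raised_def)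
    then show ?thesis
      unfolding forced_iff using R step.hyps assms(3)[rule_format, OF that]
      by (auto simp: raised_def max_def split: if_splits)
  qed
  have a: "advance h (Suc h) ?os (raised (Suc s) h y) = raised (Suc s) (Suc h) y" if "y \<in> set z" for y
    using f[OF that] by (auto simp: advance_def raised_def)
  have "lazy_counts (raising h (Suc s) @ raising_stages s) (map (raised (Suc s) h) z)
    = length (filter (forced h ?os) (map (raised (Suc s) h) z))
      # lazy_counts ?os (map (advance h (Suc h) ?os) (map (raised (Suc s) h) z))"
    using step.hyps by (simp add: raising_Cons)
  also have "length (filter (forced h ?os) (map (raised (Suc s) h) z))
      = length (filter (\<lambda>y. snd y = Suc s \<and> fst y \<le> h) z)"
    unfolding filter_map length_map comp_def using f by (metis (mono_tags, lifting) filter_cong)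
  also have "map (advance h (Suc h) ?os) (map (raised (Suc s) h) z) = map (raised (Suc s) (Suc h)) z"
    using a by simp
  finally show ?case
    using step by (simp add: upt_conv_Cons del: upt_Suc)
qed

lemma lazy_counts_lowering:
  assumes "s \<le> h" "h \<le> n" "1 \<le> s" "s < n" "\<forall>y\<in>set z. fst y \<in> {1..n} \<and> snd y \<in> {1..n}"
  shows "lazy_counts (lowering s h @ stages_from n (Suc s)) (map (lowered s h) z) =
    map (\<lambda>h. length (filter (\<lambda>y. snd y = s \<and> h < fst y) z)) (rev [s..<h])
    @ lazy_counts (stages_from n (Suc s)) (map (lowered s s) z)"
  using assms(1,2)
proof (induction h rule: dec_induct)
  case base
  then show ?case by (simp add: lowering_refl)
next
  case (step h)
  let ?os = "lowering s h @ stages_from n (Suc s)"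
  have f: "forced (Suc h) ?os (lowered s (Suc h) y) \<longleftrightarrow> snd y = s \<and> h < fst y" if "y \<in> set z" for y
  proof -
    have R: "reach ?os (Suc h) (snd y) \<longleftrightarrow> Suc h \<le> snd y \<or> Suc s \<le> snd y \<or> snd y = s \<and> Suc h \<le> h"
      by (rule reach_lowering[where n = n])
        (use step assms(3,4) assms(5)[rule_format, OF that] reach_stages_from[of "Suc s" n] in auto)
    have "snd (lowered s (Suc h) y) = snd y" by (simp add: lowered_def)
    then show ?thesis
      unfolding forced_iff using R step.hyps assms(3) assms(5)[rule_format, OF that]
      by (auto simp: lowered_def min_def split: if_splits)
  qed
  have a: "advance (Suc h) h ?os (lowered s (Suc h) y) = lowered s h y" if "y \<in> set z" for y
    using f[OF that] by (auto simp: advance_def lowered_def)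
  have "lazy_counts (lowering s (Suc h) @ stages_from n (Suc s)) (map (lowered s (Suc h)) z)
    = length (filter (forced (Suc h) ?os) (map (lowered s (Suc h)) z))
      # lazy_counts ?os (map (advance (Suc h) h ?os) (map (lowered s (Suc h)) z))"
    using step.hyps by (simp add: lowering_Suc)
  also have "length (filter (forced (Suc h) ?os) (map (lowered s (Suc h)) z))
      = length (filter (\<lambda>y. snd y = s \<and> h < fst y) z)"
    unfolding filter_map length_map comp_def using f by (metis (mono_tags, lifting) filter_cong)
  also have "map (advance (Suc h) h ?os) (map (lowered s (Suc h)) z) = map (lowered s h) z"
    using a by simp
  finally show ?case
    using step by simp
qed

lemma raising_stages_injective:
  assumes "lazy_counts (raising_stages s) (map (raised s 1) z) = lazy_counts (raising_stages s) (map (raised s 1) z')"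
    and "\<forall>y\<in>set z \<union> set z'. 1 \<le> fst y \<and> fst y \<le> snd y" "1 \<le> h" "h < j" "j \<le> s"
  shows "length (filter (\<lambda>y. snd y = j \<and> fst y \<le> h) z) = length (filter (\<lambda>y. snd y = j \<and> fst y \<le> h) z')"
  using assms(1,5)
proof (induction s)
  case (Suc s)
  have next_stage: "map (raised (Suc s) (Suc s)) y = map (raised s 1) y"
    if "\<forall>y\<in>set y. 1 \<le> fst y \<and> fst y \<le> snd y" for y
    using that by (auto simp: raised_def max_def)
  have eq: "map (\<lambda>h. length (filter (\<lambda>y. snd y = Suc s \<and> fst y \<le> h) z)) [1..<Suc s]
      @ lazy_counts (raising_stages s) (map (raised s 1) z)
    = map (\<lambda>h. length (filter (\<lambda>y. snd y = Suc s \<and> fst y \<le> h) z')) [1..<Suc s]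
      @ lazy_counts (raising_stages s) (map (raised s 1) z')"
    using Suc.prems(1) lazy_counts_raising[of 1 s z] lazy_counts_raising[of 1 s z'] assms(2)
      next_stage[of z] next_stage[of z'] by simp
  show ?case
  proof (cases "j = Suc s")
    case True
    then have "h \<in> set [1..<Suc s]" using assms(3,4) by auto
    then show ?thesis
      using eq True by (simp only: append_eq_append_conv length_map simp_thms map_eq_conv)
  next
    case False
    then show ?thesis
      using eq Suc by simp
  qed
qed (use assms in simp)

lemma stages_injective:
  assumes "lazy_counts (stages_from n s) (map (lowered s n) z) = lazy_counts (stages_from n s) (map (lowered s n) z')"
    and "1 \<le> s" "s \<le> n"
    and "\<forall>y\<in>set z \<union> set z'. fst y \<in> {1..n} \<and> snd y \<in> {1..n}"
  shows "(\<forall>h j. s \<le> j \<and> j \<le> h \<and> h < n \<longrightarrow> length (filter (\<lambda>y. snd y = j \<and> h < fst y) z)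
      = length (filter (\<lambda>y. snd y = j \<and> h < fst y) z'))
    \<and> (\<forall>h j. 1 \<le> h \<and> h < j \<and> j \<le> n \<longrightarrow> length (filter (\<lambda>y. snd y = j \<and> fst y \<le> h) z)
      = length (filter (\<lambda>y. snd y = j \<and> fst y \<le> h) z'))"
  using assms(3,1,2)
proof (induction s rule: inc_induct)
  case base
  \<comment> \<open>After all lowering stages a letter stands at the minimum of its start and its
    target. For h < j this does not affect the counts recorded by raising.\<close>
  let ?m = "map (\<lambda>y :: nat \<times> nat. (min (fst y) (snd y), snd y))"
  have l: "map (lowered n n) y = map (raised n 1) (?m y)"
    if "\<forall>y\<in>set y. fst y \<in> {1..n} \<and> snd y \<in> {1..n}" for y
    using that by (force simp: raised_def lowered_def min_def max_def)
  have f: "length (filter (\<lambda>y. snd y = j \<and> fst y \<le> h) (?m y)) = length (filter (\<lambda>y. snd y = j \<and> fst y \<le> h) y)"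
    if "h < j" for h j y
    using that by (induction y) (auto simp: min_def)
  have "length (filter (\<lambda>y. snd y = j \<and> fst y \<le> h) (?m z)) = length (filter (\<lambda>y. snd y = j \<and> fst y \<le> h) (?m z'))"
    if "1 \<le> h" "h < j" "j \<le> n" for h j
  proof (rule raising_stages_injective[where s = n])
    show "lazy_counts (raising_stages n) (map (raised n 1) (?m z))
        = lazy_counts (raising_stages n) (map (raised n 1) (?m z'))"
    proof -
      have "map (lowered n n) z = map (raised n 1) (?m z)" "map (lowered n n) z' = map (raised n 1) (?m z')"
        using assms(4) by (intro l; blast)+
      then show ?thesis
        using base(1) by (simp only: stages_from_n)
    qed
    show "\<forall>y\<in>set (?m z) \<union> set (?m z'). 1 \<le> fst y \<and> fst y \<le> snd y"
      using assms(4) by force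
  qed (use that in simp_all)
  then have "length (filter (\<lambda>y. snd y = j \<and> fst y \<le> h) z) = length (filter (\<lambda>y. snd y = j \<and> fst y \<le> h) z')"
    if "1 \<le> h" "h < j" "j \<le> n" for h j
    using that by (simp only: f)
  then show ?case by auto
next
  case (step s)
  \<comment> \<open>The positions at the end of stage s are those at the beginning of stage s +
    1.\<close>
  have next_stage: "map (lowered s s) y = map (lowered (Suc s) n) y"
    if "\<forall>y\<in>set y. fst y \<in> {1..n} \<and> snd y \<in> {1..n}" for y
    using that by (auto simp: lowered_def min_def)
  have eq: "map (\<lambda>h. length (filter (\<lambda>y. snd y = s \<and> h < fst y) z)) (rev [s..<n])
      @ lazy_counts (stages_from n (Suc s)) (map (lowered (Suc s) n) z)
    = map (\<lambda>h. length (filter (\<lambda>y. snd y = s \<and> h < fst y) z')) (rev [s..<n])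
      @ lazy_counts (stages_from n (Suc s)) (map (lowered (Suc s) n) z')"
    using step.prems step.hyps lazy_counts_lowering[of s n n z] lazy_counts_lowering[of s n n z'] assms(4)
      next_stage[of z] next_stage[of z'] by (simp add: stages_from_less)
  then have IH: "lazy_counts (stages_from n (Suc s)) (map (lowered (Suc s) n) z)
      = lazy_counts (stages_from n (Suc s)) (map (lowered (Suc s) n) z')"
    and now: "\<forall>h\<in>set (rev [s..<n]). length (filter (\<lambda>y. snd y = s \<and> h < fst y) z)
      = length (filter (\<lambda>y. snd y = s \<and> h < fst y) z')"
    by (simp_all only: append_eq_append_conv length_map simp_thms map_eq_conv) blast
  show ?case
  proof (intro conjI allI impI)
    fix h j assume hj: "s \<le> j \<and> j \<le> h \<and> h < n"
    show "length (filter (\<lambda>y. snd y = j \<and> h < fst y) z) = length (filter (\<lambda>y. snd y = j \<and> h < fst y) z')"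
    proof (cases "j = s")
      case True
      then show ?thesis using now hj by simp
    next
      case False
      then show ?thesis using step.IH[OF IH] hj by simp
    qed
  next
    fix h j assume "1 \<le> h \<and> h < j \<and> j \<le> n"
    then show "length (filter (\<lambda>y. snd y = j \<and> fst y \<le> h) z) = length (filter (\<lambda>y. snd y = j \<and> fst y \<le> h) z')"
      using step.IH[OF IH] by simp
  qed
qed

text \<open>In column j, the raising stages give the number of row indices up to h for h < j, and
  the lowering stages the number above h for h at least j. The content of the column word gives the
  total and so converts one kind into the other; successive differences are the multiplicities, the
  diagonal one included.\<close>

lemma lazy_counts_injective:
  assumes eq: "lazy_counts (stages_from n 1) z = lazy_counts (stages_from n 1) z'"
    and cols: "mset (map snd z) = mset (map snd z')"
    and sub: "set z \<subseteq> {1..n} \<times> {1..n}" "set z' \<subseteq> {1..n} \<times> {1..n}"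
  shows "mset z = mset z'"
proof (cases "n = 0")
  case True
  then show ?thesis using sub by simp
next
  case False
  have id: "map (lowered 1 n) y = y" if "set y \<subseteq> {1..n} \<times> {1..n}" for y
    using that by (intro map_idI) (force simp: lowered_def min_def)
  have "\<forall>y\<in>set z \<union> set z'. fst y \<in> {1..n} \<and> snd y \<in> {1..n}"
    using sub by force
  note inj = stages_injective[of n 1 z z', OF _ _ _ this]
  define N where "N y j h = length (filter (\<lambda>y. snd y = j \<and> fst y \<le> h) y)" for y :: "(nat \<times> nat) list" and j h
  define M where "M y j h = length (filter (\<lambda>y. snd y = j \<and> h < fst y) y)" for y :: "(nat \<times> nat) list" and j h
  define T where "T y j = length (filter (\<lambda>y. snd y = j) y)" for y :: "(nat \<times> nat) list" and j
  have T: "T z j = T z' j" for j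
  proof -
    have "T y j = count (mset (map snd y)) j" for y
      unfolding T_def by (induction y) auto
    then show ?thesis using cols by simp
  qed
  have NM: "N y j h + M y j h = T y j" for y j h
    unfolding N_def M_def T_def by (induction y) auto
  have M0: "M y j h = 0" if "set y \<subseteq> {1..n} \<times> {1..n}" "n \<le> h" for y j h
    using that unfolding M_def by (force simp: filter_empty_conv)
  have N0: "N y j 0 = 0" if "set y \<subseteq> {1..n} \<times> {1..n}" for y j
    using that unfolding N_def by (force simp: filter_empty_conv)
  have count: "count (mset y) (Suc i, j) + N y j i = N y j (Suc i)" for y i j
    unfolding N_def by (induction y) auto
  have N: "N z j h = N z' j h" if j: "j \<in> {1..n}" for j h
  proof -
    consider "h = 0" | "1 \<le> h" "h < j" | "j \<le> h" "h < n" | "n \<le> h" by linarith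
    then show ?thesis
    proof cases
      case 1
      then show ?thesis using N0 sub by simp
    next
      case 2
      then show ?thesis using inj eq id sub False j unfolding N_def by auto
    next
      case 3
      then have "M z j h = M z' j h" using inj eq id sub False j unfolding M_def by auto
      then show ?thesis using NM[of z j h] NM[of z' j h] T[of j] by simp
    next
      case 4
      then show ?thesis using NM[of z j h] NM[of z' j h] T[of j] M0[OF sub(1)] M0[OF sub(2)] by simp
    qed
  qed
  show ?thesis
  proof (rule multiset_eqI)
    fix x :: "nat \<times> nat"
    obtain i j where x: "x = (i, j)" by fastforce
    show "count (mset z) x = count (mset z') x"
    proof (cases "x \<in> {1..n} \<times> {1..n}")
      case True
      then obtain i' where "i = Suc i'" using x by (cases i) auto
      then show ?thesis
        using count[of z i' j] count[of z' i' j] N[of j i'] N[of j "Suc i'"] True x by simp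
    next
      case f: False
      then have "x \<notin> set z" "x \<notin> set z'" using sub by blast+
      then show ?thesis by (simp add: count_mset_0_iff[THEN iffD2])
    qed
  qed
qed

lemma stages_adjacent:
  "(s, t) \<in> set (stages_from n 1) \<Longrightarrow> (t = Suc s \<or> s = Suc t) \<and> s \<in> {1..n} \<and> t \<in> {1..n}"
proof -
  have "\<forall>(s, t)\<in>set (raising_stages m). t = Suc s \<and> s \<in> {1..m} \<and> t \<in> {1..m}" for m
    by (induction m) (auto simp: raising_def)
  from this[of n] show "(s, t) \<in> set (stages_from n 1) \<Longrightarrow> (t = Suc s \<or> s = Suc t) \<and> s \<in> {1..n} \<and> t \<in> {1..n}"
    by (auto simp: stages_from_def lowering_def)
qed

text \<open>In a nonzero straightened representative, choose a monomial with least lazy counts. The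
  product with these counts and with the content of its column word is nonzero on this monomial and
  vanishes on all the others.\<close>

lemma shift_products_separate:
  fixes q :: "'k::field" and u v :: "nat \<Rightarrow> nat \<Rightarrow> 'k"
  assumes "p \<in> carrier (qfree n)" "q \<noteq> 0" "\<And>s t. u s t \<noteq> 0 \<and> v s t \<noteq> 0"
    and "\<And>s t k. (s, t) \<in> set (stages_from n 1) \<Longrightarrow> centralizing n q (shift s t (u s t) (v s t) k)"
    and "\<And>\<mu> ks. evaluate (shift_product n u v \<mu> (stages_from n 1) ks) p = 0"
  shows "p \<in> qideal n q"
proof -
  let ?os = "stages_from n 1"
  have cent: "centralizing n q (shift_product n u v \<mu> os ks)" if "set os \<subseteq> set ?os" for \<mu> os ks
    using that
  proof (induction os arbitrary: ks)
    case Nil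
    then show ?case
      by (cases ks) (simp_all add: centralizing_weight_proj centralizing_zero)
  next
    case (Cons e os)
    obtain s t where e: "e = (s, t)" by fastforce
    show ?case
    proof (cases ks)
      case (Cons k ks')
      then show ?thesis
        using Cons.IH[of ks'] assms(4)[of s t k] Cons.prems e by (auto intro: centralizing_convolve)
    qed (simp add: e centralizing_zero)
  qed
  obtain p' where p': "p' \<in> carrier (qfree n)" "\<forall>w\<in>Poly_Mapping.keys p'. sorted (letters w)" "p - p' \<in> qideal n q"
    using straightening[OF assms(1), of q] unfolding straightens_def by blast
  have ev: "evaluate (shift_product n u v \<mu> ?os ks) p' = 0" for \<mu> ks
    using evaluate_qideal[OF cent[OF subset_refl] assms(2) p'(3), of \<mu> ks] assms(5)[of \<mu> ks]
    by (simp add: evaluate_diff)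
  have range: "set (letters w) \<subseteq> {1..n} \<times> {1..n}" if "w \<in> Poly_Mapping.keys p'" for w
    using p'(1) that by (auto simp: free_alg_def)
  have "p' = 0"
  proof (rule ccontr)
    assume "p' \<noteq> 0"
    then have ne: "Poly_Mapping.keys p' \<noteq> {}" by simp
    define f where "f w = lazy_counts ?os (letters w)" for w
    \<comment> \<open>The minimum may be attained more than once, but only with different column
      contents, which the weight projection tells apart.\<close>
    obtain w where w: "w \<in> Poly_Mapping.keys p'" "\<And>w'. w' \<in> Poly_Mapping.keys p' \<Longrightarrow> f w \<le> f w'"
      using ex_min_if_finite[of "f ` Poly_Mapping.keys p'"] ne by (auto simp: not_less)
    define \<xi> where "\<xi> = shift_product n u v (mset (map snd (letters w))) ?os (f w)"
    have adj: "\<forall>(s, t)\<in>set ?os. s \<noteq> t \<and> t \<in> {1..n} \<and> u s t \<noteq> 0 \<and> v s t \<noteq> 0"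
      using stages_adjacent assms(3) by fastforce
    have "\<xi> (map fst (letters w)) (map snd (letters w)) \<noteq> 0"
      unfolding \<xi>_def f_def
    proof (rule shift_product_lazy_nonzero[OF adj])
      show "map fst (letters w) \<in> words n (length (letters w))"
        using range[OF w(1)] by (force simp: words_def)
      show "\<forall>y\<in>set (letters w). reach ?os (fst y) (snd y)"
        using range[OF w(1)] reach_stages by force
    qed
    moreover have "\<xi> (map fst (letters w')) (map snd (letters w')) = 0"
      if w': "w' \<in> Poly_Mapping.keys p' - {w}" for w'
    proof (rule ccontr)
      assume "\<xi> (map fst (letters w')) (map snd (letters w')) \<noteq> 0"
      then have "f w' \<le> f w" "mset (map snd (letters w')) = mset (map snd (letters w))"
        using shift_product_nonzeroD[of n u v _ ?os "f w" "letters w'"] adj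
        unfolding \<xi>_def f_def by auto
      moreover have "f w \<le> f w'" using w(2) w' by blast
      ultimately have "mset (letters w') = mset (letters w)"
        using lazy_counts_injective[of n "letters w'" "letters w"] range w' w(1)
        unfolding f_def by (auto simp del: mset_map)
      then have "letters w' = letters w"
        using p'(2) w' w(1) by (metis DiffD1 properties_for_sort)
      then show False using w' by (metis DiffD2 insertI1 word.expand)
    qed
    then have "evaluate \<xi> p' = Poly_Mapping.lookup p' w * \<xi> (map fst (letters w)) (map snd (letters w))"
      unfolding evaluate_def by (subst sum.remove[OF _ w(1)]) auto
    ultimately show False
      using ev[of _ "f w"] w(1) unfolding \<xi>_def by (simp add: in_keys_iff)
  qed
  then show ?thesis using p'(3) by simp
qed

section \<open>Coefficients of exterior powers as products of minors\<close>

section \<open>Coefficients as cosets\<close>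

text \<open>A determinant expanded with the rows in increasing order. The signs carry no powers of q
  because the exterior relations are the classical ones.\<close>

definition minor :: "nat \<Rightarrow> nat set \<Rightarrow> nat set \<Rightarrow> (nat \<times> nat) word \<Rightarrow>\<^sub>0 'k::field"
  where "minor n B C = (\<Sum>l\<in>words n (card B).
    Poly_Mapping.single (Word (zip (sorted_list_of_set B) l)) (wedge l C))"

fun minors :: "nat \<Rightarrow> nat set list \<Rightarrow> nat set list \<Rightarrow> (nat \<times> nat) word \<Rightarrow>\<^sub>0 'k::field" where
  "minors n (B # Bs) (C # Cs) = minor n B C * minors n Bs Cs"
| "minors n _ _ = 1"

lemma single_zip_carrier:
  assumes "set i \<subseteq> {1..n}" "set j \<subseteq> {1..n}"
  shows "Poly_Mapping.single (Word (zip i j)) a \<in> carrier (qfree n)"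
proof -
  have "set (zip i j) \<subseteq> {1..n} \<times> {1..n}"
    using assms by (auto dest: set_zip_leftD set_zip_rightD)
  then show ?thesis
    by (simp add: free_alg_def)
qed

lemma minor_carrier: "B \<subseteq> {1..n} \<Longrightarrow> minor n B C \<in> carrier (qfree n)"
  unfolding minor_def
  by (intro qfree_sum single_zip_carrier)
    (use finite_subset_atLeastAtMost[of B n] in \<open>simp_all add: words_def\<close>)

lemma one_carrier: "1 \<in> carrier (qfree n)"
  by (simp add: free_alg_def zero_word_def)

lemma minors_carrier: "\<forall>B\<in>set I. B \<subseteq> {1..n} \<Longrightarrow> minors n I J \<in> carrier (qfree n)"
  by (induction n I J rule: minors.induct)
    (simp_all add: qfree_mult minor_carrier one_carrier)

text \<open>The link between the two descriptions: acting by \<open>\<xi>\<close> is evaluating it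
  on the coefficients of the comodule.\<close>

lemma evaluate_minors:
  assumes "I \<in> blocks n \<alpha>" "J \<in> blocks n \<alpha>"
  shows "evaluate \<xi> (minors n I J) = ext n \<xi> I J"
  using assms
proof (induction \<alpha> arbitrary: I J \<xi>)
  case Nil
  then show ?case by (simp add: ext_def single_one[symmetric] zero_word_def del: single_one)
next
  case (Cons s \<alpha>)
  obtain B Bs C Cs where I: "I = B # Bs" "B \<subseteq> {1..n}" "card B = s" "Bs \<in> blocks n \<alpha>"
    and J: "J = C # Cs" "C \<subseteq> {1..n}" "card C = s" "Cs \<in> blocks n \<alpha>"
    using Cons.prems unfolding blocks_Cons by blast
  have len: "length (sorted_list_of_set B) = s"
    using I(3) by simp
  have "evaluate \<xi> (minors n I J) = (\<Sum>l\<in>words n s. wedge l C *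
      evaluate (\<lambda>i j. \<xi> (sorted_list_of_set B @ i) (l @ j)) (minors n Bs Cs))"
    unfolding I(1) J(1) minors.simps minor_def sum_distrib_right evaluate_sum I(3)
    by (rule sum.cong, rule refl, frule length_words) (simp add: evaluate_single_mult I(3))
  also have "\<dots> = (\<Sum>l\<in>words n s. \<Sum>w\<in>words n (length (flat Bs)).
      \<xi> (flat I) (l @ w) * wedges (l @ w) J)"
    unfolding Cons.IH[OF I(4) J(4)] ext_def using I(1) J(1,3)
    by (intro sum.cong) (simp_all add: sum_distrib_left length_words mult_ac)
  also have "\<dots> = ext n \<xi> I J"
    using I(1,3) by (simp add: ext_def sum_words_add)
  finally show ?case .
qed

lemma qcoset_mult:
  "p \<in> carrier (qfree n) \<Longrightarrow> p' \<in> carrier (qfree n)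
    \<Longrightarrow> qcoset n q p \<otimes>\<^bsub>A n q\<^esub> qcoset n q p' = qcoset n q (p * p')"
  using ring_hom_mult[OF qcoset_ring_hom, of p n p' q] by (simp add: free_alg_simps)

lemma qcoset_add:
  "p \<in> carrier (qfree n) \<Longrightarrow> p' \<in> carrier (qfree n)
    \<Longrightarrow> qcoset n q p \<oplus>\<^bsub>A n q\<^esub> qcoset n q p' = qcoset n q (p + p')"
  using ring_hom_add[OF qcoset_ring_hom, of p n p' q] by (simp add: free_alg_simps)

lemma qcoset_one: "\<one>\<^bsub>A n q\<^esub> = qcoset n q 1"
  using ring_hom_one[OF qcoset_ring_hom, of n q] by (simp add: free_alg_simps)

lemma qcoset_zero: "\<zero>\<^bsub>A n q\<^esub> = qcoset n q 0"
  using ring_hom_zero[OF qcoset_ring_hom ring_free_alg ring_A, of n q] by (simp add: free_alg_simps)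

lemma qcoset_smult:
  "p \<in> carrier (qfree n) \<Longrightarrow> a \<odot>\<^bsub>A n q\<^esub> qcoset n q p = qcoset n q (const a * p)"
  unfolding A_simps(6) by (rule qcoset_mult[OF const_in_free_alg])

lemma finsum_qcoset:
  assumes "finite S" "\<And>x. x \<in> S \<Longrightarrow> g x \<in> carrier (qfree n)"
  shows "(\<Oplus>\<^bsub>A n q\<^esub>x\<in>S. qcoset n q (g x)) = qcoset n q (\<Sum>x\<in>S. g x)"
proof -
  interpret ring "A n q" by (rule ring_A)
  show ?thesis
    using assms
  proof (induction S rule: finite_induct)
    case empty
    show ?case by (simp add: qcoset_zero)
  next
    case (insert x S)
    then show ?case
      by (subst finsum_insert) (auto simp: qcoset_in_A qcoset_add qfree_sum)
  qed
qed

lemma A_deg_simps: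
  "\<zero>\<^bsub>A_deg n r q\<^esub> = \<zero>\<^bsub>A n q\<^esub>" "x \<oplus>\<^bsub>A_deg n r q\<^esub> y = x \<oplus>\<^bsub>A n q\<^esub> y"
  "a \<odot>\<^bsub>A_deg n r q\<^esub> x = a \<odot>\<^bsub>A n q\<^esub> x"
  by (simp_all add: A_deg_def)

lemma abelian_monoid_A_deg: "abelian_monoid (A_deg n r q)"
proof -
  interpret ring "A n q" by (rule ring_A)
  show ?thesis
    by (rule abelian_monoidI; unfold A_deg_simps;
      (intro A_deg_add A_deg_zero a_assoc a_comm l_zero)?; (assumption | rule A_deg_subset)+)
qed

text \<open>The value of a finite sum formally depends on the carrier; this moves sums from A(n,r)
  to A(n), where the ring lemmas apply.\<close>

lemma finsum_A_deg:
  assumes "finite S" "\<And>x. x \<in> S \<Longrightarrow> g x \<in> carrier (A_deg n r q)"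
  shows "(\<Oplus>\<^bsub>A_deg n r q\<^esub>x\<in>S. g x) = (\<Oplus>\<^bsub>A n q\<^esub>x\<in>S. g x)"
proof -
  interpret R: ring "A n q" by (rule ring_A)
  interpret D: abelian_monoid "A_deg n r q" by (rule abelian_monoid_A_deg)
  show ?thesis
    using assms
  proof (induction S rule: finite_induct)
    case (insert x S)
    have "g y \<in> carrier (A n q)" if "y \<in> insert x S" for y
      using insert.prems[OF that] by (rule A_deg_subset)
    then have "(\<Oplus>\<^bsub>A n q\<^esub>x\<in>insert x S. g x) = g x \<oplus>\<^bsub>A n q\<^esub> (\<Oplus>\<^bsub>A n q\<^esub>x\<in>S. g x)"
      using insert.hyps by (intro R.finsum_insert) auto
    moreover have "(\<Oplus>\<^bsub>A_deg n r q\<^esub>x\<in>insert x S. g x) = g x \<oplus>\<^bsub>A n q\<^esub> (\<Oplus>\<^bsub>A_deg n r q\<^esub>x\<in>S. g x)"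
      unfolding A_deg_simps(2)[where n = n and q = q and r = r, symmetric] using insert by (intro D.finsum_insert) auto
    ultimately show ?case
      using insert by simp
  qed (simp add: A_deg_simps)
qed

lemma tensor_natural_coeff:
  assumes "length i = length j" "set i \<subseteq> {1..n}" "set j \<subseteq> {1..n}"
  shows "coeff (tensor_comodule (A n q) (replicate (length i) (natural_comodule n q))) i j
    = qcoset n q (Poly_Mapping.single (Word (zip i j)) 1)"
  using assms
proof (induction i j rule: list_induct2)
  case Nil
  then show ?case
    by (simp add: tensor_comodule_def qcoset_one zero_word_def[symmetric])
next
  case (Cons x xs y ys)
  have "c n q x y \<otimes>\<^bsub>A n q\<^esub> qcoset n q (Poly_Mapping.single (Word (zip xs ys)) 1)
      = qcoset n q (gen (x, y) * Poly_Mapping.single (Word (zip xs ys)) 1)"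
    unfolding c_def using Cons.prems
    by (intro qcoset_mult single_zip_carrier gen_in_free_alg) simp_all
  then show ?case
    using Cons by (simp add: tensor_comodule_def natural_comodule_def gen_def mult_single plus_word_def)
qed

lemma basis_ext_power: "basis (ext_power n q s) = {B. B \<subseteq> {1..n} \<and> card B = s}"
  by (simp add: ext_power_def Let_def)

lemma coeff_ext_power:
  fixes q :: "'k::field"
  assumes "B \<subseteq> {1..n}" "card B = s"
  shows "coeff (ext_power n q s) B C = qcoset n q (minor n B C)"
proof -
  let ?T = "tensor_comodule (A n q) (replicate s (natural_comodule n q))"
  have T: "basis ?T = words n s"
    by (auto simp: basis_tensor_replicate natural_comodule_def words_def subset_eq)
  have sB: "set (sorted_list_of_set B) \<subseteq> {1..n}" "length (sorted_list_of_set B) = s"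
    using sorted_in_words[OF assms(1)] assms(2) by (simp_all add: words_def)
  have "coeff (ext_power n q s) B C = (\<Oplus>\<^bsub>A n q\<^esub>l\<in>words n s.
      wedge l C \<odot>\<^bsub>A n q\<^esub> coeff ?T (sorted_list_of_set B) l)"
    by (simp add: ext_power_def T)
  also have "\<dots> = (\<Oplus>\<^bsub>A n q\<^esub>l\<in>words n s.
      qcoset n q (Poly_Mapping.single (Word (zip (sorted_list_of_set B) l)) (wedge l C)))"
  proof -
    have "wedge l C \<odot>\<^bsub>A n q\<^esub> coeff ?T (sorted_list_of_set B) l
        = qcoset n q (Poly_Mapping.single (Word (zip (sorted_list_of_set B) l)) (wedge l C))"
      if l: "l \<in> words n s" for l
    proof -
      have "set l \<subseteq> {1..n}" "length (sorted_list_of_set B) = length l"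
        using l sB(2) by (auto simp: words_def)
      then show ?thesis
        using tensor_natural_coeff[of "sorted_list_of_set B" l n q] sB
        by (simp add: qcoset_smult single_zip_carrier const_def mult_single)
    qed
    moreover have "qcoset n q (Poly_Mapping.single (Word (zip (sorted_list_of_set B) l)) (wedge l C))
        \<in> carrier (A n q)" if "l \<in> words n s" for l
      using that sB(1) by (intro qcoset_in_A single_zip_carrier) (simp_all add: words_def)
    ultimately show ?thesis
      using ring_A[of n q] by (intro abelian_monoid.finsum_cong') (auto intro: ring.is_abelian_group abelian_group.axioms(1))
  qed
  also have "\<dots> = qcoset n q (minor n B C)"
    unfolding minor_def assms(2) using sB(1)
    by (intro finsum_qcoset single_zip_carrier finite_words) (simp_all add: words_def)
  finally show ?thesis .
qed

lemma basis_ext_powers: "basis (ext_powers n q \<alpha>) = blocks n \<alpha>"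
proof (induction \<alpha>)
  case Nil
  then show ?case by (auto simp: ext_powers_def tensor_comodule_def)
next
  case (Cons s \<alpha>)
  then have "listset (map basis (map (ext_power n q) \<alpha>)) = blocks n \<alpha>"
    by (simp add: ext_powers_def tensor_comodule_def)
  then show ?case
    by (auto simp: ext_powers_def tensor_comodule_def set_Cons_def basis_ext_power blocks_Cons)
qed

lemma coeff_ext_powers:
  assumes "I \<in> blocks n \<alpha>" "J \<in> blocks n \<alpha>"
  shows "coeff (ext_powers n q \<alpha>) I J = qcoset n q (minors n I J)"
  using assms
proof (induction \<alpha> arbitrary: I J)
  case Nil
  then show ?case by (simp add: ext_powers_def tensor_comodule_def qcoset_one)
next
  case (Cons s \<alpha>)
  obtain B Bs C Cs where I: "I = B # Bs" "B \<subseteq> {1..n}" "card B = s" "Bs \<in> blocks n \<alpha>"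
    and J: "J = C # Cs" "Cs \<in> blocks n \<alpha>"
    using Cons.prems unfolding blocks_Cons by blast
  have "coeff (ext_powers n q (s # \<alpha>)) I J
      = coeff (ext_power n q s) B C \<otimes>\<^bsub>A n q\<^esub> coeff (ext_powers n q \<alpha>) Bs Cs"
    by (simp add: I(1) J(1) ext_powers_def tensor_comodule_def)
  also have "\<dots> = qcoset n q (minors n I J)"
    unfolding coeff_ext_power[OF I(2,3)] Cons.IH[OF I(4) J(2)] I(1) J(1) minors.simps
    by (intro qcoset_mult minor_carrier minors_carrier I(2) ballI blocks_subset[OF I(4)])
  finally show ?case .
qed

section \<open>Comodule endomorphisms as matrices, and conjugation of endomorphism algebras\<close>

section \<open>Endomorphisms as matrices\<close>

lemma unit_vec_in_vectors: "b \<in> basis M \<Longrightarrow> unit_vec b \<in> vectors M"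
  by (simp add: vectors_def unit_vec_def)

lemma linear_maps_sum:
  assumes "f \<in> linear_maps M N" "finite S" "S \<subseteq> basis M"
  shows "f (\<lambda>b. \<Sum>e\<in>S. x e * unit_vec e b) = (\<lambda>d. \<Sum>e\<in>S. x e * f (unit_vec e) d)"
proof -
  have add: "\<And>x y. x \<in> vectors M \<Longrightarrow> y \<in> vectors M \<Longrightarrow> f (\<lambda>b. x b + y b) = (\<lambda>d. f x d + f y d)"
    and scale: "\<And>a x. x \<in> vectors M \<Longrightarrow> f (\<lambda>b. a * x b) = (\<lambda>d. a * f x d)"
    using assms(1) by (simp_all add: linear_maps_def)
  show ?thesis
    using assms(2,3)
  proof (induction S rule: finite_induct)
    case empty
    have "(\<lambda>b. 0) \<in> vectors M" by (simp add: vectors_def)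
    from scale[OF this, of 0] show ?case by simp
  next
    case (insert e S)
    have e: "unit_vec e \<in> vectors M"
      using insert by (intro unit_vec_in_vectors) simp
    then have xe: "(\<lambda>b. x e * unit_vec e b) \<in> vectors M"
      and S: "(\<lambda>b. \<Sum>e\<in>S. x e * unit_vec e b) \<in> vectors M"
      using insert by (auto simp: vectors_def unit_vec_def intro!: sum.neutral)
    have "f (\<lambda>b. x e * unit_vec e b + (\<Sum>e\<in>S. x e * unit_vec e b))
        = (\<lambda>d. f (\<lambda>b. x e * unit_vec e b) d + f (\<lambda>b. \<Sum>e\<in>S. x e * unit_vec e b) d)"
      by (rule add[OF xe S])
    moreover have "f (\<lambda>b. x e * unit_vec e b) = (\<lambda>d. x e * f (unit_vec e) d)"
      by (rule scale[OF e])
    ultimately show ?case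
      using insert by simp
  qed
qed

lemma linear_maps_expand:
  assumes "f \<in> linear_maps M N" "finite (basis M)" "x \<in> vectors M"
  shows "f x d = (\<Sum>e\<in>basis M. x e * f (unit_vec e) d)"
proof -
  have "x = (\<lambda>b. \<Sum>e\<in>basis M. x e * unit_vec e b)"
  proof
    fix b
    have "(\<Sum>e\<in>basis M. x e * unit_vec e b) = (\<Sum>e\<in>basis M. if e = b then x e else 0)"
      by (rule sum.cong) (auto simp: unit_vec_def)
    then show "x b = (\<Sum>e\<in>basis M. x e * unit_vec e b)"
      using assms(2,3) by (simp add: vectors_def)
  qed
  then have "f x = f (\<lambda>b. \<Sum>e\<in>basis M. x e * unit_vec e b)"
    by (rule arg_cong)
  then show ?thesis
    using linear_maps_sum[OF assms(1,2) subset_refl, of x] by simp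
qed

lemma const_add: "const (a + b) = const a + const b"
  by (simp add: const_def single_add)

lemma const_mult: "const (a * b) = const a * const b"
  by (simp add: const_def mult_single)

lemma const_0: "const 0 = 0" and const_1: "const 1 = 1"
  by (simp_all add: const_def)

lemma const_sum: "const (\<Sum>x\<in>S. f x) = (\<Sum>x\<in>S. const (f x))"
  by (induction S rule: infinite_finite_induct) (simp_all add: const_0 const_add)

text \<open>Compatibility with the coaction says that the matrix of f commutes with the coefficient
  matrix. It is stated on representatives in the free algebra, modulo the ideal, so that functionals
  can be applied to the commutator.\<close>

lemma comodule_homs_iff:
  fixes q :: "'k::field" and M :: "('b, 'k coord) comodule"
  assumes f: "f \<in> linear_maps M M" and fin: "finite (basis M)"
    and P: "\<And>b d. b \<in> basis M \<Longrightarrow> d \<in> basis M \<Longrightarrow>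
      coeff M b d = qcoset n q (P b d) \<and> P b d \<in> carrier (qfree n)"
    and deg: "\<And>b d. b \<in> basis M \<Longrightarrow> d \<in> basis M \<Longrightarrow> coeff M b d \<in> carrier (A_deg n r q)"
  shows "f \<in> comodule_homs (A_deg n r q) M M \<longleftrightarrow> (\<forall>b\<in>basis M. \<forall>d\<in>basis M.
    (\<Sum>e\<in>basis M. const (f (unit_vec b) e) * P e d)
    - (\<Sum>e\<in>basis M. const (f (unit_vec e) d) * P b e) \<in> qideal n q)"
proof -
  let ?B = "basis M" and ?C = "A_deg n r q"
  define Z where "Z b d = (\<Sum>e\<in>?B. const (f (unit_vec b) e) * P e d)
    - (\<Sum>e\<in>?B. const (f (unit_vec e) d) * P b e)" for b d
  have PC: "const a * P b d \<in> carrier (qfree n)" if "b \<in> ?B" "d \<in> ?B" for a b d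
    using P[OF that] by (intro qfree_mult const_in_free_alg) simp
  have smult: "a \<odot>\<^bsub>?C\<^esub> coeff M b d = qcoset n q (const a * P b d)"
    and smult_deg: "qcoset n q (const a * P b d) \<in> carrier ?C" if "b \<in> ?B" "d \<in> ?B" for a b d
    using P[OF that] qcoset_smult[where n = n and q = q and a = a and p = "P b d"] A_deg_smult[OF deg[OF that], of a]
    by (simp_all add: A_deg_simps)
  have coact: "coaction ?C M x d = qcoset n q (\<Sum>b\<in>?B. const (x b) * P b d)"
    and coact_deg: "coaction ?C M x d \<in> carrier ?C" if d: "d \<in> ?B" for x d
  proof -
    have "coaction ?C M x d = (\<Oplus>\<^bsub>?C\<^esub>b\<in>?B. qcoset n q (const (x b) * P b d))"
      unfolding coaction_def using d smult smult_deg abelian_monoid_A_deg[of n r q]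
      by (simp, intro abelian_monoid.finsum_cong') auto
    also have "\<dots> = (\<Oplus>\<^bsub>A n q\<^esub>b\<in>?B. qcoset n q (const (x b) * P b d))"
      using fin smult_deg d by (intro finsum_A_deg) auto
    finally have 1: "coaction ?C M x d = (\<Oplus>\<^bsub>A n q\<^esub>b\<in>?B. qcoset n q (const (x b) * P b d))" .
    show "coaction ?C M x d \<in> carrier ?C"
      unfolding 1 by (rule A_deg_finsum) (use smult_deg d in auto)
    show "coaction ?C M x d = qcoset n q (\<Sum>b\<in>?B. const (x b) * P b d)"
      unfolding 1 by (rule finsum_qcoset) (use fin PC d in auto)
  qed
  have sumC: "(\<Sum>b\<in>?B. const (x b) * P b d) \<in> carrier (qfree n)" if "d \<in> ?B" for x d
    by (intro qfree_sum PC that)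
  have idt: "id_tensor ?C M M f (coaction ?C M x) d
      = qcoset n q (\<Sum>e\<in>?B. const (f (unit_vec e) d) * (\<Sum>b\<in>?B. const (x b) * P b e))"
    if d: "d \<in> ?B" for x d
  proof -
    have s: "f (unit_vec e) d \<odot>\<^bsub>?C\<^esub> coaction ?C M x e
        = qcoset n q (const (f (unit_vec e) d) * (\<Sum>b\<in>?B. const (x b) * P b e))"
      and sd: "qcoset n q (const (f (unit_vec e) d) * (\<Sum>b\<in>?B. const (x b) * P b e)) \<in> carrier ?C"
      if e: "e \<in> ?B" for e
      using coact[OF e, of x] A_deg_smult[OF coact_deg[OF e, of x], of "f (unit_vec e) d"]
        qcoset_smult[OF sumC[OF e, of x], where q = q and a = "f (unit_vec e) d"]
      by (simp_all add: A_deg_simps)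
    have "id_tensor ?C M M f (coaction ?C M x) d
      = (\<Oplus>\<^bsub>?C\<^esub>e\<in>?B. qcoset n q (const (f (unit_vec e) d) * (\<Sum>b\<in>?B. const (x b) * P b e)))"
      unfolding id_tensor_def using d s sd abelian_monoid_A_deg[of n r q]
      by (simp, intro abelian_monoid.finsum_cong') auto
    also have "\<dots> = (\<Oplus>\<^bsub>A n q\<^esub>e\<in>?B. qcoset n q (const (f (unit_vec e) d) * (\<Sum>b\<in>?B. const (x b) * P b e)))"
      using fin sd by (intro finsum_A_deg) auto
    also have "\<dots> = qcoset n q (\<Sum>e\<in>?B. const (f (unit_vec e) d) * (\<Sum>b\<in>?B. const (x b) * P b e))"
      by (rule finsum_qcoset) (use fin sumC in \<open>auto intro: qfree_mult\<close>)
    finally show ?thesis .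
  qed
  have diff: "(\<Sum>e\<in>?B. const (f x e) * P e d)
      - (\<Sum>e\<in>?B. const (f (unit_vec e) d) * (\<Sum>b\<in>?B. const (x b) * P b e))
      = (\<Sum>b\<in>?B. const (x b) * Z b d)" if x: "x \<in> vectors M" for x d
  proof -
    have "(\<Sum>e\<in>?B. const (f x e) * P e d) = (\<Sum>e\<in>?B. \<Sum>b\<in>?B. const (x b) * (const (f (unit_vec b) e) * P e d))"
      by (simp add: linear_maps_expand[OF f fin x] const_sum const_mult sum_distrib_right mult.assoc)
    also have "\<dots> = (\<Sum>b\<in>?B. const (x b) * (\<Sum>e\<in>?B. const (f (unit_vec b) e) * P e d))"
      by (subst sum.swap) (simp add: sum_distrib_left)
    finally have 1: "(\<Sum>e\<in>?B. const (f x e) * P e d)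
      = (\<Sum>b\<in>?B. const (x b) * (\<Sum>e\<in>?B. const (f (unit_vec b) e) * P e d))" .
    have comm: "const a * (const a' * p) = const a' * (const a * p)" for a a' and p :: "(nat \<times> nat) word \<Rightarrow>\<^sub>0 'k"
      unfolding mult.assoc[symmetric] const_mult[symmetric] by (simp only: mult.commute)
    have "(\<Sum>e\<in>?B. const (f (unit_vec e) d) * (\<Sum>b\<in>?B. const (x b) * P b e))
      = (\<Sum>e\<in>?B. \<Sum>b\<in>?B. const (x b) * (const (f (unit_vec e) d) * P b e))"
      unfolding sum_distrib_left by (simp only: comm)
    also have "\<dots> = (\<Sum>b\<in>?B. const (x b) * (\<Sum>e\<in>?B. const (f (unit_vec e) d) * P b e))"
      by (subst sum.swap) (simp add: sum_distrib_left)
    finally show ?thesis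
      unfolding 1 by (simp add: Z_def sum_subtractf right_diff_distrib)
  qed
  have hom_iff: "coaction ?C M (f x) = id_tensor ?C M M f (coaction ?C M x)
      \<longleftrightarrow> (\<forall>d\<in>?B. (\<Sum>b\<in>?B. const (x b) * Z b d) \<in> qideal n q)" if x: "x \<in> vectors M" for x
  proof -
    have "coaction ?C M (f x) = id_tensor ?C M M f (coaction ?C M x)
        \<longleftrightarrow> (\<forall>d\<in>?B. coaction ?C M (f x) d = id_tensor ?C M M f (coaction ?C M x) d)"
    proof
      assume *: "\<forall>d\<in>?B. coaction ?C M (f x) d = id_tensor ?C M M f (coaction ?C M x) d"
      show "coaction ?C M (f x) = id_tensor ?C M M f (coaction ?C M x)"
      proof
        fix d
        show "coaction ?C M (f x) d = id_tensor ?C M M f (coaction ?C M x) d"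
          using * by (cases "d \<in> ?B") (simp_all add: coaction_def id_tensor_def)
      qed
    qed simp
    also have "\<dots> \<longleftrightarrow> (\<forall>d\<in>?B. (\<Sum>b\<in>?B. const (x b) * Z b d) \<in> qideal n q)"
      unfolding diff[OF x, symmetric]
      by (intro ball_cong refl, subst coact, assumption, subst idt, assumption, rule qcoset_eq_iff)
        (auto intro!: sumC qfree_sum qfree_mult simp: P)
    finally show ?thesis .
  qed
  have "(\<forall>x\<in>vectors M. \<forall>d\<in>?B. (\<Sum>b\<in>?B. const (x b) * Z b d) \<in> qideal n q)
      \<longleftrightarrow> (\<forall>b\<in>?B. \<forall>d\<in>?B. Z b d \<in> qideal n q)"
  proof (intro iffI ballI)
    fix b d assume *: "\<forall>x\<in>vectors M. \<forall>d\<in>?B. (\<Sum>b\<in>?B. const (x b) * Z b d) \<in> qideal n q"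
      and b: "b \<in> ?B" and d: "d \<in> ?B"
    have "(\<Sum>e\<in>?B. const (unit_vec b e) * Z e d) = (\<Sum>e\<in>?B. if e = b then Z e d else 0)"
      by (rule sum.cong) (auto simp: unit_vec_def const_0 const_1)
    then have "(\<Sum>e\<in>?B. const (unit_vec b e) * Z e d) = Z b d"
      using fin b by simp
    moreover have "(\<Sum>e\<in>?B. const (unit_vec b e) * Z e d) \<in> qideal n q"
      using * unit_vec_in_vectors[OF b] d by blast
    ultimately show "Z b d \<in> qideal n q" by simp
  next
    fix x d assume "\<forall>b\<in>?B. \<forall>d\<in>?B. Z b d \<in> qideal n q" "d \<in> ?B"
    then show "(\<Sum>b\<in>?B. const (x b) * Z b d) \<in> qideal n q"
      by (intro qideal_sum qideal_const) auto
  qed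
  moreover have "f \<in> comodule_homs ?C M M
      \<longleftrightarrow> (\<forall>x\<in>vectors M. \<forall>d\<in>?B. (\<Sum>b\<in>?B. const (x b) * Z b d) \<in> qideal n q)"
    using f hom_iff by (simp add: comodule_homs_def)
  ultimately show ?thesis
    unfolding Z_def by simp
qed

text \<open>The linear isomorphism \<open>T\<close> sends the basis vector of b to that of
  \<open>\<theta> b\<close> divided by \<open>D b\<close>, and conjugation by it respects all
  operations. \<open>hom\<close> compares only matrices, so the two comodules may live over
  different coalgebras.\<close>

lemma comodule_End_conjugate:
  fixes M :: "('b, 'a) comodule" and N :: "('d, 'c) comodule"
    and C :: "('k::field, 'a) module" and C' :: "('k, 'c) module"
  assumes \<theta>: "bij_betw \<theta> (basis M) (basis N)" and D: "\<And>b. D b \<noteq> (0 :: 'k)"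
    and hom: "\<And>f g. f \<in> linear_maps M M \<Longrightarrow> g \<in> linear_maps N N \<Longrightarrow>
      (\<And>b d. b \<in> basis M \<Longrightarrow> d \<in> basis M \<Longrightarrow>
        D d * g (unit_vec (\<theta> b)) (\<theta> d) = D b * f (unit_vec b) d) \<Longrightarrow>
      f \<in> comodule_homs C M M \<longleftrightarrow> g \<in> comodule_homs C' N N"
  shows "algebra_isomorphic (comodule_End C M) (comodule_End C' N)"
proof -
  define \<theta>' where "\<theta>' = inv_into (basis M) \<theta>"
  have \<theta>': "\<theta>' (\<theta> b) = b" "\<theta> b \<in> basis N" if "b \<in> basis M" for b
    using \<theta> that by (auto simp: \<theta>'_def bij_betw_inv_into_left bij_betwE)
  have \<theta>'': "\<theta> (\<theta>' d) = d" "\<theta>' d \<in> basis M" if "d \<in> basis N" for d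
    using \<theta> that by (auto simp: \<theta>'_def bij_betw_inv_into_right bij_betwE[OF bij_betw_inv_into])
  define T where "T x = (\<lambda>d. if d \<in> basis N then x (\<theta>' d) / D (\<theta>' d) else 0)" for x :: "'b \<Rightarrow> 'k"
  define T' where "T' y = (\<lambda>b. if b \<in> basis M then D b * y (\<theta> b) else 0)" for y :: "'d \<Rightarrow> 'k"
  have T: "T x \<in> vectors N" for x by (simp add: T_def vectors_def)
  have T': "T' y \<in> vectors M" for y by (simp add: T'_def vectors_def)
  have T'T: "T' (T x) = x" if "x \<in> vectors M" for x
    using that \<theta>' D by (auto simp: T'_def T_def vectors_def fun_eq_iff)
  have TT': "T (T' y) = y" if "y \<in> vectors N" for y
    using that \<theta>'' D by (auto simp: T'_def T_def vectors_def fun_eq_iff)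
  have Tadd: "T (\<lambda>b. x b + y b) = (\<lambda>d. T x d + T y d)" for x y
    by (auto simp: T_def add_divide_distrib)
  have Tsc: "T (\<lambda>b. a * x b) = (\<lambda>d. a * T x d)" for a x
    by (auto simp: T_def)
  have T'add: "T' (\<lambda>b. x b + y b) = (\<lambda>d. T' x d + T' y d)" for x y
    by (auto simp: T'_def distrib_left)
  have T'sc: "T' (\<lambda>b. a * x b) = (\<lambda>d. a * T' x d)" for a x
    by (auto simp: T'_def)
  define \<Phi> where "\<Phi> f = (\<lambda>y\<in>vectors N. T (f (T' y)))" for f :: "('b \<Rightarrow> 'k) \<Rightarrow> 'b \<Rightarrow> 'k"
  define \<Psi> where "\<Psi> g = (\<lambda>x\<in>vectors M. T' (g (T x)))" for g :: "('d \<Rightarrow> 'k) \<Rightarrow> 'd \<Rightarrow> 'k"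
  have lM: "f x \<in> vectors M" "f (\<lambda>b. x b + y b) = (\<lambda>d. f x d + f y d)" "f (\<lambda>b. a * x b) = (\<lambda>d. a * f x d)"
    if "f \<in> linear_maps M M" "x \<in> vectors M" "y \<in> vectors M" for f x y a
    using that by (auto simp: linear_maps_def)
  have lN: "f x \<in> vectors N" "f (\<lambda>b. x b + y b) = (\<lambda>d. f x d + f y d)" "f (\<lambda>b. a * x b) = (\<lambda>d. a * f x d)"
    if "f \<in> linear_maps N N" "x \<in> vectors N" "y \<in> vectors N" for f x y a
    using that by (auto simp: linear_maps_def)
  have vM: "(\<lambda>b. x b + y b) \<in> vectors M" "(\<lambda>b. a * x b) \<in> vectors M" if "x \<in> vectors M" "y \<in> vectors M"
    for x y :: "'b \<Rightarrow> 'k" and a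
    using that by (auto simp: vectors_def)
  have vN: "(\<lambda>b. x b + y b) \<in> vectors N" "(\<lambda>b. a * x b) \<in> vectors N" if "x \<in> vectors N" "y \<in> vectors N"
    for x y :: "'d \<Rightarrow> 'k" and a
    using that by (auto simp: vectors_def)
  have \<Phi>lin: "\<Phi> f \<in> linear_maps N N" if f: "f \<in> linear_maps M M" for f
    unfolding linear_maps_def mem_Collect_eq
  proof (intro conjI ballI allI)
    show "\<Phi> f \<in> vectors N \<rightarrow>\<^sub>E vectors N" by (simp add: \<Phi>_def T)
    show "\<Phi> f (\<lambda>b. x b + y b) = (\<lambda>d. \<Phi> f x d + \<Phi> f y d)" if "x \<in> vectors N" "y \<in> vectors N" for x y
      using that vN[OF that] by (simp add: \<Phi>_def T'add lM(2)[OF f T' T'] Tadd)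
    show "\<Phi> f (\<lambda>b. a * x b) = (\<lambda>d. a * \<Phi> f x d)" if "x \<in> vectors N" for a x
      using that vN(2)[OF that that] by (simp add: \<Phi>_def T'sc lM(3)[OF f T' T'] Tsc)
  qed
  have \<Psi>lin: "\<Psi> f \<in> linear_maps M M" if f: "f \<in> linear_maps N N" for f
    unfolding linear_maps_def mem_Collect_eq
  proof (intro conjI ballI allI)
    show "\<Psi> f \<in> vectors M \<rightarrow>\<^sub>E vectors M" by (simp add: \<Psi>_def T')
    show "\<Psi> f (\<lambda>b. x b + y b) = (\<lambda>d. \<Psi> f x d + \<Psi> f y d)" if "x \<in> vectors M" "y \<in> vectors M" for x y
      using that vM[OF that] by (simp add: \<Psi>_def Tadd lN(2)[OF f T T] T'add)
    show "\<Psi> f (\<lambda>b. a * x b) = (\<lambda>d. a * \<Psi> f x d)" if "x \<in> vectors M" for a x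
      using that vM(2)[OF that that] by (simp add: \<Psi>_def Tsc lN(3)[OF f T T] T'sc)
  qed
  have \<Psi>\<Phi>: "\<Psi> (\<Phi> f) = f" if f: "f \<in> linear_maps M M" for f
  proof
    fix x
    have "f \<in> extensional (vectors M)" using f by (auto simp: linear_maps_def PiE_def)
    then show "\<Psi> (\<Phi> f) x = f x"
      using lM(1)[OF f] by (cases "x \<in> vectors M") (auto simp: \<Psi>_def \<Phi>_def T T'T extensional_def)
  qed
  have \<Phi>\<Psi>: "\<Phi> (\<Psi> g) = g" if g: "g \<in> linear_maps N N" for g
  proof
    fix x
    have "g \<in> extensional (vectors N)" using g by (auto simp: linear_maps_def PiE_def)
    then show "\<Phi> (\<Psi> g) x = g x"
      using lN(1)[OF g] by (cases "x \<in> vectors N") (auto simp: \<Psi>_def \<Phi>_def T' TT' extensional_def)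
  qed
  have \<Phi>hom: "f \<in> comodule_homs C M M \<longleftrightarrow> \<Phi> f \<in> comodule_homs C' N N" if f: "f \<in> linear_maps M M" for f
  proof (rule hom[OF f \<Phi>lin[OF f]])
    fix b d assume b: "b \<in> basis M" and d: "d \<in> basis M"
    have "T' (unit_vec (\<theta> b)) = (\<lambda>e. D b * unit_vec b e)"
      using b \<theta>' by (auto simp: T'_def unit_vec_def fun_eq_iff) (metis \<theta>'(1))
    moreover have "f (\<lambda>e. D b * unit_vec b e) = (\<lambda>e. D b * f (unit_vec b) e)"
      using lM(3)[OF f unit_vec_in_vectors[OF b] unit_vec_in_vectors[OF b]] .
    moreover have "(unit_vec (\<theta> b) :: 'd \<Rightarrow> 'k) \<in> vectors N"
      by (rule unit_vec_in_vectors[OF \<theta>'(2)[OF b]])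
    ultimately show "D d * \<Phi> f (unit_vec (\<theta> b)) (\<theta> d) = D b * f (unit_vec b) d"
      using \<theta>'[OF d] D[of d] by (simp add: \<Phi>_def T_def)
  qed
  have sub: "f \<in> linear_maps M M" if "f \<in> comodule_homs C M M" for f
    using that by (simp add: comodule_homs_def)
  have sub': "g \<in> linear_maps N N" if "g \<in> comodule_homs C' N N" for g
    using that by (simp add: comodule_homs_def)
  let ?E = "comodule_End C M" and ?E' = "comodule_End C' N"
  have "\<Phi> \<in> ring_iso ?E ?E'"
  proof (rule ring_iso_memI)
    show "\<Phi> f \<in> carrier ?E'" if "f \<in> carrier ?E" for f
      using that \<Phi>hom sub by (auto simp: comodule_End_def)
    show "\<Phi> (f \<otimes>\<^bsub>?E\<^esub> g) = \<Phi> f \<otimes>\<^bsub>?E'\<^esub> \<Phi> g" if "f \<in> carrier ?E" "g \<in> carrier ?E" for f g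
    proof -
      have "g \<in> linear_maps M M" using that sub by (auto simp: comodule_End_def)
      then have "T' (T (g (T' y))) = g (T' y)" for y
        by (rule T'T[OF lM(1)[OF _ T' T']])
      then show ?thesis
        by (intro ext) (simp add: comodule_End_def \<Phi>_def compose_def T' T)
    qed
    show "\<Phi> (f \<oplus>\<^bsub>?E\<^esub> g) = \<Phi> f \<oplus>\<^bsub>?E'\<^esub> \<Phi> g" for f g
      by (auto simp: comodule_End_def \<Phi>_def T' Tadd)
    show "\<Phi> \<one>\<^bsub>?E\<^esub> = \<one>\<^bsub>?E'\<^esub>"
      by (auto simp: comodule_End_def \<Phi>_def T' TT')
    show "bij_betw \<Phi> (carrier ?E) (carrier ?E')"
    proof (rule bij_betw_byWitness[where f' = \<Psi>])
      show "\<forall>f\<in>carrier ?E. \<Psi> (\<Phi> f) = f" "\<forall>g\<in>carrier ?E'. \<Phi> (\<Psi> g) = g"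
        using \<Psi>\<Phi> \<Phi>\<Psi> sub sub' by (auto simp: comodule_End_def)
      show "\<Phi> ` carrier ?E \<subseteq> carrier ?E'"
        using \<Phi>hom sub by (auto simp: comodule_End_def)
      show "\<Psi> ` carrier ?E' \<subseteq> carrier ?E"
        using \<Phi>hom[OF \<Psi>lin[OF sub']] \<Phi>\<Psi>[OF sub'] by (auto simp: comodule_End_def)
    qed
  qed
  moreover have "\<Phi> (a \<odot>\<^bsub>?E\<^esub> f) = a \<odot>\<^bsub>?E'\<^esub> \<Phi> f" for a f
    by (auto simp: comodule_End_def \<Phi>_def T' Tsc)
  ultimately show ?thesis
    unfolding algebra_isomorphic_def by blast
qed

section \<open>Reduction of colinearity to finitely many types of generators\<close>

section \<open>Endomorphisms of sums of exterior powers\<close>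

abbreviation ext_sum :: "nat \<Rightarrow> 'k::field \<Rightarrow> nat list set \<Rightarrow> (nat list \<Rightarrow> nat list)
    \<Rightarrow> (nat list \<times> nat set list, 'k coord) comodule"
  where "ext_sum n q X f \<equiv> dsum_comodule (A n q) X (\<lambda>\<alpha>. ext_powers n q (f \<alpha>))"

definition sum_blocks :: "nat \<Rightarrow> nat list set \<Rightarrow> (nat list \<Rightarrow> nat list) \<Rightarrow> (nat list \<times> nat set list) set"
  where "sum_blocks n X f = (SIGMA \<alpha>:X. blocks n (f \<alpha>))"

definition ext_entry :: "nat \<Rightarrow> (nat list \<Rightarrow> nat list \<Rightarrow> 'k::field)
    \<Rightarrow> nat list \<times> nat set list \<Rightarrow> nat list \<times> nat set list \<Rightarrow> 'k"
  where "ext_entry n \<xi> b d = (if fst b = fst d then ext n \<xi> (snd b) (snd d) else 0)"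

definition ext_commutes :: "nat \<Rightarrow> (nat list \<times> nat set list) set
    \<Rightarrow> (nat list \<times> nat set list \<Rightarrow> nat list \<times> nat set list \<Rightarrow> 'k::field)
    \<Rightarrow> (nat list \<Rightarrow> nat list \<Rightarrow> 'k) \<Rightarrow> bool"
  where "ext_commutes n S F \<xi> \<longleftrightarrow> (\<forall>b\<in>S. \<forall>d\<in>S.
    (\<Sum>e\<in>S. F b e * ext_entry n \<xi> e d) = (\<Sum>e\<in>S. ext_entry n \<xi> b e * F e d))"

lemma ext_commutes_zero: "ext_commutes n S F (\<lambda>i j. 0)"
proof -
  have "ext_entry n (\<lambda>i j. 0) b d = (0 :: 'a)" for b d
    by (simp add: ext_entry_def ext_def)
  then show ?thesis by (simp add: ext_commutes_def)
qed

lemma finite_sum_blocks: "finite X \<Longrightarrow> finite (sum_blocks n X f)"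
  by (simp add: sum_blocks_def)

lemma basis_ext_sum: "basis (ext_sum n q X f) = sum_blocks n X f"
  by (simp add: dsum_comodule_def sum_blocks_def basis_ext_powers)

definition sum_minors :: "nat \<Rightarrow> nat list \<times> nat set list \<Rightarrow> nat list \<times> nat set list
    \<Rightarrow> (nat \<times> nat) word \<Rightarrow>\<^sub>0 'k::field"
  where "sum_minors n b d = (if fst b = fst d then minors n (snd b) (snd d) else 0)"

lemma coeff_ext_sum:
  assumes "b \<in> sum_blocks n X f" "d \<in> sum_blocks n X f"
  shows "coeff (ext_sum n q X f) b d = qcoset n q (sum_minors n b d)"
    and "sum_minors n b d \<in> carrier (qfree n)"
    and "evaluate \<xi> (sum_minors n b d) = ext_entry n \<xi> b d"
  using assms
  by (auto simp: sum_blocks_def sum_minors_def dsum_comodule_def coeff_ext_powers qcoset_zero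
      ext_entry_def evaluate_minors qfree_zero intro!: minors_carrier dest: blocks_subset)

lemma ext_entry_convolve:
  fixes \<xi> \<eta> :: "nat list \<Rightarrow> nat list \<Rightarrow> 'k::field"
  assumes "centralizing n q \<eta>" "q \<noteq> 0" "finite X" "b \<in> sum_blocks n X f" "d \<in> sum_blocks n X f"
  shows "ext_entry n (convolve n \<xi> \<eta>) b d
    = (\<Sum>e\<in>sum_blocks n X f. ext_entry n \<xi> b e * ext_entry n \<eta> e d)"
proof -
  obtain \<alpha> I \<beta> J where b: "b = (\<alpha>, I)" "\<alpha> \<in> X" "I \<in> blocks n (f \<alpha>)"
    and d: "d = (\<beta>, J)" "\<beta> \<in> X" "J \<in> blocks n (f \<beta>)"
    using assms(4,5) by (auto simp: sum_blocks_def)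
  have "(\<Sum>e\<in>sum_blocks n X f. ext_entry n \<xi> b e * ext_entry n \<eta> e d)
    = (\<Sum>\<gamma>\<in>X. \<Sum>K\<in>blocks n (f \<gamma>). ext_entry n \<xi> b (\<gamma>, K) * ext_entry n \<eta> (\<gamma>, K) d)"
    unfolding sum_blocks_def by (subst sum.Sigma) (use assms(3) in \<open>auto simp: case_prod_beta\<close>)
  also have "\<dots> = (\<Sum>\<gamma>\<in>X. if \<alpha> = \<gamma> then if \<alpha> = \<beta> then \<Sum>K\<in>blocks n (f \<alpha>). ext n \<xi> I K * ext n \<eta> K J else 0 else 0)"
    by (rule sum.cong) (auto simp: b(1) d(1) ext_entry_def)
  also have "\<dots> = ext_entry n (convolve n \<xi> \<eta>) b d"
    using assms(3) b d ext_convolve[OF assms(1,2), of I "f \<alpha>" J \<xi>] by (auto simp: ext_entry_def)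
  finally show ?thesis ..
qed

text \<open>Commuting with F passes to products, since \<open>ext_entry\<close> turns convolution
  into matrix multiplication.\<close>

lemma ext_commutes_convolve:
  assumes "centralizing n q \<eta>" "q \<noteq> 0" "finite X"
    and "ext_commutes n (sum_blocks n X f) F \<xi>" "ext_commutes n (sum_blocks n X f) F \<eta>"
  shows "ext_commutes n (sum_blocks n X f) F (convolve n \<xi> \<eta>)"
  unfolding ext_commutes_def
proof (intro ballI)
  let ?S = "sum_blocks n X f"
  let ?x = "ext_entry n \<xi>" and ?y = "ext_entry n \<eta>"
  fix b d assume b: "b \<in> ?S" and d: "d \<in> ?S"
  have "(\<Sum>e\<in>?S. F b e * ext_entry n (convolve n \<xi> \<eta>) e d) = (\<Sum>e\<in>?S. \<Sum>g\<in>?S. F b e * ?x e g * ?y g d)"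
    by (rule sum.cong) (simp_all add: ext_entry_convolve[OF assms(1-3) _ d] sum_distrib_left mult.assoc)
  also have "\<dots> = (\<Sum>g\<in>?S. (\<Sum>e\<in>?S. F b e * ?x e g) * ?y g d)"
    by (subst sum.swap) (simp add: sum_distrib_right)
  also have "\<dots> = (\<Sum>g\<in>?S. (\<Sum>e\<in>?S. ?x b e * F e g) * ?y g d)"
    using assms(4) b by (intro sum.cong) (simp_all add: ext_commutes_def)
  also have "\<dots> = (\<Sum>e\<in>?S. ?x b e * (\<Sum>g\<in>?S. F e g * ?y g d))"
    by (simp add: sum_distrib_left sum_distrib_right mult.assoc) (rule sum.swap)
  also have "\<dots> = (\<Sum>e\<in>?S. ?x b e * (\<Sum>g\<in>?S. ?y e g * F g d))"
    using assms(5) d by (intro sum.cong) (simp_all add: ext_commutes_def)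
  also have "\<dots> = (\<Sum>g\<in>?S. (\<Sum>e\<in>?S. ?x b e * ?y e g) * F g d)"
    by (simp add: sum_distrib_left sum_distrib_right mult.assoc) (rule sum.swap)
  also have "\<dots> = (\<Sum>g\<in>?S. ext_entry n (convolve n \<xi> \<eta>) b g * F g d)"
    by (rule sum.cong) (simp_all add: ext_entry_convolve[OF assms(1-3) b])
  finally show "(\<Sum>e\<in>?S. F b e * ext_entry n (convolve n \<xi> \<eta>) e d)
      = (\<Sum>e\<in>?S. ext_entry n (convolve n \<xi> \<eta>) b e * F e d)" .
qed

definition adjacent :: "nat \<Rightarrow> nat \<Rightarrow> nat \<Rightarrow> bool"
  where "adjacent n s t \<longleftrightarrow> s \<in> {1..n} \<and> t \<in> {1..n} \<and> (t = Suc s \<or> s = Suc t)"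

text \<open>\<open>Z\<close> is the commutator of the matrix of g with the coefficient matrix. If it
  lies in the ideal, every functional commuting with the Hecke algebra kills it; conversely,
  commutation with the generators extends to their products, and these detect the ideal. Only the
  ratio of u and v is prescribed, as the two sides of the final comparison need different
  normalizations.\<close>

lemma ext_sum_homs_iff:
  fixes q :: "'k::field" and u v :: "nat \<Rightarrow> nat \<Rightarrow> 'k"
  assumes "q \<noteq> 0" "finite X" "\<And>\<alpha>. \<alpha> \<in> X \<Longrightarrow> sum_list (f \<alpha>) = r"
    and "\<And>s t. u s t \<noteq> 0 \<and> v s t \<noteq> 0"
    and uv: "\<And>s. u s (Suc s) = q * v s (Suc s)" "\<And>t. v (Suc t) t = q * u (Suc t) t"
    and g: "g \<in> linear_maps (ext_sum n q X f) (ext_sum n q X f)"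
  shows "g \<in> comodule_homs (A_deg n r q) (ext_sum n q X f) (ext_sum n q X f) \<longleftrightarrow>
    (\<forall>\<mu>. ext_commutes n (sum_blocks n X f) (\<lambda>b. g (unit_vec b)) (weight_proj \<mu>)) \<and>
    (\<forall>s t k. adjacent n s t \<longrightarrow>
      ext_commutes n (sum_blocks n X f) (\<lambda>b. g (unit_vec b)) (shift s t (u s t) (v s t) k))"
    (is "?hom \<longleftrightarrow> ?comm")
proof -
  let ?S = "sum_blocks n X f" and ?F = "\<lambda>b. g (unit_vec b)"
  define Z where "Z b d = (\<Sum>e\<in>?S. const (?F b e) * sum_minors n e d)
    - (\<Sum>e\<in>?S. const (?F e d) * sum_minors n b e)" for b d
  have hom: "?hom \<longleftrightarrow> (\<forall>b\<in>?S. \<forall>d\<in>?S. Z b d \<in> qideal n q)"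
    unfolding Z_def basis_ext_sum[of n q X f, symmetric]
  proof (rule comodule_homs_iff[OF g])
    show "finite (basis (ext_sum n q X f))"
      unfolding basis_ext_sum by (rule finite_sum_blocks[OF assms(2)])
    fix b d assume bd: "b \<in> basis (ext_sum n q X f)" "d \<in> basis (ext_sum n q X f)"
    show "coeff (ext_sum n q X f) b d = qcoset n q (sum_minors n b d) \<and> sum_minors n b d \<in> carrier (qfree n)"
      using coeff_ext_sum(1,2) bd unfolding basis_ext_sum by blast
    show "coeff (ext_sum n q X f) b d \<in> carrier (A_deg n r q)"
      by (rule A_deg_dsum_ext_powers[OF assms(3) bd])
  qed
  have carr: "Z b d \<in> carrier (qfree n)" if "b \<in> ?S" "d \<in> ?S" for b d
    unfolding Z_def using coeff_ext_sum(2) that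
    by (intro qfree_diff qfree_sum qfree_mult const_in_free_alg) blast+
  have ev: "ext_commutes n ?S ?F \<xi> \<longleftrightarrow> (\<forall>b\<in>?S. \<forall>d\<in>?S. evaluate \<xi> (Z b d) = 0)" for \<xi>
  proof -
    have "evaluate \<xi> (Z b d) = (\<Sum>e\<in>?S. ?F b e * ext_entry n \<xi> e d) - (\<Sum>e\<in>?S. ext_entry n \<xi> b e * ?F e d)"
      if "b \<in> ?S" "d \<in> ?S" for b d
      unfolding Z_def evaluate_diff evaluate_sum evaluate_const_mult using that
      by (intro arg_cong2[where f = minus] sum.cong refl) (simp_all add: coeff_ext_sum(3) mult.commute)
    then show ?thesis
      by (simp add: ext_commutes_def)
  qed
  have cent: "centralizing n q (shift s t (u s t) (v s t) k)" if "t = Suc s \<or> s = Suc t" for s t k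
    using that uv by (intro centralizing_shift) auto
  show ?thesis
  proof
    assume ?hom
    then have "ext_commutes n ?S ?F \<xi>" if "centralizing n q \<xi>" for \<xi>
      unfolding ev hom using evaluate_qideal[OF that assms(1)] by blast
    then show ?comm
      using cent centralizing_weight_proj[of n q] by (auto simp: adjacent_def)
  next
    assume comm: ?comm
    let ?os = "stages_from n 1"
    have "ext_commutes n ?S ?F (shift_product n u v \<mu> os ks)
        \<and> centralizing n q (shift_product n u v \<mu> os ks)" if "set os \<subseteq> set ?os" for \<mu> os ks
      using that
    proof (induction os arbitrary: ks)
      case Nil
      show ?case
        using comm by (cases ks) (simp_all add: centralizing_weight_proj centralizing_zero ext_commutes_zero)
    next
      case (Cons e os)
      obtain s t where e: "e = (s, t)" by fastforce
      then have st: "adjacent n s t"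
        using Cons.prems stages_adjacent[of s t n] by (auto simp: adjacent_def)
      then have c: "centralizing n q (shift s t (u s t) (v s t) k)" for k
        using cent by (auto simp: adjacent_def)
      show ?case
      proof (cases ks)
        case (Cons k ks')
        have IH: "ext_commutes n ?S ?F (shift_product n u v \<mu> os ks')" "centralizing n q (shift_product n u v \<mu> os ks')"
          using Cons.IH[of ks'] Cons.prems by auto
        then show ?thesis
          unfolding e Cons shift_product.simps
          using comm st c by (intro conjI ext_commutes_convolve[OF _ assms(1,2)] centralizing_convolve) auto
      qed (simp add: e centralizing_zero ext_commutes_zero)
    qed
    then have "evaluate (shift_product n u v \<mu> ?os ks) (Z b d) = 0" if "b \<in> ?S" "d \<in> ?S" for \<mu> ks b d
      using ev that by blast
    then have "Z b d \<in> qideal n q" if bd: "b \<in> ?S" "d \<in> ?S" for b d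
      using that
    proof (intro shift_products_separate[OF carr[OF bd] assms(1), of u v])
      show "u s t \<noteq> 0 \<and> v s t \<noteq> 0" for s t by (rule assms(4))
      show "centralizing n q (shift s t (u s t) (v s t) k)" if "(s, t) \<in> set ?os" for s t k
        using stages_adjacent[OF that] cent by blast
    qed blast
    then show ?hom
      unfolding hom by blast
  qed
qed

section \<open>Transfer to the complementary exterior powers\<close>

section \<open>Complementary exterior powers\<close>

lemma length_blocks: "I \<in> blocks n \<alpha> \<Longrightarrow> length I = length \<alpha>"
  by (auto simp: blocks_def dest: list_all2_lengthD)

lemma complements_in_blocks:
  assumes "I \<in> blocks n \<alpha>"
  shows "complements n I \<in> blocks n (complement n \<alpha>)"
proof -
  have "list_all2 (\<lambda>B s. B \<subseteq> {1..n} \<and> card B = s) (map (\<lambda>B. {1..n} - B) I) (map (\<lambda>a. n - a) \<alpha>)"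
    using assms unfolding blocks_def mem_Collect_eq list.rel_map
    by (rule list_all2_mono) (auto simp: card_Diff_subset finite_subset_atLeastAtMost)
  then show ?thesis
    by (simp add: blocks_def complement_def)
qed

lemma complements_complements: "I \<in> blocks n \<alpha> \<Longrightarrow> complements n (complements n I) = I"
proof -
  assume I: "I \<in> blocks n \<alpha>"
  have "map (\<lambda>B. {1..n} - ({1..n} - B)) I = I"
    by (rule map_idI) (use blocks_subset[OF I] in blast)
  then show ?thesis
    by (simp add: rev_map[symmetric] comp_def)
qed

lemma complement_complement:
  "\<forall>a\<in>set \<alpha>. a \<le> n \<Longrightarrow> complement n (complement n \<alpha>) = \<alpha>"
  by (simp add: complement_def rev_map comp_def map_idI)

text \<open>The label \<alpha> is kept and only the blocks are complemented. Both sums are thus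
  indexed by X, and the map is inverse to itself.\<close>

lemma bij_betw_complements:
  assumes "\<And>\<alpha>. \<alpha> \<in> X \<Longrightarrow> \<forall>a\<in>set \<alpha>. a \<le> n"
  shows "bij_betw (\<lambda>(\<alpha>, I). (\<alpha>, complements n I)) (sum_blocks n X (\<lambda>\<alpha>. \<alpha>)) (sum_blocks n X (complement n))"
    (is "bij_betw ?\<theta> ?S ?S'")
proof (rule bij_betw_byWitness[where f' = "?\<theta>"])
  have compl: "complements n I \<in> blocks n \<alpha>" if "\<alpha> \<in> X" "I \<in> blocks n (complement n \<alpha>)" for \<alpha> I
    using complements_in_blocks[OF that(2)] complement_complement[OF assms[OF that(1)]] by simp
  show "\<forall>b\<in>?S. ?\<theta> (?\<theta> b) = b"
    "\<forall>b\<in>?S'. ?\<theta> (?\<theta> b) = b"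
    using complements_complements by (auto simp: sum_blocks_def)
  show "?\<theta> ` ?S \<subseteq> ?S'"
    using complements_in_blocks by (auto simp: sum_blocks_def)
  show "?\<theta> ` ?S' \<subseteq> ?S"
    using compl by (auto simp: sum_blocks_def)
qed

lemma count_mset_flat:
  assumes "I \<in> blocks n \<alpha>"
  shows "count (mset (flat I)) x = length (filter (\<lambda>B. x \<in> B) I)"
proof -
  have "\<forall>B\<in>set I. finite B"
    by (intro ballI finite_subset_atLeastAtMost[OF blocks_subset[OF assms]])
  from count_list_flat[OF this] show ?thesis
    by (simp add: count_mset)
qed

text \<open>If x between 1 and n lies in c of the m blocks, it lies in m - c of their complements,
  so equal contents remain equal.\<close>

lemma mset_flat_complements:
  assumes "I \<in> blocks n \<alpha>" "J \<in> blocks n \<beta>" "length \<alpha> = length \<beta>"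
  shows "mset (flat (complements n I)) = mset (flat (complements n J)) \<longleftrightarrow> mset (flat I) = mset (flat J)"
proof -
  have imp: "mset (flat (complements n I)) = mset (flat (complements n J))"
    if I: "I \<in> blocks n \<alpha>" and J: "J \<in> blocks n \<beta>" and l: "length \<alpha> = length \<beta>"
      and eq: "mset (flat I) = mset (flat J)" for I J \<alpha> \<beta>
  proof (rule multiset_eqI)
    fix x
    have len: "length (filter (\<lambda>B. x \<in> B) I) + length (filter (\<lambda>B. x \<notin> B) I)
      = length (filter (\<lambda>B. x \<in> B) J) + length (filter (\<lambda>B. x \<notin> B) J)"
      unfolding sum_length_filter_compl using length_blocks[OF I] length_blocks[OF J] l by simp
    have "length (filter (\<lambda>B. x \<in> B) I) = length (filter (\<lambda>B. x \<in> B) J)"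
      using count_mset_flat[OF I, of x] count_mset_flat[OF J, of x] eq by simp
    then have c: "length (filter (\<lambda>B. x \<notin> B) I) = length (filter (\<lambda>B. x \<notin> B) J)"
      using len by simp
    show "count (mset (flat (complements n I))) x = count (mset (flat (complements n J))) x"
    proof (cases "x \<in> {1..n}")
      case True
      show ?thesis
        unfolding count_mset_flat[OF complements_in_blocks[OF I]] count_mset_flat[OF complements_in_blocks[OF J]]
          length_filter_complements[OF True] by (rule c)
    next
      case False
      have "filter (\<lambda>B. x \<in> B) (complements n K) = []" for K
        using False by (auto simp: filter_empty_conv)
      then show ?thesis
        unfolding count_mset_flat[OF complements_in_blocks[OF I]] count_mset_flat[OF complements_in_blocks[OF J]]
        by simp
    qed
  qed
  have l: "length (complement n \<alpha>) = length (complement n \<beta>)"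
    using assms(3) by (simp add: complement_def)
  show ?thesis
    using imp[OF assms] imp[OF complements_in_blocks[OF assms(1)] complements_in_blocks[OF assms(2)] l]
      complements_complements[OF assms(1)] complements_complements[OF assms(2)] by metis
qed

text \<open>Commuting with all weight projections means that nonzero entries join equal weights. In
  this form nothing has to be said about which \<mu> corresponds to which on the complementary
  side.\<close>

lemma ext_commutes_weight_proj:
  fixes F :: "nat list \<times> nat set list \<Rightarrow> nat list \<times> nat set list \<Rightarrow> 'k::field"
  assumes "finite X"
  shows "(\<forall>\<mu>. ext_commutes n (sum_blocks n X f) F (weight_proj \<mu>)) \<longleftrightarrow>
    (\<forall>b\<in>sum_blocks n X f. \<forall>d\<in>sum_blocks n X f. F b d \<noteq> 0 \<longrightarrow> mset (flat (snd b)) = mset (flat (snd d)))"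
proof -
  let ?S = "sum_blocks n X f"
  have e: "(ext_entry n (weight_proj \<mu>) b d :: 'k) = (if b = d \<and> mset (flat (snd d)) = \<mu> then 1 else 0)"
    if "b \<in> ?S" "d \<in> ?S" for b d \<mu>
  proof (cases "fst b = fst d")
    case True
    have "snd b \<in> blocks n (f (fst b))" "snd d \<in> blocks n (f (fst b))"
      using that True by (auto simp: sum_blocks_def)
    from ext_weight_proj[OF this, of \<mu>, where 'k = 'k] True show ?thesis
      by (auto simp: ext_entry_def prod_eq_iff)
  qed (auto simp: ext_entry_def)
  have l: "(\<Sum>e\<in>?S. F b e * ext_entry n (weight_proj \<mu>) e d) = (if mset (flat (snd d)) = \<mu> then F b d else 0)"
    if "d \<in> ?S" for b d \<mu>
  proof -
    have "(\<Sum>e\<in>?S. F b e * ext_entry n (weight_proj \<mu>) e d)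
      = (\<Sum>e\<in>?S. if e = d then if mset (flat (snd d)) = \<mu> then F b d else 0 else 0)"
      by (rule sum.cong) (use e that in auto)
    then show ?thesis using that finite_sum_blocks[OF assms] by simp
  qed
  have r: "(\<Sum>e\<in>?S. ext_entry n (weight_proj \<mu>) b e * F e d) = (if mset (flat (snd b)) = \<mu> then F b d else 0)"
    if "b \<in> ?S" for b d \<mu>
  proof -
    have "(\<Sum>e\<in>?S. ext_entry n (weight_proj \<mu>) b e * F e d)
      = (\<Sum>e\<in>?S. if e = b then if mset (flat (snd b)) = \<mu> then F b d else 0 else 0)"
      by (rule sum.cong) (use e that in auto)
    then show ?thesis using that finite_sum_blocks[OF assms] by simp
  qed
  have comm: "ext_commutes n ?S F (weight_proj \<mu>) \<longleftrightarrow> (\<forall>b\<in>?S. \<forall>d\<in>?S.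
      (if mset (flat (snd d)) = \<mu> then F b d else 0) = (if mset (flat (snd b)) = \<mu> then F b d else 0))" for \<mu>
    unfolding ext_commutes_def by (intro ball_cong refl) (simp only: l r)
  show ?thesis
  proof (intro iffI ballI impI allI)
    fix b d assume "\<forall>\<mu>. ext_commutes n ?S F (weight_proj \<mu>)" "b \<in> ?S" "d \<in> ?S" "F b d \<noteq> 0"
    then have "(if mset (flat (snd d)) = mset (flat (snd d)) then F b d else 0)
        = (if mset (flat (snd b)) = mset (flat (snd d)) then F b d else 0)"
      unfolding comm by blast
    then show "mset (flat (snd b)) = mset (flat (snd d))"
      using \<open>F b d \<noteq> 0\<close> by (simp split: if_splits)
  next
    fix \<mu> assume *: "\<forall>b\<in>?S. \<forall>d\<in>?S. F b d \<noteq> 0 \<longrightarrow> mset (flat (snd b)) = mset (flat (snd d))"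
    show "ext_commutes n ?S F (weight_proj \<mu>)"
      unfolding comm
    proof (intro ballI)
      fix b d assume "b \<in> ?S" "d \<in> ?S"
      then show "(if mset (flat (snd d)) = \<mu> then F b d else 0) = (if mset (flat (snd b)) = \<mu> then F b d else 0)"
        using * by (cases "F b d = 0") simp_all
    qed
  qed
qed

text \<open>The entries of \<open>\<eta>\<close> are those of \<open>\<xi>\<close> conjugated by D,
  up to the scalar z' / z. This is the same for all b and d, so it drops out of the
  commutation.\<close>

lemma ext_commutes_conjugate:
  fixes F F' :: "nat list \<times> nat set list \<Rightarrow> nat list \<times> nat set list \<Rightarrow> 'k::field"
  assumes \<theta>: "bij_betw \<theta> S S'" and D: "\<And>b. D b \<noteq> 0" and z: "z \<noteq> 0" "z' \<noteq> 0"
    and F: "\<And>b d. b \<in> S \<Longrightarrow> d \<in> S \<Longrightarrow> D d * F' (\<theta> b) (\<theta> d) = D b * F b d"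
    and E: "\<And>b d. b \<in> S \<Longrightarrow> d \<in> S \<Longrightarrow>
      z * D d * ext_entry n \<eta> (\<theta> b) (\<theta> d) = z' * D b * ext_entry n \<xi> b d"
  shows "ext_commutes n S F \<xi> \<longleftrightarrow> ext_commutes n S' F' \<eta>"
proof -
  have F': "F' (\<theta> b) (\<theta> d) = D b / D d * F b d" if "b \<in> S" "d \<in> S" for b d
    using F[OF that] D[of d] by (simp add: field_simps)
  have E': "ext_entry n \<eta> (\<theta> b) (\<theta> d) = z' / z * D b / D d * ext_entry n \<xi> b d" if "b \<in> S" "d \<in> S" for b d
    using E[OF that] D[of d] z by (simp add: field_simps)
  have S': "S' = \<theta> ` S"
    using \<theta> by (simp add: bij_betw_def)
  have re: "(\<Sum>e\<in>S'. h e) = (\<Sum>e\<in>S. h (\<theta> e))" for h :: "_ \<Rightarrow> 'k"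
    by (rule sum.reindex_bij_betw[OF \<theta>, symmetric])
  have "((\<Sum>e\<in>S'. F' (\<theta> b) e * ext_entry n \<eta> e (\<theta> d)) = (\<Sum>e\<in>S'. ext_entry n \<eta> (\<theta> b) e * F' e (\<theta> d)))
      \<longleftrightarrow> ((\<Sum>e\<in>S. F b e * ext_entry n \<xi> e d) = (\<Sum>e\<in>S. ext_entry n \<xi> b e * F e d))"
    if b: "b \<in> S" and d: "d \<in> S" for b d
  proof -
    let ?w = "z' / z * D b / D d"
    have "(\<Sum>e\<in>S'. F' (\<theta> b) e * ext_entry n \<eta> e (\<theta> d)) = ?w * (\<Sum>e\<in>S. F b e * ext_entry n \<xi> e d)"
      unfolding re sum_distrib_left
      by (rule sum.cong) (use b d D in \<open>simp_all add: F' E'\<close>)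
    moreover have "(\<Sum>e\<in>S'. ext_entry n \<eta> (\<theta> b) e * F' e (\<theta> d)) = ?w * (\<Sum>e\<in>S. ext_entry n \<xi> b e * F e d)"
      unfolding re sum_distrib_left
      by (rule sum.cong) (use b d D in \<open>simp_all add: F' E'\<close>)
    moreover have "?w \<noteq> 0" using z D by simp
    ultimately show ?thesis by simp
  qed
  then show ?thesis
    unfolding ext_commutes_def S' ball_simps by simp
qed

lemma finite_partitions: "finite (partitions n r m)"
proof (rule finite_subset)
  show "partitions n r m \<subseteq> {\<alpha>. set \<alpha> \<subseteq> {..n} \<and> length \<alpha> = m}"
    by (auto simp: partitions_def)
qed (rule finite_lists_length_eq, simp)

theorem corollary4p4:
  fixes q :: "'k::field" and n r m :: nat and X :: "nat list set"
  assumes "infinite (UNIV :: 'k set)" and "q \<noteq> 0"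
    and "n \<ge> 1" and "r \<ge> 1"
    and "X \<subseteq> partitions n r m"
  shows "algebra_isomorphic
    (Schur_End n r q
      (dsum_comodule (A n q) X (\<lambda>\<alpha>. ext_powers n q \<alpha>)))
    (Schur_End n (n * m - r) q
      (dsum_comodule (A n q) X (\<lambda>\<alpha>. ext_powers n q (complement n \<alpha>))))"
  unfolding Schur_End_def
proof (rule comodule_End_conjugate)
  let ?M = "ext_sum n q X (\<lambda>\<alpha>. \<alpha>)" and ?N = "ext_sum n q X (complement n)"
  let ?S = "sum_blocks n X (\<lambda>\<alpha>. \<alpha>)" and ?S' = "sum_blocks n X (complement n)"
  let ?\<theta> = "\<lambda>(\<alpha>, I). (\<alpha>, complements n I)"
  define D where "D b = q ^ crossing_number (snd b)" for b :: "nat list \<times> nat set list"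
  have finX: "finite X"
    using assms(5) finite_partitions by (rule finite_subset)
  have part: "\<forall>a\<in>set \<alpha>. a \<le> n" "length \<alpha> = m" "sum_list \<alpha> = r" if "\<alpha> \<in> X" for \<alpha>
    using assms(5) that by (auto simp: partitions_def)
  have sum': "sum_list (complement n \<alpha>) = n * m - r" if "\<alpha> \<in> X" for \<alpha>
    using complement_in_partitions[of \<alpha> n r m] assms(5) that by (auto simp: partitions_def)
  have bij: "bij_betw ?\<theta> ?S ?S'"
    by (rule bij_betw_complements) (rule part(1))
  show "bij_betw ?\<theta> (basis ?M) (basis ?N)"
    unfolding basis_ext_sum by (rule bij)
  show D0: "D b \<noteq> 0" for b
    using assms(2) by (simp add: D_def)
  fix f g assume f: "f \<in> linear_maps ?M ?M" and g: "g \<in> linear_maps ?N ?N"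
    and conj: "\<And>b d. b \<in> basis ?M \<Longrightarrow> d \<in> basis ?M \<Longrightarrow>
      D d * g (unit_vec (?\<theta> b)) (?\<theta> d) = D b * f (unit_vec b) d"
  let ?F = "\<lambda>b. f (unit_vec b)" and ?G = "\<lambda>b. g (unit_vec b)"
  \<comment> \<open>\<open>centralizing_shift\<close> prescribes only the ratio of each pair of
    factors; the scaling is the one for which \<open>u\<close>, \<open>v\<close> and, in the
    opposite direction, \<open>u'\<close>, \<open>v'\<close> fit the two identities for
    complements.\<close>
  define u v where "u s t = (if t = Suc s then q else 1)" and "v s t = (if t = Suc s then 1 else q)" for s t
  define u' v' where "u' s t = (if t = Suc s then 1 else 1 / q)" and "v' s t = (if t = Suc s then 1 / q else 1)" for s t
  have M: "f \<in> comodule_homs (A_deg n r q) ?M ?M \<longleftrightarrow>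
    (\<forall>\<mu>. ext_commutes n ?S ?F (weight_proj \<mu>)) \<and>
    (\<forall>s t k. adjacent n s t \<longrightarrow> ext_commutes n ?S ?F (shift s t (u s t) (v s t) k))"
    using part(3) assms(2) f by (intro ext_sum_homs_iff finX) (simp_all add: u_def v_def)
  have N: "g \<in> comodule_homs (A_deg n (n * m - r) q) ?N ?N \<longleftrightarrow>
    (\<forall>\<mu>. ext_commutes n ?S' ?G (weight_proj \<mu>)) \<and>
    (\<forall>s t k. adjacent n s t \<longrightarrow> ext_commutes n ?S' ?G (shift s t (u' s t) (v' s t) k))"
    using sum' assms(2) g by (intro ext_sum_homs_iff finX) (simp_all add: u'_def v'_def)
  have GF: "D d * ?G (?\<theta> b) (?\<theta> d) = D b * ?F b d" if "b \<in> ?S" "d \<in> ?S" for b d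
    using conj that unfolding basis_ext_sum by blast
  have weight: "(\<forall>\<mu>. ext_commutes n ?S ?F (weight_proj \<mu>)) \<longleftrightarrow> (\<forall>\<mu>. ext_commutes n ?S' ?G (weight_proj \<mu>))"
  proof -
    have S': "?S' = ?\<theta> ` ?S"
      using bij by (simp add: bij_betw_def)
    have "?G (?\<theta> b) (?\<theta> d) \<noteq> 0 \<longleftrightarrow> ?F b d \<noteq> 0" if "b \<in> ?S" "d \<in> ?S" for b d
      using GF[OF that] D0 by (metis mult_eq_0_iff)
    moreover have "mset (flat (snd (?\<theta> b))) = mset (flat (snd (?\<theta> d)))
        \<longleftrightarrow> mset (flat (snd b)) = mset (flat (snd d))" if "b \<in> ?S" "d \<in> ?S" for b d
    proof -
      have "fst b \<in> X" "snd b \<in> blocks n (fst b)" "fst d \<in> X" "snd d \<in> blocks n (fst d)"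
        using that by (auto simp: sum_blocks_def)
      then show ?thesis
        using mset_flat_complements[of "snd b" n "fst b" "snd d" "fst d"] part(2)
        by (simp add: case_prod_beta mset_map)
    qed
    ultimately have "(\<forall>b\<in>?S. \<forall>d\<in>?S. ?F b d \<noteq> 0 \<longrightarrow> mset (flat (snd b)) = mset (flat (snd d)))
      \<longleftrightarrow> (\<forall>b\<in>?S. \<forall>d\<in>?S. ?G (?\<theta> b) (?\<theta> d) \<noteq> 0 \<longrightarrow>
        mset (flat (snd (?\<theta> b))) = mset (flat (snd (?\<theta> d))))"
      by (intro ball_cong refl) (simp only:)
    then show ?thesis
      unfolding ext_commutes_weight_proj[OF finX] unfolding S' Set.ball_simps(9) .
  qed
  have shift: "ext_commutes n ?S ?F (shift s t (u s t) (v s t) k)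
      \<longleftrightarrow> ext_commutes n ?S' ?G (shift t s (u' t s) (v' t s) k)" if st: "adjacent n s t" for s t k
  proof (rule ext_commutes_conjugate[OF bij, where D = D])
    \<comment> \<open>The scalars of the raising and lowering identities for complements. Since
      every partition in X has length m, they are the same for all summands.\<close>
    let ?z = "if t = Suc s then 1 else q ^ (m choose 2)"
    let ?z' = "if t = Suc s then q ^ (k choose 2) else q ^ (m - k choose 2)"
    show "?z \<noteq> 0" "?z' \<noteq> 0" using assms(2) by auto
    fix b d assume b: "b \<in> ?S" and d: "d \<in> ?S"
    obtain \<alpha> I \<beta> J where bI: "b = (\<alpha>, I)" "\<alpha> \<in> X" "I \<in> blocks n \<alpha>"
      and dJ: "d = (\<beta>, J)" "\<beta> \<in> X" "J \<in> blocks n \<beta>"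
      using b d by (auto simp: sum_blocks_def)
    show "?z * D d * ext_entry n (shift t s (u' t s) (v' t s) k) (?\<theta> b) (?\<theta> d)
        = ?z' * D b * ext_entry n (shift s t (u s t) (v s t) k) b d"
    proof (cases "\<alpha> = \<beta>")
      case True
      have len: "length I = m" "length I = length J"
        using length_blocks[OF bI(3)] length_blocks[OF dJ(3)] part(2) bI(2) dJ(2) by simp_all
      have sub: "\<forall>B\<in>set I \<union> set J. B \<subseteq> {1..n}"
        using blocks_subset[OF bI(3)] blocks_subset[OF dJ(3)] by blast
      have adj: "t = Suc s \<or> s = Suc t" "t \<in> {1..n}" "s = Suc t \<or> t = Suc s" "s \<in> {1..n}"
        using st by (auto simp: adjacent_def)
      have e: "ext n (shift s t (u s t) (v s t) k) I J = block_shift s t (u s t) (v s t) k I J"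
        using ext_shift[OF adj(1,2) bI(3), of J] dJ(3) True by simp
      have e': "ext n (shift t s (u' t s) (v' t s) k) (complements n I) (complements n J)
          = block_shift t s (u' t s) (v' t s) k (complements n I) (complements n J)"
        using ext_shift[OF adj(3,4) complements_in_blocks[OF bI(3)], of "complements n J"]
          complements_in_blocks[OF dJ(3)] True by simp
      show ?thesis
      proof (cases "t = Suc s")
        case t: True
        then show ?thesis
          using block_shift_complements_up[OF assms(2) len(2) sub, of s k] adj True
          unfolding bI(1) dJ(1) ext_entry_def prod.case fst_conv snd_conv e e'
          by (simp add: D_def u_def v_def u'_def v'_def mult_ac)
      next
        case False
        then have s: "s = Suc t" using adj by blast
        then show ?thesis
          using block_shift_complements_down[OF assms(2) len(2) sub, of t k] adj True len(1)
          unfolding bI(1) dJ(1) ext_entry_def prod.case fst_conv snd_conv e e'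
          by (simp add: D_def u_def v_def u'_def v'_def mult_ac)
      qed
    qed (simp add: bI(1) dJ(1) ext_entry_def)
  qed (use D0 GF in auto)
  \<comment> \<open>Single conditions correspond with s and t interchanged; \<open>adjacent\<close>
    is symmetric, so the two families correspond as a whole.\<close>
  have "(\<forall>s t k. adjacent n s t \<longrightarrow> ext_commutes n ?S ?F (shift s t (u s t) (v s t) k))
    \<longleftrightarrow> (\<forall>s t k. adjacent n s t \<longrightarrow> ext_commutes n ?S' ?G (shift s t (u' s t) (v' s t) k))"
    using shift by (metis adjacent_def)
  then show "f \<in> comodule_homs (A_deg n r q) ?M ?M \<longleftrightarrow> g \<in> comodule_homs (A_deg n (n * m - r) q) ?N ?N"
    unfolding M N weight by simp
qed

end
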